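(* Let $d\ge2$ and let $m,k>0$ be fixed. If $u$ is a compactly supported solution in $\mathbb{R}^d$ of $$\Delta u=m\,\mathbb{I}_{\{0<u<k\}}-\delta_0,$$ then $u$ is unique (any two compactly supported solutions coincide) and $u$ is spherically symmetric.
   Context: $\Delta$ is the Laplace operator on $\mathbb{R}^d$, $\mathbb{I}$ denotes the characteristic function of a set, $\delta_0$ is the Dirac delta at the origin, and the equation is understood in the sense of distributions in $\mathbb{R}^d$. *)

theory Defs
  imports "HOL-Analysis.Analysis"
begin

definition partial_derivative :: "'d::finite \<Rightarrow> (real^'d \<Rightarrow> real) \<Rightarrow> real^'d \<Rightarrow> real" where
  "partial_derivative i f x = frechet_derivative f (at x) (axis i 1)"

fun times_cont_diff :: "nat \<Rightarrow> (real^'d::finite \<Rightarrow> real) \<Rightarrow> bool" where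
  "times_cont_diff 0 f \<longleftrightarrow> continuous_on UNIV f"
| "times_cont_diff (Suc n) f \<longleftrightarrow>
     (\<forall>x. f differentiable (at x)) \<and> (\<forall>i. times_cont_diff n (partial_derivative i f))"

definition laplacian :: "(real^'d::finite \<Rightarrow> real) \<Rightarrow> real^'d \<Rightarrow> real" where
  "laplacian f x = (\<Sum>i\<in>UNIV. partial_derivative i (partial_derivative i f) x)"

definition test_function :: "(real^'d::finite \<Rightarrow> real) \<Rightarrow> bool" where
  "test_function \<phi> \<longleftrightarrow> (\<forall>n. times_cont_diff n \<phi>) \<and> compact (closure {x. \<phi> x \<noteq> 0})"

text \<open>Distributions are represented by functionals of which only the values on test functions
  matter. Since everything is real-valued, real test functions suffice.\<close>

type_synonym 'd functional = "(real^'d \<Rightarrow> real) \<Rightarrow> real"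

definition distr_eq :: "'d::finite functional \<Rightarrow> 'd functional \<Rightarrow> bool" where
  "distr_eq S T \<longleftrightarrow> (\<forall>\<phi>. test_function \<phi> \<longrightarrow> S \<phi> = T \<phi>)"

definition regular_distr :: "(real^'d::finite \<Rightarrow> real) \<Rightarrow> 'd functional" where
  "regular_distr f \<phi> = (LINT x|lebesgue. f x * \<phi> x)"

definition dirac_delta :: "real^'d::finite \<Rightarrow> 'd functional" where
  "dirac_delta a \<phi> = \<phi> a"

definition distr_laplacian :: "'d::finite functional \<Rightarrow> 'd functional" where
  "distr_laplacian T \<phi> = T (laplacian \<phi>)"

definition locally_integrable :: "(real^'d::finite \<Rightarrow> real) \<Rightarrow> bool" where
  "locally_integrable f \<longleftrightarrow> (\<forall>K. compact K \<longrightarrow> f absolutely_integrable_on K)"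

definition is_solution :: "real \<Rightarrow> real \<Rightarrow> (real^'d::finite \<Rightarrow> real) \<Rightarrow> bool" where
  "is_solution m k u \<longleftrightarrow>
     locally_integrable u \<and>
     distr_eq (distr_laplacian (regular_distr u))
       (\<lambda>\<phi>. m * regular_distr (indicator {x. 0 < u x \<and> u x < k}) \<phi> - dirac_delta 0 \<phi>)"

text \<open>A locally integrable function is determined by its distribution only up to null sets, so
  the following notions (like uniqueness of solutions) are understood almost everywhere.\<close>

definition compactly_supported :: "(real^'d::finite \<Rightarrow> real) \<Rightarrow> bool" where
  "compactly_supported u \<longleftrightarrow> (\<exists>K. compact K \<and> (AE x in lebesgue. x \<notin> K \<longrightarrow> u x = 0))"

definition spherically_symmetric :: "(real^'d::finite \<Rightarrow> real) \<Rightarrow> bool" where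
  "spherically_symmetric u \<longleftrightarrow> (\<exists>g :: real \<Rightarrow> real. AE x in lebesgue. u x = g (norm x))"

end

(* Write kappa = 1/(m vol B_1). For every r >= 0 there is an explicit radial function V_r with compact
   support and Delta V_r = m I_{r < |x| < R} - delta_0, R^d = r^d + kappa. If {u >= k} lies in B_r then
   Delta(u - V_r) >= 0 where u > V_r, so u <= V_r; if B_r lies in {u >= k} then V_r <= u for the same
   reason. Applied to the smallest ball containing {u >= k} (radius r_2) and the largest ball contained
   in it (radius r_1), this gives V_{r_2} >= k inside B_{r_2} and V_{r_1} < k outside B_{r_1}. The value of
   V_r on the sphere of radius r is strictly decreasing in r, so r_2 <= r_1. Hence {u >= k} is a ball and
   u = V_r, and r is determined by m, k and d.

   The comparison is Kato's inequality. It is proved for mollifications with second differences in place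
   of derivatives. The Dirac mass never enters, because it cancels in u - V_r. *)

theory Submission
  imports Defs
begin

section \<open>Test functions\<close>

text \<open>Two solutions cannot be compared directly: the right-hand side jumps down where u passes
  k, the wrong direction for a maximum principle. Once {u >= k} is replaced by a fixed ball, what
  remains is monotone, and u can be compared with the solution belonging to that ball. The constant
  kappa expresses conservation of charge: a compactly supported potential needs m vol{r < |x| < R} =
  1. Monotonicity in r of the value on the sphere comes from the variable y = \<rho>^d - r^d: the
  mass still to come is m vol(B_1) (kappa - y) for every r, while the sphere that carries the flux
  grows with r, so the potential climbs less on the way in. The potential of a ball of radius a is a
  superposition of truncated paraboloids max 0 (b^2 - |x|^2) with 0 < b <= a; scaling, Fubini and
  the fundamental theorem of calculus then give its Laplacian, Dirac mass included, without surface
  integrals or estimates near the pole.\<close>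

lemma has_derivative_partial_derivative:
  fixes f :: "real^'d::finite \<Rightarrow> real"
  assumes "f differentiable (at x)"
  shows "(f has_derivative (\<lambda>h. \<Sum>i\<in>UNIV. h $ i * partial_derivative i f x)) (at x)"
proof -
  let ?D = "frechet_derivative f (at x)"
  have D: "(f has_derivative ?D) (at x)"
    using assms frechet_derivative_works by blast
  then have lin: "linear ?D"
    by (rule has_derivative_linear)
  have "?D = (\<lambda>h. \<Sum>i\<in>UNIV. h $ i * partial_derivative i f x)"
  proof
    fix h :: "real^'d"
    have "h = (\<Sum>i\<in>UNIV. h $ i *\<^sub>R axis i 1)"
      by (metis (no_types) basis_expansion scalar_mult_eq_scaleR)
    then have "?D h = ?D (\<Sum>i\<in>UNIV. h $ i *\<^sub>R axis i 1)" by simp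
    then show "?D h = (\<Sum>i\<in>UNIV. h $ i * partial_derivative i f x)"
      by (simp add: linear_sum[OF lin] linear_scale[OF lin] partial_derivative_def)
  qed
  with D show ?thesis by simp
qed

lemma partial_derivative_fun:
  "partial_derivative i f = (\<lambda>x. frechet_derivative f (at x) (axis i 1))"
  by (rule ext) (simp add: partial_derivative_def)

lemma partial_derivative_eqI:
  assumes "(f has_derivative f') (at x)"
  shows "partial_derivative i f x = f' (axis i 1)"
  using frechet_derivative_at[OF assms] by (simp add: partial_derivative_def)

lemma times_cont_diff_SucD: "times_cont_diff (Suc n) f \<Longrightarrow> times_cont_diff n f"
proof (induction n arbitrary: f)
  case 0
  then show ?case
    by (auto simp: continuous_on_eq_continuous_at differentiable_imp_continuous_within)
next
  case (Suc n)
  then show ?case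
    unfolding times_cont_diff.simps(2)[of "Suc n"] times_cont_diff.simps(2)[of n f] by blast
qed

text \<open>\<open>partial_derivative\<close> goes through the choice made by
  \<open>frechet_derivative\<close>; uniqueness of derivatives allows any explicit formula in its
  place. The smoothness inductions below run through this rule.\<close>

lemma times_cont_diff_SucI:
  assumes "\<And>x. (f has_derivative f' x) (at x)"
    and "\<And>i. times_cont_diff n (\<lambda>x. f' x (axis i 1))"
  shows "times_cont_diff (Suc n) f"
proof -
  have "partial_derivative i f = (\<lambda>x. f' x (axis i 1))" for i
    using partial_derivative_eqI[OF assms(1)] by blast
  with assms show ?thesis
    by (auto simp: differentiable_def)
qed

text \<open>The factor \<open>c\<close> is part of the statement because differentiation brings out
  a factor \<open>s\<close>, which the induction hypothesis must absorb. Rescaled kernels centred at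
  a point have this form.\<close>

lemma times_cont_diff_affine:
  assumes "times_cont_diff n g"
  shows "times_cont_diff n (\<lambda>x. c * g (s *\<^sub>R x + y))"
  using assms
proof (induction n arbitrary: g c)
  case 0
  then have "continuous_on UNIV g" by simp
  then have "continuous_on UNIV (\<lambda>x. g (s *\<^sub>R x + y))"
    by (rule continuous_on_compose2) (auto intro!: continuous_intros)
  then show ?case by (auto intro!: continuous_intros)
next
  case (Suc n)
  then have d: "\<And>x. g differentiable (at x)"
    and t: "\<And>i. times_cont_diff n (partial_derivative i g)" by auto
  show ?case
  proof (rule times_cont_diff_SucI)
    show "((\<lambda>x. c * g (s *\<^sub>R x + y)) has_derivative
       (\<lambda>h. c * (\<Sum>i\<in>UNIV. (s *\<^sub>R h) $ i * partial_derivative i g (s *\<^sub>R x + y)))) (at x)" for x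
    proof (rule has_derivative_mult_right)
      have "((\<lambda>x. s *\<^sub>R x + y) has_derivative (\<lambda>h. s *\<^sub>R h)) (at x)"
        by (auto intro!: derivative_eq_intros)
      from has_derivative_compose[OF this has_derivative_partial_derivative[OF d]]
      show "((\<lambda>x. g (s *\<^sub>R x + y)) has_derivative
       (\<lambda>h. (\<Sum>i\<in>UNIV. (s *\<^sub>R h) $ i * partial_derivative i g (s *\<^sub>R x + y)))) (at x)" .
    qed
    have "(\<Sum>j\<in>UNIV. (s *\<^sub>R axis i 1) $ j * partial_derivative j g z)
      = s * partial_derivative i g z" for i z
      by (simp add: axis_def if_distrib if_distribR cong: if_cong)
    then show "times_cont_diff n (\<lambda>x. c * (\<Sum>j\<in>UNIV. (s *\<^sub>R axis i 1) $ j * partial_derivative j g (s *\<^sub>R x + y)))"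
      for i using Suc.IH[OF t, of "c * s"] by (simp only: mult.assoc)
  qed
qed

lemma partial_derivative_affine:
  assumes "g differentiable (at (s *\<^sub>R x + y))"
  shows "partial_derivative i (\<lambda>x. c * g (s *\<^sub>R x + y)) x = c * s * partial_derivative i g (s *\<^sub>R x + y)"
proof -
  have "((\<lambda>x. s *\<^sub>R x + y) has_derivative (\<lambda>h. s *\<^sub>R h)) (at x)"
    by (auto intro!: derivative_eq_intros)
  from has_derivative_compose[OF this has_derivative_partial_derivative[OF assms]]
  have "((\<lambda>x. c * g (s *\<^sub>R x + y)) has_derivative
       (\<lambda>h. c * (\<Sum>i\<in>UNIV. (s *\<^sub>R h) $ i * partial_derivative i g (s *\<^sub>R x + y)))) (at x)"
    by (rule has_derivative_mult_right)
  from partial_derivative_eqI[OF this, of i] show ?thesis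
    by (simp add: axis_def if_distrib if_distribR cong: if_cong)
qed

lemma times_cont_diff_add:
  "times_cont_diff n f \<Longrightarrow> times_cont_diff n g \<Longrightarrow> times_cont_diff n (\<lambda>x. f x + g x)"
proof (induction n arbitrary: f g)
  case 0
  then show ?case by (auto intro!: continuous_intros)
next
  case (Suc n)
  show ?case
  proof (rule times_cont_diff_SucI)
    show "((\<lambda>x. f x + g x) has_derivative
      (\<lambda>h. frechet_derivative f (at x) h + frechet_derivative g (at x) h)) (at x)" for x
      using Suc.prems frechet_derivative_works
      by (intro has_derivative_add) auto
    show "times_cont_diff n (\<lambda>x. frechet_derivative f (at x) (axis i 1) + frechet_derivative g (at x) (axis i 1))" for i
      using Suc.IH[of "partial_derivative i f" "partial_derivative i g"] Suc.prems
      by (simp add: partial_derivative_fun)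
  qed
qed

lemma times_cont_diff_mult:
  "times_cont_diff n f \<Longrightarrow> times_cont_diff n g \<Longrightarrow> times_cont_diff n (\<lambda>x. f x * g x)"
proof (induction n arbitrary: f g)
  case 0
  then show ?case by (auto intro!: continuous_intros)
next
  case (Suc n)
  show ?case
  proof (rule times_cont_diff_SucI)
    show "((\<lambda>x. f x * g x) has_derivative
      (\<lambda>h. f x * frechet_derivative g (at x) h + frechet_derivative f (at x) h * g x)) (at x)" for x
      using Suc.prems frechet_derivative_works
      by (intro has_derivative_mult) auto
    show "times_cont_diff n (\<lambda>x. f x * frechet_derivative g (at x) (axis i 1) + frechet_derivative f (at x) (axis i 1) * g x)" for i
      using Suc.IH[of f "partial_derivative i g"] Suc.IH[of "partial_derivative i f" g] Suc.prems
        times_cont_diff_SucD[of n f] times_cont_diff_SucD[of n g]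
      by (intro times_cont_diff_add) (simp_all add: partial_derivative_fun)
  qed
qed

lemma times_cont_diff_const: "times_cont_diff n (\<lambda>x. c)"
proof (induction n arbitrary: c)
  case 0
  then show ?case by simp
next
  case (Suc n)
  show ?case
    by (rule times_cont_diff_SucI[where f' = "\<lambda>x h. 0"]) (use Suc.IH[of 0] in auto)
qed

lemma times_cont_diff_nth: "times_cont_diff n (\<lambda>x. x $ i)"
proof (cases n)
  case (Suc n')
  show ?thesis unfolding Suc
    by (rule times_cont_diff_SucI[where f' = "\<lambda>x h. h $ i"])
      (auto intro: times_cont_diff_const bounded_linear_imp_has_derivative bounded_linear_vec_nth)
qed (auto intro!: continuous_intros)

text \<open>The functions \<open>t\<^sup>-\<^sup>j exp (-1/t)\<close>, extended by zero, are closed under differentiation up to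
  linear combinations.\<close>

definition flat_exp :: "nat \<Rightarrow> real \<Rightarrow> real" where
  "flat_exp j t = (if 0 < t then (1 / t) ^ j * exp (- 1 / t) else 0)"

lemma flat_exp_tendsto_0: "((\<lambda>t. (1 / t) ^ j * exp (- 1 / t)) \<longlongrightarrow> (0::real)) (at_right 0)"
proof -
  have "((\<lambda>x::real. x ^ j / exp x) \<longlongrightarrow> 0) at_top"
    by (rule tendsto_power_div_exp_0)
  from filterlim_compose[OF this filterlim_inverse_at_top_right]
  show ?thesis by (simp add: inverse_eq_divide exp_minus field_simps)
qed

lemma flat_exp_has_derivative:
  "(flat_exp j has_real_derivative (flat_exp (j + 2) t + (- real j) * flat_exp (j + 1) t)) (at t)"
proof (cases t "0::real" rule: linorder_cases)
  case less
  have "((\<lambda>t. 0) has_real_derivative 0) (at t)" by simp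
  moreover have "eventually (\<lambda>t. 0 = flat_exp j t) (nhds t)"
    using eventually_nhds_in_open[of "{..<0}" t] less
    by (auto simp: flat_exp_def elim!: eventually_mono)
  ultimately have "(flat_exp j has_real_derivative 0) (at t)"
    by (simp only: DERIV_cong_ev[OF refl _ refl])
  then show ?thesis using less by (simp add: flat_exp_def)
next
  case equal
  have "((\<lambda>h. flat_exp j h / h) \<longlongrightarrow> 0) (at 0)"
  proof (rule filterlim_split_at)
    show "((\<lambda>h. flat_exp j h / h) \<longlongrightarrow> 0) (at_left 0)"
      by (rule Lim_transform_eventually[OF tendsto_const])
        (auto simp: eventually_at_filter flat_exp_def)
    \<comment> \<open>For \<open>h > 0\<close> division by \<open>h\<close> raises the index by one,
      so this is the known limit for \<open>Suc j\<close>.\<close>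
    show "((\<lambda>h. flat_exp j h / h) \<longlongrightarrow> 0) (at_right 0)"
      by (rule Lim_transform_eventually[OF flat_exp_tendsto_0[of "Suc j"]])
        (auto simp: eventually_at_filter flat_exp_def)
  qed
  then have "(flat_exp j has_real_derivative 0) (at 0)"
    by (simp add: DERIV_def flat_exp_def)
  then show ?thesis using equal by (simp add: flat_exp_def)
next
  case greater
  have "((\<lambda>x. x ^ j * exp (- x)) has_real_derivative (real j * x ^ (j - 1) - x ^ j) * exp (- x)) (at x)" for x
    by (auto intro!: derivative_eq_intros simp: algebra_simps)
  moreover have "((\<lambda>t. 1 / t) has_real_derivative - ((1 / t) * (1 / t))) (at t)"
    using greater by (auto intro!: derivative_eq_intros simp: power2_eq_square)
  ultimately have "((\<lambda>t. (1 / t) ^ j * exp (- (1 / t))) has_real_derivative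
      (real j * (1 / t) ^ (j - 1) - (1 / t) ^ j) * exp (- (1 / t)) * (- ((1 / t) * (1 / t)))) (at t)"
    by (rule DERIV_chain2)
  moreover have "(real j * x ^ (j - 1) - x ^ j) * e * (- (x * x)) = x ^ (j + 2) * e + (- real j) * (x ^ (j + 1) * e)"
    for x e :: real
    by (cases j) (simp_all add: algebra_simps)
  ultimately have "((\<lambda>t. (1 / t) ^ j * exp (- 1 / t)) has_real_derivative
      (flat_exp (j + 2) t + (- real j) * flat_exp (j + 1) t)) (at t)"
    using greater by (simp only: flat_exp_def if_True minus_divide_left)
  moreover have "eventually (\<lambda>t. (1 / t) ^ j * exp (- 1 / t) = flat_exp j t) (nhds t)"
    using eventually_nhds_in_open[of "{0<..}" t] greater
    by (auto simp: flat_exp_def elim!: eventually_mono)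
  ultimately show ?thesis
    by (simp only: DERIV_cong_ev[OF refl _ refl])
qed


text \<open>The square of the norm is used because it is smooth at the origin. The index
  \<open>j\<close> is general since one differentiation leads to the indices \<open>j + 1\<close>
  and \<open>j + 2\<close>.\<close>

lemma times_cont_diff_flat_exp_norm:
  "times_cont_diff n (\<lambda>x::real^'d::finite. flat_exp j (1 - (norm x)\<^sup>2))"
proof (induction n arbitrary: j)
  case 0
  have "continuous_on UNIV (flat_exp j)"
    by (intro continuous_at_imp_continuous_on ballI DERIV_isCont[OF flat_exp_has_derivative])
  moreover have "continuous_on UNIV (\<lambda>x::real^'d. 1 - (norm x)\<^sup>2)"
    by (intro continuous_intros)
  ultimately have "continuous_on UNIV (\<lambda>x::real^'d. flat_exp j (1 - (norm x)\<^sup>2))"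
    by (rule continuous_on_compose2) simp
  then show ?case by simp
next
  case (Suc n)
  define D where "D x = flat_exp (j + 2) (1 - (norm x)\<^sup>2) + (- real j) * flat_exp (j + 1) (1 - (norm x)\<^sup>2)"
    for x :: "real^'d"
  show ?case
  proof (rule times_cont_diff_SucI)
    fix x :: "real^'d"
    have "((\<lambda>x. 1 - (norm x)\<^sup>2) has_derivative (\<lambda>h. - 2 * (x \<bullet> h))) (at x)"
      unfolding power2_norm_eq_inner by (auto intro!: derivative_eq_intros simp: inner_commute)
    moreover have "(flat_exp j has_derivative (*) (D x)) (at (1 - (norm x)\<^sup>2))"
      using flat_exp_has_derivative[of j "1 - (norm x)\<^sup>2"] by (simp only: has_field_derivative_def D_def)
    ultimately show "((\<lambda>x. flat_exp j (1 - (norm x)\<^sup>2)) has_derivative (\<lambda>h. D x * (- 2 * (x \<bullet> h)))) (at x)"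
      by (rule has_derivative_compose)
  next
    fix i
    have "times_cont_diff n (\<lambda>x::real^'d. (- real j) * flat_exp (j + 1) (1 - (norm x)\<^sup>2))"
      by (rule times_cont_diff_mult[OF times_cont_diff_const[of n "- real j"] Suc.IH[of "j + 1"]])
    from times_cont_diff_add[OF Suc.IH[of "j + 2"] this]
    have D: "times_cont_diff n (\<lambda>x. D x)" by (simp only: D_def)
    have "times_cont_diff n (\<lambda>x::real^'d. - 2 * x $ i)"
      by (rule times_cont_diff_mult[OF times_cont_diff_const[of n "- 2"] times_cont_diff_nth[of n i]])
    from times_cont_diff_mult[OF D this]
    show "times_cont_diff n (\<lambda>x. D x * (- 2 * (x \<bullet> axis i 1)))"
      by (simp only: inner_axis inner_real_def mult_1_right)
  qed
qed

section \<open>Affine images, Laplacians and directional derivatives of test functions\<close>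

lemma test_functionI:
  assumes "\<And>n. times_cont_diff n \<phi>" and "\<And>x. \<phi> x \<noteq> 0 \<Longrightarrow> norm x \<le> r"
  shows "test_function \<phi>"
proof -
  have "bounded {x. \<phi> x \<noteq> 0}"
    using assms(2) by (auto simp: bounded_iff)
  with assms(1) show ?thesis
    by (simp add: test_function_def compact_eq_bounded_closed bounded_closure)
qed

lemma test_function_affine:
  assumes "test_function \<phi>" and "s \<noteq> 0"
  shows "test_function (\<lambda>x. c * \<phi> (s *\<^sub>R x + y))"
proof -
  have "bounded {x. \<phi> x \<noteq> 0}"
    using assms by (metis test_function_def bounded_closure_image compact_imp_bounded
      bounded_subset closure_subset)
  then obtain r where r: "\<And>x. \<phi> x \<noteq> 0 \<Longrightarrow> norm x \<le> r" by (auto simp: bounded_iff)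
  show ?thesis
  proof (rule test_functionI)
    show "times_cont_diff n (\<lambda>x. c * \<phi> (s *\<^sub>R x + y))" for n
      using assms by (intro times_cont_diff_affine) (simp add: test_function_def)
    fix x assume "c * \<phi> (s *\<^sub>R x + y) \<noteq> 0"
    then have "norm (s *\<^sub>R x + y) \<le> r" using r by simp
    then have "\<bar>s\<bar> * norm x \<le> r + norm y"
      using norm_triangle_ineq4[of "s *\<^sub>R x + y" y] by simp
    then show "norm x \<le> (r + norm y) / \<bar>s\<bar>"
      using assms(2) by (simp add: field_simps)
  qed
qed

lemma laplacian_affine:
  assumes "times_cont_diff 2 g"
  shows "laplacian (\<lambda>x. c * g (s *\<^sub>R x + y)) x = c * s\<^sup>2 * laplacian g (s *\<^sub>R x + y)"
proof -
  have d: "g differentiable (at z)" "partial_derivative i g differentiable (at z)" for i z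
    using assms by (simp_all add: numeral_2_eq_2)
  have "partial_derivative i (\<lambda>x. c * g (s *\<^sub>R x + y)) = (\<lambda>x. (c * s) * partial_derivative i g (s *\<^sub>R x + y))" for i
    using partial_derivative_affine[OF d(1)] by blast
  then have "partial_derivative i (partial_derivative i (\<lambda>x. c * g (s *\<^sub>R x + y))) x
      = c * s\<^sup>2 * partial_derivative i (partial_derivative i g) (s *\<^sub>R x + y)" for i
    by (simp only: partial_derivative_affine[OF d(2)]) (simp add: power2_eq_square)
  then show ?thesis
    by (simp add: laplacian_def sum_distrib_left)
qed

lemma test_function_cases:
  assumes "test_function \<phi>"
  obtains B where "0 < B" and "\<And>x. B \<le> norm x \<Longrightarrow> \<phi> x = 0"
proof -
  have "bounded {x. \<phi> x \<noteq> 0}"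
    using assms by (metis test_function_def compact_imp_bounded bounded_subset closure_subset)
  then obtain r where r: "0 < r" "\<And>x. \<phi> x \<noteq> 0 \<Longrightarrow> norm x \<le> r" by (auto simp: bounded_pos)
  show ?thesis
    by (rule that[of "r + 1"]) (use r in force)+
qed

lemma has_real_derivative_along_axis:
  assumes "f differentiable (at (z + t *\<^sub>R axis i 1))"
  shows "((\<lambda>t. f (z + t *\<^sub>R axis i 1)) has_real_derivative partial_derivative i f (z + t *\<^sub>R axis i 1)) (at t)"
proof -
  have "((\<lambda>t. z + t *\<^sub>R axis i (1::real)) has_derivative (\<lambda>h. h *\<^sub>R axis i 1)) (at t)"
    by (auto intro!: derivative_eq_intros)
  note has_derivative_compose[OF this has_derivative_partial_derivative[OF assms]]
  moreover have "(\<lambda>h. \<Sum>j\<in>UNIV. (h *\<^sub>R axis i 1) $ j * a j) = (*) (a i)" for a :: "_ \<Rightarrow> real"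
    by (rule ext) (simp add: axis_def if_distrib if_distribR mult.commute cong: if_cong)
  ultimately show ?thesis
    unfolding has_field_derivative_def by (simp only:)
qed

section \<open>Mollification in \<open>L\<^sup>1\<close>\<close>

lemma nn_integral_lborel_affine:
  fixes t :: "'a::euclidean_space"
  assumes [measurable]: "f \<in> borel_measurable borel" and c: "c \<noteq> 0"
  shows "(\<integral>\<^sup>+x. f x \<partial>lborel) = ennreal (\<bar>c\<bar> ^ DIM('a)) * (\<integral>\<^sup>+x. f (t + c *\<^sub>R x) \<partial>lborel)"
  by (subst lborel_affine[OF c, of t])
     (simp add: nn_integral_density nn_integral_distr nn_integral_cmult ennreal_power)

lemma integrable_lborel_affine:
  fixes t :: "'a::euclidean_space" and f :: "'a \<Rightarrow> real"
  assumes f: "integrable lborel f" and c: "c \<noteq> 0"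
  shows "integrable lborel (\<lambda>x. f (t + c *\<^sub>R x))"
proof -
  have [measurable]: "f \<in> borel_measurable borel" using f by auto
  have "(\<integral>\<^sup>+x. norm (f x) \<partial>lborel) = \<bar>c\<bar> ^ DIM('a) * (\<integral>\<^sup>+x. norm (f (t + c *\<^sub>R x)) \<partial>lborel)"
    using nn_integral_lborel_affine[of "\<lambda>x. ennreal (norm (f x))", OF _ c, of t] by simp
  moreover have "(\<integral>\<^sup>+x. norm (f x) \<partial>lborel) < \<infinity>"
    using f by (simp add: integrable_iff_bounded)
  moreover have "\<bar>c\<bar> ^ DIM('a) > 0" using c by simp
  ultimately show ?thesis
    by (auto simp: integrable_iff_bounded ennreal_mult_less_top ennreal_mult_eq_top_iff less_top)
qed

lemma integral_lborel_affine:
  fixes t :: "'a::euclidean_space" and f :: "'a \<Rightarrow> real"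
  assumes f: "integrable lborel f" and c: "c \<noteq> 0"
  shows "(\<integral>x. f x \<partial>lborel) = \<bar>c\<bar> ^ DIM('a) * (\<integral>x. f (t + c *\<^sub>R x) \<partial>lborel)"
  using f integrable_lborel_affine[OF f c] borel_measurable_integrable[OF f]
  by (subst lborel_affine[OF c, of t]) (simp add: integral_density integral_distr)

lemma integrable_lborel_translate:
  fixes f :: "'a::euclidean_space \<Rightarrow> real"
  assumes "integrable lborel f"
  shows "integrable lborel (\<lambda>x. f (x + t))"
  using integrable_lborel_affine[OF assms, of 1 t] by (simp add: add.commute)

lemma integral_lborel_translate:
  fixes f :: "'a::euclidean_space \<Rightarrow> real"
  assumes "integrable lborel f"
  shows "(\<integral>x. f (x + t) \<partial>lborel) = (\<integral>x. f x \<partial>lborel)"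
  using integral_lborel_affine[OF assms, of 1 t] by (simp add: add.commute)

text \<open>By translation invariance the error of replacing \<open>g\<close> by \<open>h\<close>
  enters twice, once for the shifted copy and once for the unshifted one.\<close>

lemma L1_translation_diff_le:
  fixes g h :: "'a::euclidean_space \<Rightarrow> real"
  assumes g: "integrable lborel g" and h: "integrable lborel h"
  shows "(\<integral>y. \<bar>g (y + z) - g y\<bar> \<partial>lborel)
    \<le> (\<integral>y. \<bar>h (y + z) - h y\<bar> \<partial>lborel) + 2 * (\<integral>y. \<bar>g y - h y\<bar> \<partial>lborel)"
proof -
  note gz = integrable_lborel_translate[OF g, of z]
  note hz = integrable_lborel_translate[OF h, of z]
  have gh: "integrable lborel (\<lambda>y. \<bar>g y - h y\<bar>)" using g h by simp
  note ghz = integrable_lborel_translate[OF gh, of z]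
  have "(\<integral>y. \<bar>g (y + z) - g y\<bar> \<partial>lborel)
    \<le> (\<integral>y. \<bar>h (y + z) - h y\<bar> + (\<bar>g (y + z) - h (y + z)\<bar> + \<bar>g y - h y\<bar>) \<partial>lborel)"
    using g h gz hz gh ghz by (intro integral_mono) auto
  also have "\<dots> = (\<integral>y. \<bar>h (y + z) - h y\<bar> \<partial>lborel)
      + ((\<integral>y. \<bar>g (y + z) - h (y + z)\<bar> \<partial>lborel) + (\<integral>y. \<bar>g y - h y\<bar> \<partial>lborel))"
    using g h gz hz gh ghz by (subst Bochner_Integration.integral_add, simp, simp)+ simp
  finally show ?thesis
    using integral_lborel_translate[OF gh, of z] by simp
qed

text \<open>For an open set \<open>U\<close> the positive part of the difference of the indicators tends to zero
  pointwise, and it carries half of the \<open>L\<^sup>1\<close> norm by translation invariance.\<close>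

lemma L1_translation_indicator_open:
  fixes U :: "'a::euclidean_space set"
  assumes U: "open U" "emeasure lborel U < \<infinity>" and Z: "Z \<longlonglongrightarrow> 0"
  shows "(\<lambda>n. \<integral>y. \<bar>indicator U (y + Z n) - indicator U y\<bar> \<partial>lborel) \<longlonglongrightarrow> (0::real)"
proof -
  let ?f = "indicator U :: 'a \<Rightarrow> real"
  have [measurable]: "U \<in> sets borel" using U by simp
  have f: "integrable lborel ?f" using U by simp
  note fz = integrable_lborel_translate[OF f]
  have "(\<lambda>n. \<integral>y. max 0 (?f y - ?f (y + Z n)) \<partial>lborel) \<longlonglongrightarrow> (\<integral>y. 0 \<partial>(lborel :: 'a measure))"
  proof (rule integral_dominated_convergence[where w = ?f])
    show "AE y in lborel. (\<lambda>n. max 0 (?f y - ?f (y + Z n))) \<longlonglongrightarrow> 0"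
    proof (rule AE_I2)
      fix y
      show "(\<lambda>n. max 0 (?f y - ?f (y + Z n))) \<longlonglongrightarrow> 0"
      proof (cases "y \<in> U")
        case True
        have "(\<lambda>n. y + Z n) \<longlonglongrightarrow> y + 0" by (intro tendsto_intros Z)
        then have "\<forall>\<^sub>F n in sequentially. y + Z n \<in> U"
          using True U(1) by (auto intro: topological_tendstoD)
        then have "\<forall>\<^sub>F n in sequentially. 0 = max 0 (?f y - ?f (y + Z n))"
          by (auto elim!: eventually_mono)
        then show ?thesis by (rule Lim_transform_eventually[OF tendsto_const])
      qed simp
    qed
  qed (use f in \<open>auto simp: indicator_def\<close>)
  then have "(\<lambda>n. 2 * (\<integral>y. max 0 (?f y - ?f (y + Z n)) \<partial>lborel)) \<longlonglongrightarrow> 0"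
    by (auto intro: tendsto_mult_right_zero)
  moreover have "2 * (\<integral>y. max 0 (?f y - ?f (y + z)) \<partial>lborel) = (\<integral>y. \<bar>?f (y + z) - ?f y\<bar> \<partial>lborel)" for z
  proof -
    have "(\<integral>y. \<bar>?f (y + z) - ?f y\<bar> \<partial>lborel) = (\<integral>y. 2 * max 0 (?f y - ?f (y + z)) + (?f (y + z) - ?f y) \<partial>lborel)"
      by (rule Bochner_Integration.integral_cong) (auto simp: indicator_def)
    also have "\<dots> = 2 * (\<integral>y. max 0 (?f y - ?f (y + z)) \<partial>lborel) + ((\<integral>y. ?f (y + z) \<partial>lborel) - (\<integral>y. ?f y \<partial>lborel))"
      using f fz by (subst Bochner_Integration.integral_add) (auto simp: Bochner_Integration.integral_diff)
    finally show ?thesis using integral_lborel_translate[OF f, of z] by simp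
  qed
  ultimately show ?thesis by simp
qed

text \<open>Closedness under L1 limits: it carries the property from open sets to Borel sets and
  from simple functions to integrable functions.\<close>

lemma L1_translation_approx:
  fixes g :: "'a::euclidean_space \<Rightarrow> real"
  assumes g: "integrable lborel g"
    and appr: "\<And>e. 0 < e \<Longrightarrow> \<exists>h. integrable lborel h \<and> (\<integral>y. \<bar>g y - h y\<bar> \<partial>lborel) < e \<and>
      (\<lambda>n. \<integral>y. \<bar>h (y + Z n) - h y\<bar> \<partial>lborel) \<longlonglongrightarrow> 0"
  shows "(\<lambda>n. \<integral>y. \<bar>g (y + Z n) - g y\<bar> \<partial>lborel) \<longlonglongrightarrow> 0"
proof (rule LIMSEQ_I)
  fix e :: real assume "0 < e"
  \<comment> \<open>A quarter, because \<open>L1_translation_diff_le\<close> counts the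
    approximation error twice.\<close>
  obtain h where h: "integrable lborel h" "(\<integral>y. \<bar>g y - h y\<bar> \<partial>lborel) < e / 4"
    and lim: "(\<lambda>n. \<integral>y. \<bar>h (y + Z n) - h y\<bar> \<partial>lborel) \<longlonglongrightarrow> 0"
    using appr[of "e / 4"] \<open>0 < e\<close> by auto
  obtain N where "\<And>n. n \<ge> N \<Longrightarrow> norm (\<integral>y. \<bar>h (y + Z n) - h y\<bar> \<partial>lborel) < e / 2"
    using LIMSEQ_D[OF lim, of "e / 2"] \<open>0 < e\<close> by auto
  then have "norm ((\<integral>y. \<bar>g (y + Z n) - g y\<bar> \<partial>lborel) - 0) < e" if "n \<ge> N" for n
    using L1_translation_diff_le[OF g h(1), of "Z n"] h(2) that by fastforce
  then show "\<exists>N. \<forall>n\<ge>N. norm ((\<integral>y. \<bar>g (y + Z n) - g y\<bar> \<partial>lborel) - 0) < e" by blast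
qed

text \<open>Outer regularity gives an open superset of small excess, and the measure of the excess
  is the L1 distance of the two indicators.\<close>

lemma L1_translation_indicator:
  fixes A :: "'a::euclidean_space set"
  assumes A: "A \<in> sets borel" "emeasure lborel A < \<infinity>" and Z: "Z \<longlonglongrightarrow> 0"
  shows "(\<lambda>n. \<integral>y. \<bar>indicator A (y + Z n) - indicator A y\<bar> \<partial>lborel) \<longlonglongrightarrow> (0::real)"
proof (rule L1_translation_approx)
  show "integrable lborel (indicator A :: 'a \<Rightarrow> real)" using A by simp
  fix e :: real assume "0 < e"
  obtain U where U: "open U" "A \<subseteq> U" "emeasure lborel (U - A) < e"
    using outer_regular_lborel[OF A(1) \<open>0 < e\<close>] by blast
  have [measurable]: "U \<in> sets borel" "A \<in> sets borel" using U A by auto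
  have "emeasure lborel U \<le> emeasure lborel A + emeasure lborel (U - A)"
    using U by (metis Un_Diff_cancel Un_absorb1 \<open>A \<in> sets borel\<close> \<open>U \<in> sets borel\<close>
        emeasure_subadditive sets.Diff sets_lborel)
  also have "\<dots> < \<infinity>" using U(3) A(2) by (auto simp: less_top[symmetric] ennreal_add_eq_top)
  finally have fin: "emeasure lborel U < \<infinity>" .
  have "(\<integral>y. \<bar>indicator A y - indicator U y\<bar> \<partial>lborel) = (\<integral>y. indicator (U - A) y \<partial>(lborel::'a measure) :: real)"
    using U(2) by (intro Bochner_Integration.integral_cong) (auto simp: indicator_def)
  also have "\<dots> = measure lborel (U - A)" by simp
  also have "\<dots> < e"
  proof -
    have "emeasure lborel (U - A) = ennreal (measure lborel (U - A))"
      by (rule emeasure_eq_ennreal_measure) (use U(3) in auto)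
    then show ?thesis using U(3) by (simp add: ennreal_less_iff)
  qed
  finally show "\<exists>h. integrable lborel h \<and> (\<integral>y. \<bar>indicator A y - h y\<bar> \<partial>lborel) < e \<and>
      (\<lambda>n. \<integral>y. \<bar>h (y + Z n) - h y\<bar> \<partial>lborel) \<longlonglongrightarrow> 0"
    using L1_translation_indicator_open[OF U(1) fin Z] fin by (intro exI[of _ "indicator U"]) simp
qed

lemma L1_translation_continuous:
  fixes g :: "'a::euclidean_space \<Rightarrow> real"
  assumes "integrable lborel g" and Z: "Z \<longlonglongrightarrow> 0"
  shows "(\<lambda>n. \<integral>y. \<bar>g (y + Z n) - g y\<bar> \<partial>lborel) \<longlonglongrightarrow> 0"
  using assms(1)
proof (induct rule: integrable_induct)
  case (base A c)
  have "(\<integral>y. \<bar>indicator A (y + z) *\<^sub>R c - indicator A y *\<^sub>R c\<bar> \<partial>lborel)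
    = \<bar>c\<bar> * (\<integral>y. \<bar>indicator A (y + z) - indicator A y\<bar> \<partial>lborel)" for z
    by (subst integral_mult_right_zero[symmetric], rule Bochner_Integration.integral_cong)
      (auto simp: left_diff_distrib[symmetric] abs_mult)
  then show ?case
    using L1_translation_indicator[of A Z] base Z by (auto intro: tendsto_mult_right_zero)
next
  case (add f g)
  note i = add(1,3) integrable_lborel_translate[OF add(1)] integrable_lborel_translate[OF add(3)]
  have lim: "(\<lambda>n. (\<integral>y. \<bar>f (y + Z n) - f y\<bar> \<partial>lborel) + (\<integral>y. \<bar>g (y + Z n) - g y\<bar> \<partial>lborel)) \<longlonglongrightarrow> 0"
    using tendsto_add[OF add(2,4)] by simp
  have "(\<integral>y. \<bar>f (y + z) + g (y + z) - (f y + g y)\<bar> \<partial>lborel)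
    \<le> (\<integral>y. \<bar>f (y + z) - f y\<bar> \<partial>lborel) + (\<integral>y. \<bar>g (y + z) - g y\<bar> \<partial>lborel)" for z
  proof -
    have "(\<integral>y. \<bar>f (y + z) + g (y + z) - (f y + g y)\<bar> \<partial>lborel)
      \<le> (\<integral>y. \<bar>f (y + z) - f y\<bar> + \<bar>g (y + z) - g y\<bar> \<partial>lborel)"
      using i by (intro integral_mono) auto
    also have "\<dots> = (\<integral>y. \<bar>f (y + z) - f y\<bar> \<partial>lborel) + (\<integral>y. \<bar>g (y + z) - g y\<bar> \<partial>lborel)"
      using i by (intro Bochner_Integration.integral_add) auto
    finally show ?thesis .
  qed
  then show ?case
    by (intro Lim_null_comparison[OF always_eventually lim]) auto
next
  case (lim f s)
  show ?case
  proof (rule L1_translation_approx[OF lim(5)])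
    fix e :: real assume "0 < e"
    \<comment> \<open>The induction rule provides approximations bounded by
      \<open>2 * \<bar>f y\<bar>\<close>, which gives the majorant with factor 3.\<close>
    have "(\<lambda>i. \<integral>y. \<bar>f y - s i y\<bar> \<partial>lborel) \<longlonglongrightarrow> (\<integral>y. 0 \<partial>(lborel :: 'a measure))"
    proof (rule integral_dominated_convergence[where w = "\<lambda>y. 3 * \<bar>f y\<bar>"])
      show "AE y in lborel. (\<lambda>i. \<bar>f y - s i y\<bar>) \<longlonglongrightarrow> 0"
      proof (rule AE_I2)
        fix y
        have "(\<lambda>i. \<bar>f y - s i y\<bar>) \<longlonglongrightarrow> \<bar>f y - f y\<bar>"
          by (intro tendsto_intros lim(3)) simp
        then show "(\<lambda>i. \<bar>f y - s i y\<bar>) \<longlonglongrightarrow> 0" by simp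
      qed
      show "AE y in lborel. norm \<bar>f y - s i y\<bar> \<le> 3 * \<bar>f y\<bar>" for i
      proof (rule AE_I2)
        fix y show "norm \<bar>f y - s i y\<bar> \<le> 3 * \<bar>f y\<bar>" using lim(4)[of y i] by simp
      qed
    qed (use lim(1,5) in \<open>auto\<close>)
    from LIMSEQ_D[OF this \<open>0 < e\<close>] obtain i where "(\<integral>y. \<bar>f y - s i y\<bar> \<partial>lborel) < e" by fastforce
    with lim(1,2) show "\<exists>h. integrable lborel h \<and> (\<integral>y. \<bar>f y - h y\<bar> \<partial>lborel) < e \<and>
      (\<lambda>n. \<integral>y. \<bar>h (y + Z n) - h y\<bar> \<partial>lborel) \<longlonglongrightarrow> 0" by blast
  qed
qed

text \<open>For \<open>e > 0\<close> this is the convolution of \<open>g\<close> with the kernel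
  \<open>\<theta> (x / e) / e ^ d\<close>. After the substitution \<open>e\<close> occurs only in a
  shift of \<open>g\<close>, so L1 continuity of translations applies with a fixed
  \<open>\<theta>\<close>.\<close>

definition mollify :: "('a::euclidean_space \<Rightarrow> real) \<Rightarrow> real \<Rightarrow> ('a \<Rightarrow> real) \<Rightarrow> 'a \<Rightarrow> real" where
  "mollify \<theta> e g y = (\<integral>s. g (y - e *\<^sub>R s) * \<theta> s \<partial>lborel)"

lemma borel_measurable_mollify [measurable]:
  assumes [measurable]: "g \<in> borel_measurable borel" "\<theta> \<in> borel_measurable borel"
  shows "mollify \<theta> e g \<in> borel_measurable borel"
  unfolding mollify_def by measurable

lemma integrable_bounded_mult:
  fixes f g :: "'a \<Rightarrow> real"
  assumes "integrable M f" and "g \<in> borel_measurable M" and "\<And>x. \<bar>g x\<bar> \<le> B"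
  shows "integrable M (\<lambda>x. f x * g x)"
proof (rule Bochner_Integration.integrable_bound[of _ "\<lambda>x. B * f x"])
  have "norm (f x * g x) \<le> norm (B * f x)" for x
    using mult_right_mono[OF order_trans[OF assms(3)[of x] abs_ge_self], of "\<bar>f x\<bar>"]
    by (simp add: abs_mult mult.commute)
  then show "AE x in M. norm (f x * g x) \<le> norm (B * f x)" by simp
qed (use assms in auto)

lemma integrable_mollify_integrand:
  fixes g \<theta> :: "'a::euclidean_space \<Rightarrow> real"
  assumes g: "integrable lborel g" and "\<theta> \<in> borel_measurable borel" and "\<And>s. \<bar>\<theta> s\<bar> \<le> B" and "e \<noteq> 0"
  shows "integrable lborel (\<lambda>s. g (y - e *\<^sub>R s) * \<theta> s)"
  using integrable_bounded_mult[OF integrable_lborel_affine[OF g, of "- e" y], of \<theta> B] assms by simp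

text \<open>The error is a \<open>\<theta>\<close>-weighted average of the differences
  \<open>g (y - e n *\<^sub>R s) - g y\<close>. Fubini bounds its L1 norm by the average of the
  translation modulus \<open>\<omega> (e n *\<^sub>R s)\<close>, which tends to 0 pointwise and is
  bounded by twice the norm of \<open>g\<close>.\<close>

lemma mollify_L1_tendsto:
  fixes g \<theta> :: "'a::euclidean_space \<Rightarrow> real"
  assumes g: "integrable lborel g"
    and \<theta>: "integrable lborel \<theta>" "(\<integral>s. \<theta> s \<partial>lborel) = 1" "\<And>s. 0 \<le> \<theta> s" "\<And>s. \<theta> s \<le> B"
    and e: "e \<longlonglongrightarrow> 0" "\<And>n. e n \<noteq> 0"
  shows "(\<lambda>n. \<integral>y. \<bar>mollify \<theta> (e n) g y - g y\<bar> \<partial>lborel) \<longlonglongrightarrow> 0"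
    and "integrable lborel (mollify \<theta> (e n) g)"
proof -
  have [measurable]: "g \<in> borel_measurable borel" "\<theta> \<in> borel_measurable borel" using g \<theta> by auto
  define \<omega> where "\<omega> z = (\<integral>y. \<bar>g (y - z) - g y\<bar> \<partial>lborel)" for z
  have gz: "integrable lborel (\<lambda>y. g (y - z))" for z
    using integrable_lborel_translate[OF g, of "- z"] by simp
  have \<omega>_le: "\<bar>\<omega> z\<bar> \<le> 2 * (\<integral>y. \<bar>g y\<bar> \<partial>lborel)" for z
  proof -
    have "\<omega> z \<le> (\<integral>y. \<bar>g (y - z)\<bar> + \<bar>g y\<bar> \<partial>lborel)"
      unfolding \<omega>_def using g gz[of z] by (intro integral_mono) auto
    also have "\<dots> = 2 * (\<integral>y. \<bar>g y\<bar> \<partial>lborel)"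
      using g gz[of z] integral_lborel_translate[of "\<lambda>y. \<bar>g y\<bar>" "- z"]
      by (subst Bochner_Integration.integral_add) auto
    finally show ?thesis by (simp add: \<omega>_def)
  qed
  have [measurable]: "\<omega> \<in> borel_measurable borel"
    unfolding \<omega>_def by measurable
  have pair: "integrable (lborel \<Otimes>\<^sub>M lborel) (\<lambda>(s, y). (g (y - e n *\<^sub>R s) - g y) * \<theta> s)" for n
  proof (rule lborel_pair.Fubini_integrable)
    show "(\<lambda>(s, y). (g (y - e n *\<^sub>R s) - g y) * \<theta> s) \<in> borel_measurable (lborel \<Otimes>\<^sub>M lborel)"
      by measurable
    have "integrable lborel (\<lambda>s. \<theta> s * \<omega> (e n *\<^sub>R s))"
      by (rule integrable_bounded_mult[OF \<theta>(1) _ \<omega>_le]) measurable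
    then show "integrable lborel (\<lambda>s. \<integral>y. norm (case (s, y) of (s, y) \<Rightarrow> (g (y - e n *\<^sub>R s) - g y) * \<theta> s) \<partial>lborel)"
      by (simp add: abs_mult \<omega>_def \<theta>(3) mult.commute)
    show "AE s in lborel. integrable lborel (\<lambda>y. case (s, y) of (s, y) \<Rightarrow> (g (y - e n *\<^sub>R s) - g y) * \<theta> s)"
      using g gz by auto
  qed
  have mol: "mollify \<theta> (e n) g y - g y = (\<integral>s. (g (y - e n *\<^sub>R s) - g y) * \<theta> s \<partial>lborel)" for n y
  proof -
    have "integrable lborel (\<lambda>s. g (y - e n *\<^sub>R s) * \<theta> s)"
      by (rule integrable_mollify_integrand[OF g, of _ B]) (use \<theta> e in auto)
    moreover have "integrable lborel (\<lambda>s. g y * \<theta> s)" using \<theta> by simp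
    ultimately show ?thesis
      using \<theta>(2) by (simp add: left_diff_distrib mollify_def Bochner_Integration.integral_diff)
  qed
  have idiff: "integrable lborel (\<lambda>y. mollify \<theta> (e n) g y - g y)" for n
    using lborel_pair.integrable_snd[OF pair[of n]] by (simp add: mol)
  from Bochner_Integration.integrable_add[OF idiff[of n] g]
  show "integrable lborel (mollify \<theta> (e n) g)" by simp
  have le: "(\<integral>y. \<bar>mollify \<theta> (e n) g y - g y\<bar> \<partial>lborel) \<le> (\<integral>s. \<theta> s * \<omega> (e n *\<^sub>R s) \<partial>lborel)" for n
  proof -
    have pair': "integrable (lborel \<Otimes>\<^sub>M lborel) (\<lambda>(s, y). \<bar>(g (y - e n *\<^sub>R s) - g y) * \<theta> s\<bar>)"
      using integrable_norm[OF pair[of n]] by (simp add: case_prod_unfold)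
    have "(\<integral>y. \<bar>mollify \<theta> (e n) g y - g y\<bar> \<partial>lborel)
      \<le> (\<integral>y. \<integral>s. \<bar>(g (y - e n *\<^sub>R s) - g y) * \<theta> s\<bar> \<partial>lborel \<partial>lborel)"
    proof (rule integral_mono)
      show "integrable lborel (\<lambda>y. \<bar>mollify \<theta> (e n) g y - g y\<bar>)" using idiff by simp
      show "integrable lborel (\<lambda>y. \<integral>s. \<bar>(g (y - e n *\<^sub>R s) - g y) * \<theta> s\<bar> \<partial>lborel)"
        using lborel_pair.integrable_snd[OF pair'] by simp
      show "\<bar>mollify \<theta> (e n) g y - g y\<bar> \<le> (\<integral>s. \<bar>(g (y - e n *\<^sub>R s) - g y) * \<theta> s\<bar> \<partial>lborel)" for y
        unfolding mol by (rule integral_abs_bound)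
    qed
    also have "\<dots> = (\<integral>s. \<integral>y. \<bar>(g (y - e n *\<^sub>R s) - g y) * \<theta> s\<bar> \<partial>lborel \<partial>lborel)"
      using lborel_pair.Fubini_integral[OF pair'] by simp
    also have "\<dots> = (\<integral>s. \<theta> s * \<omega> (e n *\<^sub>R s) \<partial>lborel)"
      by (simp add: abs_mult \<omega>_def \<theta>(3) mult.commute)
    finally show ?thesis .
  qed
  have "(\<lambda>n. \<integral>s. \<theta> s * \<omega> (e n *\<^sub>R s) \<partial>lborel) \<longlonglongrightarrow> (\<integral>s. 0 \<partial>(lborel :: 'a measure))"
  proof (rule integral_dominated_convergence[where w = "\<lambda>s. \<theta> s * (2 * (\<integral>y. \<bar>g y\<bar> \<partial>lborel))"])
    show "AE s in lborel. norm (\<theta> s * \<omega> (e n *\<^sub>R s)) \<le> \<theta> s * (2 * (\<integral>y. \<bar>g y\<bar> \<partial>lborel))" for n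
      using \<theta>(3) \<omega>_le by (auto simp: abs_mult intro!: mult_left_mono)
    show "AE s in lborel. (\<lambda>n. \<theta> s * \<omega> (e n *\<^sub>R s)) \<longlonglongrightarrow> 0"
    proof (rule AE_I2)
      fix s :: 'a
      have "(\<lambda>n. - (e n *\<^sub>R s)) \<longlonglongrightarrow> - (0 *\<^sub>R s)" by (intro tendsto_intros e)
      then have "(\<lambda>n. \<omega> (e n *\<^sub>R s)) \<longlonglongrightarrow> 0"
        using L1_translation_continuous[OF g, of "\<lambda>n. - (e n *\<^sub>R s)"] by (simp add: \<omega>_def)
      then show "(\<lambda>n. \<theta> s * \<omega> (e n *\<^sub>R s)) \<longlonglongrightarrow> 0" by (rule tendsto_mult_right_zero)
    qed
  qed (use \<theta> in auto)
  then have "(\<lambda>n. \<integral>s. \<theta> s * \<omega> (e n *\<^sub>R s) \<partial>lborel) \<longlonglongrightarrow> 0" by simp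
  then show "(\<lambda>n. \<integral>y. \<bar>mollify \<theta> (e n) g y - g y\<bar> \<partial>lborel) \<longlonglongrightarrow> 0"
    by (rule Lim_null_comparison[rotated]) (auto simp: le)
qed

section \<open>Second differences of test functions\<close>

lemma test_function_partial_derivative:
  assumes "test_function \<phi>"
  shows "test_function (partial_derivative i \<phi>)"
proof -
  obtain B where B: "\<And>x. B \<le> norm x \<Longrightarrow> \<phi> x = 0" using test_function_cases[OF assms] by blast
  show ?thesis
  proof (rule test_functionI)
    show "times_cont_diff n (partial_derivative i \<phi>)" for n
      using assms times_cont_diff.simps(2)[of n \<phi>] by (auto simp: test_function_def)
    fix x assume "partial_derivative i \<phi> x \<noteq> 0"
    moreover have "partial_derivative i \<phi> x = 0" if "B < norm x"
    proof -
      have "open {x::real^'a. B < norm x}" by (intro open_Collect_less continuous_intros)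
      then have "(\<phi> has_derivative (\<lambda>h. 0)) (at x)"
        by (rule has_derivative_transform_within_open[OF has_derivative_const[of 0]])
          (use that B in auto)
      from partial_derivative_eqI[OF this] show ?thesis by simp
    qed
    ultimately show "norm x \<le> B" by force
  qed
qed

lemma test_function_add:
  assumes "test_function \<phi>" and "test_function \<psi>"
  shows "test_function (\<lambda>x. \<phi> x + \<psi> x)"
proof -
  obtain A where "\<And>x. A \<le> norm x \<Longrightarrow> \<phi> x = 0" using test_function_cases[OF assms(1)] by blast
  moreover obtain B where "\<And>x. B \<le> norm x \<Longrightarrow> \<psi> x = 0" using test_function_cases[OF assms(2)] by blast
  ultimately have "\<phi> x + \<psi> x \<noteq> 0 \<Longrightarrow> norm x \<le> max A B" for x
    by (cases "A \<le> norm x"; cases "B \<le> norm x") auto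
  then show ?thesis
    using assms by (intro test_functionI[of _ "max A B"] times_cont_diff_add) (auto simp: test_function_def)
qed

lemma test_function_sum:
  fixes \<phi> :: "'i \<Rightarrow> real^'d::finite \<Rightarrow> real"
  assumes "finite I" and "\<And>i. i \<in> I \<Longrightarrow> test_function (\<phi> i)"
  shows "test_function (\<lambda>x. \<Sum>i\<in>I. \<phi> i x)"
  using assms
proof (induction I rule: finite_induct)
  case empty
  have "test_function (\<lambda>x::real^'d. 0)"
    by (rule test_functionI[OF times_cont_diff_const]) simp
  then show ?case by simp
next
  case (insert i I)
  then have "test_function (\<lambda>x. \<phi> i x + (\<Sum>i\<in>I. \<phi> i x))"
    by (intro test_function_add) auto
  with insert.hyps show ?case by simp
qed

lemma test_function_laplacian:
  assumes "test_function \<phi>"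
  shows "test_function (laplacian \<phi>)"
proof -
  have "test_function (\<lambda>x. laplacian \<phi> x)"
    unfolding laplacian_def by (intro test_function_sum test_function_partial_derivative assms) simp
  then show ?thesis by simp
qed

lemma test_function_differentiable: "test_function \<phi> \<Longrightarrow> \<phi> differentiable (at x)"
  unfolding test_function_def using times_cont_diff.simps(2)[of 0 \<phi>] by blast

lemma test_function_continuous: "test_function \<phi> \<Longrightarrow> continuous_on UNIV \<phi>"
  unfolding test_function_def using times_cont_diff.simps(1)[of \<phi>] by blast

lemma test_function_measurable: "test_function \<phi> \<Longrightarrow> \<phi> \<in> borel_measurable borel"
  by (simp add: test_function_continuous borel_measurable_continuous_onI)

lemma test_function_bounded:
  assumes "test_function \<phi>"
  obtains C where "0 < C" and "\<And>x. \<bar>\<phi> x\<bar> \<le> C"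
proof -
  obtain B where B: "0 < B" "\<And>x. B \<le> norm x \<Longrightarrow> \<phi> x = 0" using test_function_cases[OF assms] by blast
  have "bounded (\<phi> ` cball 0 B)"
    by (intro compact_imp_bounded compact_continuous_image
        continuous_on_subset[OF test_function_continuous[OF assms]]) auto
  then obtain C where C: "0 < C" "\<forall>y \<in> \<phi> ` cball 0 B. norm y \<le> C"
    unfolding bounded_pos by blast
  have "\<bar>\<phi> x\<bar> \<le> C" for x
    using C B(2)[of x] by (cases "norm x \<le> B") auto
  with C(1) show ?thesis by (rule that)
qed

lemma integrable_bounded_support:
  fixes f :: "'a::euclidean_space \<Rightarrow> real"
  assumes [measurable]: "f \<in> borel_measurable borel" and "\<And>x. \<bar>f x\<bar> \<le> B" and "\<And>x. K \<le> norm x \<Longrightarrow> f x = 0"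
  shows "integrable lborel f"
proof (rule Bochner_Integration.integrable_bound)
  show "integrable lborel (\<lambda>x. indicator (cball (0::'a) K) x *\<^sub>R B)"
    using emeasure_bounded_finite[OF bounded_cball, of "0::'a" K] by (intro integrable_indicator) simp_all
  show "AE x in lborel. norm (f x) \<le> norm (indicator (cball 0 K) x *\<^sub>R B)"
  proof (rule AE_I2)
    fix x show "norm (f x) \<le> norm (indicator (cball 0 K) x *\<^sub>R B)"
      using assms(2)[of x] assms(3)[of x] by (cases "norm x \<le> K") auto
  qed
qed simp

lemma integrable_test_function:
  assumes "test_function \<phi>"
  shows "integrable lborel \<phi>"
proof -
  obtain C where C: "\<And>x. \<bar>\<phi> x\<bar> \<le> C" using test_function_bounded[OF assms] by blast
  obtain K where K: "\<And>x. K \<le> norm x \<Longrightarrow> \<phi> x = 0" using test_function_cases[OF assms] by blast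
  show ?thesis
    by (rule integrable_bounded_support[OF test_function_measurable[OF assms] C K])
qed

text \<open>A finite combination of translates, so it makes sense for merely integrable functions,
  commutes with mollification and respects convexity pointwise; divided by \<open>h\<^sup>2\<close>
  it approximates the Laplacian.\<close>

definition second_difference :: "real \<Rightarrow> (real^'d::finite \<Rightarrow> real) \<Rightarrow> real^'d \<Rightarrow> real" where
  "second_difference h f x = (\<Sum>i\<in>UNIV. f (x + h *\<^sub>R axis i 1) + f (x - h *\<^sub>R axis i 1) - 2 * f x)"

text \<open>Second-order Maclaurin expansion of the even function \<open>f t + f (- t)\<close>,
  whose derivative vanishes at 0; a single intermediate point therefore serves both sides.\<close>

lemma second_difference_real:
  fixes f f' f'' :: "real \<Rightarrow> real"
  assumes "\<And>t. (f has_real_derivative f' t) (at t)" and "\<And>t. (f' has_real_derivative f'' t) (at t)"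
    and "0 < h"
  obtains \<xi> where "0 < \<xi>" "\<xi> < h" "f h + f (- h) - 2 * f 0 = h\<^sup>2 * ((f'' \<xi> + f'' (- \<xi>)) / 2)"
proof -
  define D where "D m = (if m = 0 then (\<lambda>t. f t + f (- t)) else if m = Suc 0 then (\<lambda>t. f' t - f' (- t))
    else (\<lambda>t. f'' t + f'' (- t)))" for m :: nat
  have "DERIV (\<lambda>t. f t + f (- t)) t :> f' t - f' (- t)" for t
    using DERIV_add[OF assms(1)[of t] assms(1)[of "- t", unfolded DERIV_mirror]] by simp
  moreover have "DERIV (\<lambda>t. f' t - f' (- t)) t :> f'' t + f'' (- t)" for t
    using DERIV_diff[OF assms(2)[of t] assms(2)[of "- t", unfolded DERIV_mirror]] by simp
  ultimately have "\<forall>m t. m < 2 \<and> 0 \<le> t \<and> t \<le> h \<longrightarrow> DERIV (D m) t :> D (Suc m) t"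
    by (auto simp: D_def less_2_cases_iff)
  from Maclaurin[OF assms(3) _ _ this, of "\<lambda>t. f t + f (- t)"]
  obtain t where "0 < t" "t < h"
    "f h + f (- h) = (\<Sum>m<2. D m 0 / fact m * h ^ m) + D 2 t / fact 2 * h ^ 2"
    by (auto simp: D_def)
  then show ?thesis
    by (intro that[of t]) (auto simp: D_def numeral_2_eq_2 field_simps)
qed

lemma second_difference_axis:
  assumes "test_function \<phi>" and "0 < h"
  obtains \<xi> where "0 < \<xi>" "\<xi> < h"
    "\<phi> (x + h *\<^sub>R axis i 1) + \<phi> (x - h *\<^sub>R axis i 1) - 2 * \<phi> x
      = h\<^sup>2 * ((partial_derivative i (partial_derivative i \<phi>) (x + \<xi> *\<^sub>R axis i 1)
        + partial_derivative i (partial_derivative i \<phi>) (x + (- \<xi>) *\<^sub>R axis i 1)) / 2)"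
proof -
  have d: "((\<lambda>t. \<psi> (x + t *\<^sub>R axis i 1)) has_real_derivative partial_derivative i \<psi> (x + t *\<^sub>R axis i 1)) (at t)"
    if "test_function \<psi>" for \<psi> t
    by (intro has_real_derivative_along_axis test_function_differentiable that)
  from second_difference_real[OF d[OF assms(1)] d[OF test_function_partial_derivative[OF assms(1)]] assms(2)]
  show ?thesis using that by auto
qed

text \<open>Uniform in the point and of order \<open>h\<^sup>2\<close>: with the pointwise limit
  below it allows dominated convergence for difference quotients of the mollifier.\<close>

lemma second_difference_bound:
  fixes \<phi> :: "real^'d::finite \<Rightarrow> real"
  assumes "test_function \<phi>"
  obtains C where "0 < C" and "\<And>h x. 0 < h \<Longrightarrow> \<bar>second_difference h \<phi> x\<bar> \<le> C * h\<^sup>2"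
proof -
  let ?P = "\<lambda>i. partial_derivative i (partial_derivative i \<phi>)"
  have "\<exists>C>0. \<forall>x. \<bar>?P i x\<bar> \<le> C" for i
    by (meson test_function_bounded test_function_partial_derivative assms)
  then obtain C where C: "\<And>i. 0 < C i" "\<And>i x. \<bar>?P i x\<bar> \<le> C i" by metis
  have half: "\<bar>(a + b) / 2\<bar> \<le> c" if "\<bar>a\<bar> \<le> c" "\<bar>b\<bar> \<le> c" for a b c :: real
    using that by (auto simp: abs_le_iff)
  have "\<bar>second_difference h \<phi> x\<bar> \<le> (\<Sum>i\<in>UNIV. C i) * h\<^sup>2" if "0 < h" for h x
  proof -
    have "\<bar>\<phi> (x + h *\<^sub>R axis i 1) + \<phi> (x - h *\<^sub>R axis i 1) - 2 * \<phi> x\<bar> \<le> C i * h\<^sup>2" for i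
    proof -
      obtain \<xi> where \<xi>: "\<phi> (x + h *\<^sub>R axis i 1) + \<phi> (x - h *\<^sub>R axis i 1) - 2 * \<phi> x
        = h\<^sup>2 * ((?P i (x + \<xi> *\<^sub>R axis i 1) + ?P i (x + (- \<xi>) *\<^sub>R axis i 1)) / 2)"
        using second_difference_axis[OF assms \<open>0 < h\<close>] by blast
      have "\<bar>(?P i (x + \<xi> *\<^sub>R axis i 1) + ?P i (x + (- \<xi>) *\<^sub>R axis i 1)) / 2\<bar> \<le> C i"
        using half[OF C(2)[of i "x + \<xi> *\<^sub>R axis i 1"] C(2)[of i "x + (- \<xi>) *\<^sub>R axis i 1"]] .
      from mult_left_mono[OF this, of "h\<^sup>2"] show ?thesis
        unfolding \<xi> abs_mult by (simp only: abs_power2 zero_le_power2 mult.commute[of "C i"])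
    qed
    then show ?thesis
      unfolding second_difference_def sum_distrib_right
      by (intro order_trans[OF sum_abs] sum_mono) auto
  qed
  moreover have "0 < (\<Sum>i\<in>UNIV. C i)" using C(1) by (intro sum_pos) auto
  ultimately show ?thesis using that by blast
qed

lemma second_difference_tendsto_laplacian:
  assumes "test_function \<phi>" and h: "h \<longlonglongrightarrow> 0" "\<And>n. 0 < h n"
  shows "(\<lambda>n. second_difference (h n) \<phi> x / (h n)\<^sup>2) \<longlonglongrightarrow> laplacian \<phi> x"
  unfolding second_difference_def laplacian_def sum_divide_distrib
proof (rule tendsto_sum)
  fix i
  let ?P = "partial_derivative i (partial_derivative i \<phi>)"
  have "\<exists>\<xi>. 0 < \<xi> \<and> \<xi> < h n \<and> \<phi> (x + h n *\<^sub>R axis i 1) + \<phi> (x - h n *\<^sub>R axis i 1) - 2 * \<phi> x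
      = (h n)\<^sup>2 * ((?P (x + \<xi> *\<^sub>R axis i 1) + ?P (x + (- \<xi>) *\<^sub>R axis i 1)) / 2)" for n
    using second_difference_axis[OF assms(1) h(2)] by metis
  then obtain \<xi> where \<xi>: "\<And>n. 0 < \<xi> n" "\<And>n. \<xi> n < h n"
    "\<And>n. \<phi> (x + h n *\<^sub>R axis i 1) + \<phi> (x - h n *\<^sub>R axis i 1) - 2 * \<phi> x
      = (h n)\<^sup>2 * ((?P (x + \<xi> n *\<^sub>R axis i 1) + ?P (x + (- \<xi> n) *\<^sub>R axis i 1)) / 2)"
    by metis
  have "\<xi> \<longlonglongrightarrow> 0"
    by (rule tendsto_sandwich[OF _ _ tendsto_const h(1)]) (auto simp: \<xi> less_imp_le)
  moreover have "isCont ?P (x + 0 *\<^sub>R axis i 1)" "isCont ?P (x + (- 0) *\<^sub>R axis i 1)"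
    using test_function_continuous[OF test_function_partial_derivative[OF test_function_partial_derivative[OF assms(1)]]]
    by (simp_all add: continuous_on_eq_continuous_at)
  ultimately have "(\<lambda>n. (?P (x + \<xi> n *\<^sub>R axis i 1) + ?P (x + (- \<xi> n) *\<^sub>R axis i 1)) / 2)
    \<longlonglongrightarrow> (?P (x + 0 *\<^sub>R axis i 1) + ?P (x + (- 0) *\<^sub>R axis i 1)) / 2"
    by (intro tendsto_intros isCont_tendsto_compose[of _ ?P]) auto
  then show "(\<lambda>n. (\<phi> (x + h n *\<^sub>R axis i 1) + \<phi> (x - h n *\<^sub>R axis i 1) - 2 * \<phi> x) / (h n)\<^sup>2) \<longlonglongrightarrow> ?P x"
    using h(2) by (simp add: \<xi>(3) less_imp_neq[symmetric] )
qed

lemma exists_mollifier: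
  obtains \<theta> :: "real^'d::finite \<Rightarrow> real" where
    "test_function \<theta>" "\<And>x. 0 \<le> \<theta> x" "\<And>x. 1 \<le> norm x \<Longrightarrow> \<theta> x = 0" "(\<integral>x. \<theta> x \<partial>lborel) = 1"
proof -
  define b where "b x = flat_exp 0 (1 - (norm x)\<^sup>2)" for x :: "real^'d"
  have pos: "0 < b x" if "norm x < 1" for x
    using that by (simp add: b_def flat_exp_def abs_square_less_1)
  have zero: "b x = 0" if "1 \<le> norm x" for x
    using that by (simp add: b_def flat_exp_def not_less)
  have nn: "0 \<le> b x" for x by (simp add: b_def flat_exp_def)
  have t: "test_function b"
    by (rule test_functionI[of _ 1])
      (use zero times_cont_diff_flat_exp_norm in \<open>auto simp: b_def[abs_def] not_le intro: ccontr less_imp_le\<close>)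
  define I where "I = (\<integral>x. b x \<partial>lborel)"
  \<comment> \<open>A vanishing integral would force \<open>b\<close>, which is positive on the open
    unit ball, to be 0 almost everywhere there.\<close>
  have "I \<noteq> 0"
  proof
    assume "I = 0"
    then have "AE x in lborel. b x = 0"
      using integral_nonneg_eq_0_iff_AE[OF integrable_test_function[OF t]] nn by (auto simp: I_def)
    then have "AE x in lborel. x \<notin> ball 0 (1::real) \<or> b x = 0" by auto
    then have "AE x in lborel. x \<notin> ball (0::real^'d) 1"
      by eventually_elim (use pos in fastforce)
    then have "emeasure lborel (ball (0::real^'d) 1) = 0"
      using AE_iff_null_sets[of "ball (0::real^'d) 1" lborel] null_setsD1 by auto
    then show False
      using content_ball_pos[of 1 "0::real^'d"] by (simp add: measure_def)
  qed
  moreover have "0 \<le> I" using nn by (simp add: I_def)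
  ultimately have I: "0 < I" by simp
  \<comment> \<open>The trivial map \<open>1 *\<^sub>R x + 0\<close> gives the normalised kernel the
    form treated by \<open>test_function_affine\<close>.\<close>
  show ?thesis
  proof (rule that[of "\<lambda>x. (1 / I) * b (1 *\<^sub>R x + 0)"])
    show "test_function (\<lambda>x. (1 / I) * b (1 *\<^sub>R x + 0))"
      by (rule test_function_affine[OF t]) simp
  qed (use I nn zero in \<open>auto simp: I_def[symmetric]\<close>)
qed

section \<open>The weak maximum principle\<close>

text \<open>Derivative of the convex function \<open>huber\<close> below and a Lipschitz substitute
  for the indicator of the positive reals: bounded, stable under L1 limits, and positive exactly
  where its argument is.\<close>

definition clamp01 :: "real \<Rightarrow> real" where "clamp01 s = min 1 (max 0 s)"

text \<open>The primitive of \<open>clamp01\<close> that vanishes at \<open>0\<close>. As a supremum over \<open>c \<in> {0..1}\<close> of the affine functions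
  \<open>c * s - c\<^sup>2 / 2\<close> it is convex.\<close>

definition huber :: "real \<Rightarrow> real" where "huber s = clamp01 s * s - (clamp01 s)\<^sup>2 / 2"

lemma clamp01_bounds: "0 \<le> clamp01 s" "clamp01 s \<le> 1" "\<bar>clamp01 s\<bar> \<le> 1"
  by (auto simp: clamp01_def)

lemma clamp01_lipschitz: "\<bar>clamp01 a - clamp01 b\<bar> \<le> \<bar>a - b\<bar>"
  by (auto simp: clamp01_def min_def max_def abs_if)

lemma clamp01_pos_iff: "0 < clamp01 s \<longleftrightarrow> 0 < s"
  by (auto simp: clamp01_def)

lemma huber_ge: "0 \<le> c \<Longrightarrow> c \<le> 1 \<Longrightarrow> c * s - c\<^sup>2 / 2 \<le> huber s"
proof -
  assume c: "0 \<le> c" "c \<le> 1"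
  let ?a = "clamp01 s"
  \<comment> \<open>\<open>?a\<close> is the projection of \<open>s\<close> to the unit interval, so
    this is the variational inequality of the projection; the two sides of the claim differ by this
    product plus half of \<open>(?a - c)\<^sup>2\<close>.\<close>
  have "0 \<le> (?a - c) * (s - ?a)"
    using c by (cases "s \<le> 0"; cases "1 \<le> s") (auto simp: clamp01_def mult_nonpos_nonpos mult_nonneg_nonneg mult_nonneg_nonpos)
  moreover have "0 \<le> (?a - c)\<^sup>2" by simp
  ultimately show ?thesis
    unfolding huber_def by (simp add: power2_eq_square algebra_simps)
qed

text \<open>The affine function of \<open>huber_ge\<close> with slope \<open>clamp01 a\<close>
  agrees with \<open>huber\<close> at \<open>a\<close>, hence it supports the graph there.\<close>

lemma huber_convex: "huber a + clamp01 a * (b - a) \<le> huber b"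
  using huber_ge[of "clamp01 a" b] clamp01_bounds[of a] by (simp add: huber_def algebra_simps)

lemma huber_0: "huber 0 = 0"
  by (simp add: huber_def clamp01_def)

lemma huber_nonneg: "0 \<le> huber s"
  using huber_ge[of 0 s] by simp

text \<open>The supporting line at \<open>s / 2\<close> already has positive slope.\<close>

lemma huber_pos: "0 < s \<Longrightarrow> 0 < huber s"
  using huber_convex[of "s / 2" s] huber_nonneg[of "s / 2"] clamp01_pos_iff[of "s / 2"]
  by (smt (verit) field_sum_of_halves mult_pos_pos)

lemma huber_lipschitz: "\<bar>huber a - huber b\<bar> \<le> \<bar>a - b\<bar>"
proof -
  have "\<bar>clamp01 s * t\<bar> \<le> \<bar>t\<bar>" for s t
    using clamp01_bounds(3)[of s] by (simp add: abs_mult mult_left_le_one_le)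
  from this[of a "b - a"] this[of b "a - b"] show ?thesis
    using huber_convex[of a b] huber_convex[of b a] by linarith
qed

lemma huber_le: "\<bar>huber s\<bar> \<le> \<bar>s\<bar>"
  using huber_lipschitz[of s 0] by (simp add: huber_0)

lemma borel_measurable_clamp01 [measurable]: "clamp01 \<in> borel_measurable borel"
  unfolding clamp01_def[abs_def] by measurable

lemma borel_measurable_huber [measurable]: "huber \<in> borel_measurable borel"
  unfolding huber_def[abs_def] by measurable

text \<open>Exact for every step size because the function is quadratic, so the negative constant
  survives the limit in \<open>h\<close> without a remainder estimate.\<close>

lemma second_difference_paraboloid:
  "second_difference h (\<lambda>y::real^'d::finite. A - (norm y)\<^sup>2) y = - 2 * real CARD('d) * h\<^sup>2"
proof -
  have "(A - (norm (y + h *\<^sub>R axis i 1))\<^sup>2) + (A - (norm (y - h *\<^sub>R axis i 1))\<^sup>2) - 2 * (A - (norm y)\<^sup>2) = - 2 * h\<^sup>2"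
    for i :: 'd
    unfolding power2_norm_eq_inner
    by (simp add: inner_simps inner_commute power2_eq_square inner_axis_axis algebra_simps)
  then show ?thesis by (simp add: second_difference_def)
qed

text \<open>Discrete Kato inequality. The supporting lines of \<open>huber\<close> give
  \<open>clamp01 (W y) * second_difference h W y \<le> second_difference h G y\<close> with
  \<open>G y = huber (W y)\<close>; summation by parts then moves the second difference to the
  paraboloid, where it is a negative constant.\<close>

lemma integral_paraboloid_huber_le:
  fixes W :: "real^'d::finite \<Rightarrow> real"
  assumes W: "integrable lborel W" and supp: "\<And>y. L \<le> norm y \<Longrightarrow> W y = 0" and h: "0 < h" "h \<le> 1" and L: "0 < L"
  shows "(\<integral>y. ((L + 1)\<^sup>2 - (norm y)\<^sup>2) * clamp01 (W y) * second_difference h W y \<partial>lborel)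
    \<le> - 2 * real CARD('d) * h\<^sup>2 * (\<integral>y. huber (W y) \<partial>lborel)"
proof -
  \<comment> \<open>The radius \<open>L + 1\<close> exceeds that of the support by the largest step,
    so wherever the weight is negative both \<open>W\<close> and its shifted copies vanish.\<close>
  define \<phi> where "\<phi> y = (L + 1)\<^sup>2 - (norm y)\<^sup>2" for y :: "real^'d"
  define G where "G y = huber (W y)" for y
  have [measurable]: "W \<in> borel_measurable borel" using W by auto
  have [measurable]: "\<phi> \<in> borel_measurable borel" unfolding \<phi>_def by measurable
  have [measurable]: "G \<in> borel_measurable borel" unfolding G_def by measurable
  have G: "integrable lborel G"
    by (rule Bochner_Integration.integrable_bound[OF W]) (auto simp: G_def huber_le)
  have Gsupp: "L \<le> norm y \<Longrightarrow> G y = 0" for y by (simp add: G_def supp huber_0)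
  have \<phi>_bound: "\<bar>\<phi> y\<bar> \<le> (L + 1)\<^sup>2" if "norm y \<le> L + 1" for y
  proof -
    have "(norm y)\<^sup>2 \<le> (L + 1)\<^sup>2" using that by (intro power_mono) auto
    then show ?thesis by (simp add: \<phi>_def)
  qed
  have \<phi>_nonneg: "0 \<le> \<phi> y" if "norm y \<le> L + 1" for y
    using that unfolding \<phi>_def by (simp add: power_mono)
  have shift: "norm (y + z) \<ge> L" "norm y \<ge> L" if "norm z \<le> 1" "\<not> norm y \<le> L + 1" for y z :: "real^'d"
    using norm_triangle_ineq4[of "y + z" z] that by auto
  have i\<phi>G: "integrable lborel (\<lambda>y. \<phi> y * G (y + z))" if "norm z \<le> 1" for z
  proof -
    have "integrable lborel (\<lambda>y. G (y + z) * (\<phi> y * indicator (cball 0 (L + 1)) y))"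
      by (rule integrable_bounded_mult[OF integrable_lborel_translate[OF G], where B = "(L + 1)\<^sup>2"])
        (use \<phi>_bound in \<open>auto simp: indicator_def\<close>)
    moreover have "G (y + z) * (\<phi> y * indicator (cball 0 (L + 1)) y) = \<phi> y * G (y + z)" for y
      using Gsupp shift[OF that, of y] by (cases "norm y \<le> L + 1") auto
    ultimately show ?thesis by simp
  qed
  have iG\<phi>: "integrable lborel (\<lambda>y. \<phi> (y - z) * G y)" "(\<integral>y. \<phi> y * G (y + z) \<partial>lborel) = (\<integral>y. \<phi> (y - z) * G y \<partial>lborel)"
    if "norm z \<le> 1" for z
    using integrable_lborel_translate[OF i\<phi>G[OF that], of "- z"]
      integral_lborel_translate[OF i\<phi>G[OF that], of "- z"] by simp_all
  have na: "norm (h *\<^sub>R axis i (1::real) :: real^'d) \<le> 1" for i using h by simp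
  have na': "norm (- (h *\<^sub>R axis i (1::real)) :: real^'d) \<le> 1" for i using h by simp
  have i0: "integrable lborel (\<lambda>y. \<phi> y * G y)" using i\<phi>G[of 0] by simp
  have iterm: "integrable lborel (\<lambda>y. \<phi> y * G (y + h *\<^sub>R axis i 1) + \<phi> y * G (y - h *\<^sub>R axis i 1) - 2 * (\<phi> y * G y))" for i
    using i\<phi>G[OF na[of i]] i\<phi>G[OF na'[of i]] i0 by simp
  have iD: "integrable lborel (\<lambda>y. \<phi> y * second_difference h G y)"
  proof -
    have "\<phi> y * second_difference h G y
      = (\<Sum>i\<in>UNIV. \<phi> y * G (y + h *\<^sub>R axis i 1) + \<phi> y * G (y - h *\<^sub>R axis i 1) - 2 * (\<phi> y * G y))" for y
      by (simp add: second_difference_def sum_distrib_left algebra_simps)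
    then show ?thesis using iterm by simp
  qed
  have eq: "(\<integral>y. \<phi> y * second_difference h G y \<partial>lborel) = - 2 * real CARD('d) * h\<^sup>2 * (\<integral>y. G y \<partial>lborel)"
  proof -
    have "(\<integral>y. \<phi> y * second_difference h G y \<partial>lborel)
      = (\<Sum>i\<in>UNIV. \<integral>y. \<phi> y * G (y + h *\<^sub>R axis i 1) + \<phi> y * G (y - h *\<^sub>R axis i 1) - 2 * (\<phi> y * G y) \<partial>lborel)"
      by (subst Bochner_Integration.integral_sum[symmetric], rule iterm)
        (simp add: second_difference_def sum_distrib_left algebra_simps)
    \<comment> \<open>Summation by parts: invariance of Lebesgue measure moves each shift from
      \<open>G\<close> to \<open>\<phi>\<close>.\<close>
    also have "\<dots> = (\<Sum>i\<in>UNIV. \<integral>y. \<phi> (y - h *\<^sub>R axis i 1) * G y + \<phi> (y + h *\<^sub>R axis i 1) * G y - 2 * (\<phi> y * G y) \<partial>lborel)"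
    proof (rule sum.cong[OF refl])
      fix i
      show "(\<integral>y. \<phi> y * G (y + h *\<^sub>R axis i 1) + \<phi> y * G (y - h *\<^sub>R axis i 1) - 2 * (\<phi> y * G y) \<partial>lborel)
        = (\<integral>y. \<phi> (y - h *\<^sub>R axis i 1) * G y + \<phi> (y + h *\<^sub>R axis i 1) * G y - 2 * (\<phi> y * G y) \<partial>lborel)"
        using i\<phi>G[OF na[of i]] i\<phi>G[OF na'[of i]] i0 iG\<phi>[OF na[of i]] iG\<phi>[OF na'[of i]]
        by simp
    qed
    also have "\<dots> = (\<integral>y. second_difference h \<phi> y * G y \<partial>lborel)"
    proof (subst Bochner_Integration.integral_sum[symmetric])
      show "integrable lborel (\<lambda>y. \<phi> (y - h *\<^sub>R axis i 1) * G y + \<phi> (y + h *\<^sub>R axis i 1) * G y - 2 * (\<phi> y * G y))" for i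
        using i0 iG\<phi>(1)[OF na[of i]] iG\<phi>(1)[OF na'[of i]] by simp
    qed (simp only: second_difference_def sum_distrib_right left_diff_distrib distrib_right mult.assoc add.commute)
    also have "\<dots> = (\<integral>y. (- 2 * real CARD('d) * h\<^sup>2) * G y \<partial>lborel)"
      unfolding \<phi>_def second_difference_paraboloid ..
    finally show ?thesis by simp
  qed
  have iL: "integrable lborel (\<lambda>y. \<phi> y * clamp01 (W y) * second_difference h W y)"
  proof -
    have "integrable lborel (second_difference h W)"
      unfolding second_difference_def[abs_def]
      using W integrable_lborel_translate[OF W] integrable_lborel_translate[OF W, of "- _"]
      by (intro Bochner_Integration.integrable_sum Bochner_Integration.integrable_diff
          Bochner_Integration.integrable_add) (simp_all add: diff_conv_add_uminus del: add_uminus_conv_diff)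
    then have "integrable lborel (\<lambda>y. second_difference h W y * (\<phi> y * clamp01 (W y)))"
    proof (rule integrable_bounded_mult)
      show "\<bar>\<phi> y * clamp01 (W y)\<bar> \<le> (L + 1)\<^sup>2" for y
      proof (cases "norm y \<le> L + 1")
        case True
        show ?thesis
          using mult_mono[OF \<phi>_bound[OF True] clamp01_bounds(3)[of "W y"]] by (simp add: abs_mult)
      next
        case False
        then show ?thesis using supp[of y] by (simp add: clamp01_def)
      qed
    qed measurable
    then show ?thesis by (simp add: mult.commute)
  qed
  have "(\<integral>y. \<phi> y * clamp01 (W y) * second_difference h W y \<partial>lborel)
    \<le> (\<integral>y. \<phi> y * second_difference h G y \<partial>lborel)"
  proof (rule integral_mono[OF iL iD])
    fix y :: "real^'d"
    show "\<phi> y * clamp01 (W y) * second_difference h W y \<le> \<phi> y * second_difference h G y"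
    proof (cases "norm y \<le> L + 1")
      case True
      have "clamp01 (W y) * second_difference h W y \<le> second_difference h G y"
        unfolding second_difference_def sum_distrib_left
      proof (rule sum_mono)
        fix i
        show "clamp01 (W y) * (W (y + h *\<^sub>R axis i 1) + W (y - h *\<^sub>R axis i 1) - 2 * W y)
          \<le> G (y + h *\<^sub>R axis i 1) + G (y - h *\<^sub>R axis i 1) - 2 * G y"
          using huber_convex[of "W y" "W (y + h *\<^sub>R axis i 1)"] huber_convex[of "W y" "W (y - h *\<^sub>R axis i 1)"]
          by (simp add: G_def algebra_simps)
      qed
      then show ?thesis using \<phi>_nonneg[OF True] by (simp add: mult_left_mono mult.assoc)
    next
      case False
      have "W y = 0" "W (y + h *\<^sub>R axis i 1) = 0" "W (y - h *\<^sub>R axis i 1) = 0" for i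
        using shift[OF na[of i] False] shift[OF na'[of i] False] supp by simp_all
      then show ?thesis by (simp add: second_difference_def G_def)
    qed
  qed
  then show ?thesis unfolding eq by (simp add: \<phi>_def G_def[abs_def])
qed

text \<open>The mollification at \<open>y\<close> becomes a pairing of \<open>g\<close> with a
  reflected, rescaled kernel centred at \<open>y\<close>, the form in which that kernel can be
  inserted as a test function.\<close>

lemma mollify_eq_convolution:
  fixes g \<psi> :: "'a::euclidean_space \<Rightarrow> real"
  assumes g: "integrable lborel g" and \<psi>: "\<psi> \<in> borel_measurable borel" "\<And>s. \<bar>\<psi> s\<bar> \<le> B" and e: "0 < e"
  shows "mollify \<psi> e g y = (1 / e) ^ DIM('a) * (\<integral>x. g x * \<psi> ((- (1 / e)) *\<^sub>R x + (1 / e) *\<^sub>R y) \<partial>lborel)"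
proof -
  note \<psi>(1)[measurable]
  have i: "integrable lborel (\<lambda>x. g x * \<psi> ((- (1 / e)) *\<^sub>R x + (1 / e) *\<^sub>R y))"
    by (rule integrable_bounded_mult[OF g, where B = B]) (use \<psi> in auto)
  have "(\<integral>x. g x * \<psi> ((- (1 / e)) *\<^sub>R x + (1 / e) *\<^sub>R y) \<partial>lborel) = e ^ DIM('a) * mollify \<psi> e g y"
    using integral_lborel_affine[OF i, of "- e" y] e
    by (simp add: mollify_def scaleR_diff_right scaleR_add_right)
  then show ?thesis using e by (simp add: power_one_over)
qed

lemma mollify_eq_0:
  assumes "\<And>x. K \<le> norm x \<Longrightarrow> g x = 0" and "\<And>s. 1 \<le> norm s \<Longrightarrow> \<theta> s = 0"
    and "0 < e" "e \<le> 1" "K + 1 \<le> norm y"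
  shows "mollify \<theta> e g y = 0"
proof -
  have "g (y - e *\<^sub>R s) * \<theta> s = 0" for s
  proof (cases "1 \<le> norm s")
    case False
    then have "norm (e *\<^sub>R s) \<le> 1" using assms(3,4) by (simp add: mult_le_one)
    then have "K \<le> norm (y - e *\<^sub>R s)" using norm_triangle_ineq2[of y "e *\<^sub>R s"] assms(5) by linarith
    then show ?thesis using assms(1) by simp
  qed (use assms(2) in simp)
  then have "(\<lambda>s. g (y - e *\<^sub>R s) * \<theta> s) = (\<lambda>s. 0)" by (rule ext)
  then show ?thesis by (simp only: mollify_def Bochner_Integration.integral_zero)
qed

text \<open>The weak equation is tested with \<open>\<theta> ((y - x) / e)\<close>; the two
  derivatives of the rescaled kernel account for the factor \<open>e\<^sup>2\<close>.\<close>

lemma mollify_weak_laplacian: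
  fixes w f :: "real^'d::finite \<Rightarrow> real"
  assumes w: "integrable lborel w" and f: "integrable lborel f"
    and eq: "\<And>\<phi>. test_function \<phi> \<Longrightarrow> (\<integral>x. w x * laplacian \<phi> x \<partial>lborel) = (\<integral>x. f x * \<phi> x \<partial>lborel)"
    and \<theta>: "test_function \<theta>" and e: "0 < e"
  shows "mollify (laplacian \<theta>) e w y = e\<^sup>2 * mollify \<theta> e f y"
proof -
  let ?T = "\<lambda>x. 1 * \<theta> ((- (1 / e)) *\<^sub>R x + (1 / e) *\<^sub>R y)"
  have T: "test_function ?T" using \<theta> e by (intro test_function_affine) auto
  have "times_cont_diff 2 \<theta>" using \<theta> by (simp add: test_function_def)
  note lap = laplacian_affine[OF this, of 1 "- (1 / e)" "(1 / e) *\<^sub>R y"]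
  obtain B where B: "\<And>x. \<bar>\<theta> x\<bar> \<le> B" using test_function_bounded[OF \<theta>] by blast
  obtain B' where B': "\<And>x. \<bar>laplacian \<theta> x\<bar> \<le> B'"
    using test_function_bounded[OF test_function_laplacian[OF \<theta>]] by blast
  have "(\<integral>x. w x * laplacian ?T x \<partial>lborel)
    = (\<integral>x. (1 / e)\<^sup>2 * (w x * laplacian \<theta> ((- (1 / e)) *\<^sub>R x + (1 / e) *\<^sub>R y)) \<partial>lborel)"
    unfolding lap by (simp add: mult_ac)
  then have "(1 / e)\<^sup>2 * (\<integral>x. w x * laplacian \<theta> ((- (1 / e)) *\<^sub>R x + (1 / e) *\<^sub>R y) \<partial>lborel)
    = (\<integral>x. f x * \<theta> ((- (1 / e)) *\<^sub>R x + (1 / e) *\<^sub>R y) \<partial>lborel)"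
    using eq[OF T] by simp
  then show ?thesis
    unfolding mollify_eq_convolution[OF f test_function_measurable[OF \<theta>] B e]
      mollify_eq_convolution[OF w test_function_measurable[OF test_function_laplacian[OF \<theta>]] B' e]
    using e by (simp add: field_simps)
qed

text \<open>Translating the mollification by \<open>e * t\<close> amounts to translating the kernel
  by \<open>t\<close>, so the differences fall on the smooth \<open>\<theta>\<close> instead of on
  \<open>w\<close>.\<close>

lemma second_difference_mollify:
  fixes w \<theta> :: "real^'d::finite \<Rightarrow> real"
  assumes w: "integrable lborel w" and \<theta>: "test_function \<theta>" and e: "0 < e"
  shows "second_difference (e * t) (mollify \<theta> e w) y = mollify (second_difference t \<theta>) e w y"
proof -
  obtain B where B: "\<And>x. \<bar>\<theta> x\<bar> \<le> B" using test_function_bounded[OF \<theta>] by blast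
  note [measurable] = test_function_measurable[OF \<theta>]
  have i: "integrable lborel (\<lambda>s. w (y - e *\<^sub>R s) * \<theta> (s + z))" for y z
    by (rule integrable_mollify_integrand[OF w, where B = B]) (use B e in auto)
  have shift: "mollify \<theta> e w (y + (e * t) *\<^sub>R a) = (\<integral>s. w (y - e *\<^sub>R s) * \<theta> (s + t *\<^sub>R a) \<partial>lborel)" for t a
    using integral_lborel_translate[OF i[of "y + (e * t) *\<^sub>R a" 0], of "t *\<^sub>R a"]
    by (simp add: mollify_def algebra_simps)
  have "mollify (second_difference t \<theta>) e w y
    = (\<integral>s. (\<Sum>i\<in>UNIV. w (y - e *\<^sub>R s) * \<theta> (s + t *\<^sub>R axis i 1)
      + w (y - e *\<^sub>R s) * \<theta> (s + (- t) *\<^sub>R axis i 1) - 2 * (w (y - e *\<^sub>R s) * \<theta> s)) \<partial>lborel)"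
    unfolding mollify_def second_difference_def sum_distrib_left
    by (simp add: algebra_simps)
  also have "\<dots> = (\<Sum>i\<in>UNIV. mollify \<theta> e w (y + (e * t) *\<^sub>R axis i 1)
      + mollify \<theta> e w (y + (e * - t) *\<^sub>R axis i 1) - 2 * mollify \<theta> e w y)"
  proof (subst Bochner_Integration.integral_sum)
    show "integrable lborel (\<lambda>s. w (y - e *\<^sub>R s) * \<theta> (s + t *\<^sub>R axis i 1)
      + w (y - e *\<^sub>R s) * \<theta> (s + (- t) *\<^sub>R axis i 1) - 2 * (w (y - e *\<^sub>R s) * \<theta> s))" for i
      using i[of y "t *\<^sub>R axis i 1"] i[of y "(- t) *\<^sub>R axis i 1"] i[of y 0] by simp
  next
    show "(\<Sum>i\<in>UNIV. \<integral>s. w (y - e *\<^sub>R s) * \<theta> (s + t *\<^sub>R axis i 1)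
      + w (y - e *\<^sub>R s) * \<theta> (s + (- t) *\<^sub>R axis i 1) - 2 * (w (y - e *\<^sub>R s) * \<theta> s) \<partial>lborel)
      = (\<Sum>i\<in>UNIV. mollify \<theta> e w (y + (e * t) *\<^sub>R axis i 1)
      + mollify \<theta> e w (y + (e * - t) *\<^sub>R axis i 1) - 2 * mollify \<theta> e w y)"
    proof (rule sum.cong[OF refl])
      fix i
      show "(\<integral>s. w (y - e *\<^sub>R s) * \<theta> (s + t *\<^sub>R axis i 1)
      + w (y - e *\<^sub>R s) * \<theta> (s + (- t) *\<^sub>R axis i 1) - 2 * (w (y - e *\<^sub>R s) * \<theta> s) \<partial>lborel)
      = mollify \<theta> e w (y + (e * t) *\<^sub>R axis i 1)
      + mollify \<theta> e w (y + (e * - t) *\<^sub>R axis i 1) - 2 * mollify \<theta> e w y"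
        unfolding shift
        using i[of y "t *\<^sub>R axis i 1"] i[of y "(- t) *\<^sub>R axis i 1"] i[of y 0] by (simp add: mollify_def)
    qed
  qed
  also have "\<dots> = second_difference (e * t) (mollify \<theta> e w) y"
    by (simp add: second_difference_def)
  finally show ?thesis by simp
qed

text \<open>The scale \<open>e\<close> is fixed while the step \<open>t n\<close> tends to 0: the
  discrete inequality is divided by \<open>(t n)\<^sup>2\<close>, and the difference quotients of
  the kernel converge boundedly to its Laplacian, which the weak equation turns into
  \<open>f\<close>.\<close>

lemma integral_paraboloid_mollify_le:
  fixes w f :: "real^'d::finite \<Rightarrow> real"
  assumes w: "integrable lborel w" "\<And>x. K \<le> norm x \<Longrightarrow> w x = 0" and K: "0 < K"
    and f: "integrable lborel f"
    and eq: "\<And>\<phi>. test_function \<phi> \<Longrightarrow> (\<integral>x. w x * laplacian \<phi> x \<partial>lborel) = (\<integral>x. f x * \<phi> x \<partial>lborel)"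
    and \<theta>: "test_function \<theta>" "\<And>s. 1 \<le> norm s \<Longrightarrow> \<theta> s = 0" and e: "0 < e" "e \<le> 1"
    and iw: "integrable lborel (mollify \<theta> e w)"
  shows "(\<integral>y. ((K + 2)\<^sup>2 - (norm y)\<^sup>2) * clamp01 (mollify \<theta> e w y) * mollify \<theta> e f y \<partial>lborel)
    \<le> - 2 * real CARD('d) * (\<integral>y. huber (mollify \<theta> e w y) \<partial>lborel)"
proof -
  define W where "W = mollify \<theta> e w"
  \<comment> \<open>Mollification enlarges the support to radius \<open>K + 1\<close>; the second 1
    is the margin for the difference step.\<close>
  define \<phi> where "\<phi> y = ((K + 1) + 1)\<^sup>2 - (norm y)\<^sup>2" for y :: "real^'d"
  have [measurable]: "w \<in> borel_measurable borel" "\<theta> \<in> borel_measurable borel" "f \<in> borel_measurable borel"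
    using w f test_function_measurable[OF \<theta>(1)] by auto
  have [measurable]: "W \<in> borel_measurable borel" "\<phi> \<in> borel_measurable borel"
    unfolding W_def \<phi>_def by measurable
  have W0: "W y = 0" if "K + 1 \<le> norm y" for y
    unfolding W_def using w(2) \<theta>(2) e that by (rule mollify_eq_0)
  define t where "t n = 1 / real (Suc n)" for n
  have t: "0 < t n" "t n \<le> 1" "t \<longlonglongrightarrow> 0" for n
    unfolding t_def using LIMSEQ_inverse_real_of_nat by (auto simp: field_simps inverse_eq_divide)
  obtain C where C: "0 < C" "\<And>h x. 0 < h \<Longrightarrow> \<bar>second_difference h \<theta> x\<bar> \<le> C * h\<^sup>2"
    using second_difference_bound[OF \<theta>(1)] by blast
  have [measurable]: "second_difference h \<theta> \<in> borel_measurable borel" for h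
    unfolding second_difference_def[abs_def] by measurable
  define Q where "Q n = mollify (\<lambda>s. second_difference (t n) \<theta> s / (t n)\<^sup>2) e w" for n
  have q_bound: "\<bar>second_difference (t n) \<theta> s / (t n)\<^sup>2\<bar> \<le> C" for n s
    using C(2)[OF t(1), of n s] t(1)[of n] by (simp add: abs_div_pos[symmetric] field_simps)
  have SD: "second_difference (e * t n) W y = (t n)\<^sup>2 * Q n y" for n y
    unfolding W_def second_difference_mollify[OF w(1) \<theta>(1) e(1)] Q_def mollify_def
    using t(1)[of n] by simp
  have iabs: "integrable lborel (\<lambda>s. \<bar>w (y - e *\<^sub>R s)\<bar>)" for y
    using integrable_lborel_affine[OF w(1), of "- e" y] e by simp
  \<comment> \<open>Bound for every \<open>Q n\<close>: the difference quotients of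
    \<open>\<theta>\<close> are at most \<open>C\<close>, and the change of variables in
    \<open>w\<close> contributes \<open>(1 / e) ^ d\<close>.\<close>
  define M where "M = C * ((1 / e) ^ CARD('d) * (\<integral>x. \<bar>w x\<bar> \<partial>lborel))"
  have Mint: "C * (\<integral>s. \<bar>w (y - e *\<^sub>R s)\<bar> \<partial>lborel) = M" for y
    using integral_lborel_affine[of "\<lambda>x. \<bar>w x\<bar>" "- e" y] w(1) e by (simp add: M_def power_one_over)
  have Q_bound: "\<bar>Q n y\<bar> \<le> M" for n y
  proof -
    have "\<bar>Q n y\<bar> \<le> (\<integral>s. \<bar>w (y - e *\<^sub>R s) * (second_difference (t n) \<theta> s / (t n)\<^sup>2)\<bar> \<partial>lborel)"
      unfolding Q_def mollify_def by (rule integral_abs_bound)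
    also have "\<dots> \<le> (\<integral>s. C * \<bar>w (y - e *\<^sub>R s)\<bar> \<partial>lborel)"
    proof (rule integral_mono)
      show "integrable lborel (\<lambda>s. \<bar>w (y - e *\<^sub>R s) * (second_difference (t n) \<theta> s / (t n)\<^sup>2)\<bar>)"
        by (intro integrable_abs integrable_mollify_integrand[OF w(1) _ q_bound]) (use e in auto)
      show "\<bar>w (y - e *\<^sub>R s) * (second_difference (t n) \<theta> s / (t n)\<^sup>2)\<bar> \<le> C * \<bar>w (y - e *\<^sub>R s)\<bar>" for s
        unfolding abs_mult by (subst mult.commute) (rule mult_right_mono[OF q_bound abs_ge_zero])
    qed (use iabs in simp)
    finally show ?thesis using Mint by simp
  qed
  have Q_lim: "(\<lambda>n. Q n y) \<longlonglongrightarrow> e\<^sup>2 * mollify \<theta> e f y" for y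
  proof -
    have "(\<lambda>n. Q n y) \<longlonglongrightarrow> mollify (laplacian \<theta>) e w y"
      unfolding Q_def mollify_def
    proof (rule integral_dominated_convergence[where w = "\<lambda>s. C * \<bar>w (y - e *\<^sub>R s)\<bar>"])
      show "AE s in lborel. (\<lambda>n. w (y - e *\<^sub>R s) * (second_difference (t n) \<theta> s / (t n)\<^sup>2))
        \<longlonglongrightarrow> w (y - e *\<^sub>R s) * laplacian \<theta> s"
        by (intro AE_I2 tendsto_mult_left second_difference_tendsto_laplacian \<theta>(1) t)
      show "AE s in lborel. norm (w (y - e *\<^sub>R s) * (second_difference (t n) \<theta> s / (t n)\<^sup>2)) \<le> C * \<bar>w (y - e *\<^sub>R s)\<bar>" for n
        unfolding real_norm_def abs_mult
        by (rule AE_I2, subst mult.commute) (rule mult_right_mono[OF q_bound abs_ge_zero])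
      show "(\<lambda>s. w (y - e *\<^sub>R s) * laplacian \<theta> s) \<in> borel_measurable lborel"
        using test_function_measurable[OF test_function_laplacian[OF \<theta>(1)]] by measurable
    qed (use iabs in \<open>simp_all\<close>)
    moreover have "mollify (laplacian \<theta>) e w y = e\<^sup>2 * mollify \<theta> e f y"
      by (rule mollify_weak_laplacian[OF w(1) f _ \<theta>(1) e(1)]) (rule eq)
    ultimately show ?thesis by simp
  qed
  have [measurable]: "Q n \<in> borel_measurable borel" for n unfolding Q_def by measurable
  have \<phi>c: "\<bar>\<phi> y * clamp01 (W y)\<bar> \<le> (K + 2)\<^sup>2 * indicator (cball 0 (K + 1)) y" for y
  proof (cases "norm y \<le> K + 1")
    case True
    have "(norm y)\<^sup>2 \<le> (K + 2)\<^sup>2" using True by (intro power_mono) auto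
    then have "\<bar>\<phi> y\<bar> \<le> (K + 2)\<^sup>2" by (simp add: \<phi>_def add.commute[of 2])
    from mult_mono[OF this clamp01_bounds(3)[of "W y"]] show ?thesis using True by (simp add: abs_mult)
  next
    case False
    then show ?thesis using W0[of y] by (simp add: clamp01_def)
  qed
  have ic: "integrable lborel (\<lambda>y::real^'d. (K + 2)\<^sup>2 * indicator (cball 0 (K + 1)) y * M :: real)" for M
    using emeasure_bounded_finite[OF bounded_cball, of "0::real^'d" "K + 1"]
    by (intro integrable_mult_left integrable_mult_right integrable_real_indicator) auto
  have "(\<lambda>n. \<integral>y. \<phi> y * clamp01 (W y) * Q n y \<partial>lborel) \<longlonglongrightarrow> (\<integral>y. \<phi> y * clamp01 (W y) * (e\<^sup>2 * mollify \<theta> e f y) \<partial>lborel)"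
  proof (rule integral_dominated_convergence[where w = "\<lambda>y. (K + 2)\<^sup>2 * indicator (cball 0 (K + 1)) y * M"])
    show "integrable lborel (\<lambda>y::real^'d. (K + 2)\<^sup>2 * indicator (cball 0 (K + 1)) y * M)" by (rule ic)
    show "AE y in lborel. (\<lambda>n. \<phi> y * clamp01 (W y) * Q n y) \<longlonglongrightarrow> \<phi> y * clamp01 (W y) * (e\<^sup>2 * mollify \<theta> e f y)"
      by (intro AE_I2 tendsto_mult_left Q_lim)
    show "AE y in lborel. norm (\<phi> y * clamp01 (W y) * Q n y) \<le> (K + 2)\<^sup>2 * indicator (cball 0 (K + 1)) y * M" for n
    proof (rule AE_I2)
      fix y :: "real^'d"
      show "norm (\<phi> y * clamp01 (W y) * Q n y) \<le> (K + 2)\<^sup>2 * indicator (cball 0 (K + 1)) y * M"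
        unfolding real_norm_def abs_mult[of _ "Q n y"]
        by (rule mult_mono[OF \<phi>c Q_bound]) auto
    qed
  qed measurable
  moreover have "(\<integral>y. \<phi> y * clamp01 (W y) * Q n y \<partial>lborel) \<le> - 2 * real CARD('d) * e\<^sup>2 * (\<integral>y. huber (W y) \<partial>lborel)" for n
  proof -
    have "(\<integral>y. \<phi> y * clamp01 (W y) * second_difference (e * t n) W y \<partial>lborel)
      \<le> - 2 * real CARD('d) * (e * t n)\<^sup>2 * (\<integral>y. huber (W y) \<partial>lborel)"
      unfolding \<phi>_def
      using iw W0 e t(1,2)[of n] K
      by (intro integral_paraboloid_huber_le) (auto simp: W_def intro: mult_le_one less_imp_le)
    moreover have "(\<integral>y. \<phi> y * clamp01 (W y) * second_difference (e * t n) W y \<partial>lborel)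
      = (t n)\<^sup>2 * (\<integral>y. \<phi> y * clamp01 (W y) * Q n y \<partial>lborel)"
      unfolding SD by (subst integral_mult_right_zero[symmetric]) (simp add: mult_ac)
    ultimately have "(t n)\<^sup>2 * (\<integral>y. \<phi> y * clamp01 (W y) * Q n y \<partial>lborel)
      \<le> (t n)\<^sup>2 * (- 2 * real CARD('d) * e\<^sup>2 * (\<integral>y. huber (W y) \<partial>lborel))"
      by (simp add: power_mult_distrib mult_ac)
    then show ?thesis using t(1)[of n] by (subst (asm) mult_le_cancel_left_pos) auto
  qed
  ultimately have "(\<integral>y. \<phi> y * clamp01 (W y) * (e\<^sup>2 * mollify \<theta> e f y) \<partial>lborel)
    \<le> - 2 * real CARD('d) * e\<^sup>2 * (\<integral>y. huber (W y) \<partial>lborel)"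
    by (intro LIMSEQ_le_const2) auto
  moreover have "(\<integral>y. \<phi> y * clamp01 (W y) * (e\<^sup>2 * mollify \<theta> e f y) \<partial>lborel)
    = e\<^sup>2 * (\<integral>y. \<phi> y * clamp01 (W y) * mollify \<theta> e f y \<partial>lborel)"
    by (subst integral_mult_right_zero[symmetric]) (simp add: mult_ac)
  ultimately have "e\<^sup>2 * (\<integral>y. \<phi> y * clamp01 (W y) * mollify \<theta> e f y \<partial>lborel)
    \<le> e\<^sup>2 * (- 2 * real CARD('d) * (\<integral>y. huber (W y) \<partial>lborel))"
    by (simp add: mult_ac)
  then have "(\<integral>y. \<phi> y * clamp01 (W y) * mollify \<theta> e f y \<partial>lborel) \<le> - 2 * real CARD('d) * (\<integral>y. huber (W y) \<partial>lborel)"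
    using e(1) by (subst (asm) mult_le_cancel_left_pos) auto
  then show ?thesis by (simp add: \<phi>_def W_def add.commute[of 2])
qed

text \<open>Kato's inequality \<open>\<Delta> H(w) \<ge> H'(w) \<Delta> w\<close> for a convex \<open>H\<close>, tested against a concave paraboloid that is
  nonnegative on the support.\<close>

lemma weak_maximum_principle:
  fixes w f :: "real^'d::finite \<Rightarrow> real"
  assumes w: "integrable lborel w" "\<And>x. K \<le> norm x \<Longrightarrow> w x = 0"
    and f: "f \<in> borel_measurable borel" "\<And>x. \<bar>f x\<bar> \<le> B" "\<And>x. K \<le> norm x \<Longrightarrow> f x = 0"
    and eq: "\<And>\<phi>. test_function \<phi> \<Longrightarrow> (\<integral>x. w x * laplacian \<phi> x \<partial>lborel) = (\<integral>x. f x * \<phi> x \<partial>lborel)"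
    and pos: "AE x in lborel. 0 < w x \<longrightarrow> 0 \<le> f x" and K: "0 < K"
  shows "AE x in lborel. w x \<le> 0"
proof -
  have fi: "integrable lborel f" by (rule integrable_bounded_support[OF f])
  note [measurable] = f(1) borel_measurable_integrable[OF w(1)]
  have [measurable]: "w \<in> borel_measurable borel" using w by auto
  obtain \<theta> :: "real^'d \<Rightarrow> real" where \<theta>: "test_function \<theta>" "\<And>x. 0 \<le> \<theta> x" "\<And>x. 1 \<le> norm x \<Longrightarrow> \<theta> x = 0"
    "(\<integral>x. \<theta> x \<partial>lborel) = 1"
    using exists_mollifier by blast
  obtain C where C: "\<And>x. \<bar>\<theta> x\<bar> \<le> C" using test_function_bounded[OF \<theta>(1)] by blast
  have C': "\<theta> x \<le> C" for x using C[of x] by simp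
  define e where "e n = 1 / real (Suc n)" for n
  have e: "0 < e n" "e n \<le> 1" "e n \<noteq> 0" "e \<longlonglongrightarrow> 0" for n
    unfolding e_def using LIMSEQ_inverse_real_of_nat by (auto simp: field_simps inverse_eq_divide)
  define W where "W n = mollify \<theta> (e n) w" for n
  define F where "F n = mollify \<theta> (e n) f" for n
  have [measurable]: "\<theta> \<in> borel_measurable borel" using test_function_measurable[OF \<theta>(1)] .
  have [measurable]: "W n \<in> borel_measurable borel" "F n \<in> borel_measurable borel" for n
    unfolding W_def F_def by measurable
  note \<theta>i = integrable_test_function[OF \<theta>(1)]
  have W: "(\<lambda>n. \<integral>y. \<bar>W n y - w y\<bar> \<partial>lborel) \<longlonglongrightarrow> 0" "integrable lborel (W n)" for n
    unfolding W_def by (rule mollify_L1_tendsto[OF w(1) \<theta>i \<theta>(4,2) C' e(4,3)])+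
  have F: "(\<lambda>n. \<integral>y. \<bar>F n y - f y\<bar> \<partial>lborel) \<longlonglongrightarrow> 0" "integrable lborel (F n)" for n
    unfolding F_def by (rule mollify_L1_tendsto[OF fi \<theta>i \<theta>(4,2) C' e(4,3)])+
  define \<phi> where "\<phi> y = (K + 2)\<^sup>2 - (norm y)\<^sup>2" for y :: "real^'d"
  have [measurable]: "\<phi> \<in> borel_measurable borel" unfolding \<phi>_def by measurable
  have W0: "W n y = 0" if "K + 1 \<le> norm y" for n y
    unfolding W_def using w(2) \<theta>(3) e(1,2) that by (rule mollify_eq_0)
  have \<phi>_le: "\<bar>\<phi> y\<bar> \<le> (K + 2)\<^sup>2" "0 \<le> \<phi> y" if "norm y \<le> K + 1" for y
  proof -
    have "(norm y)\<^sup>2 \<le> (K + 2)\<^sup>2" using that by (intro power_mono) auto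
    then show "\<bar>\<phi> y\<bar> \<le> (K + 2)\<^sup>2" "0 \<le> \<phi> y" by (simp_all add: \<phi>_def)
  qed
  have \<phi>c: "\<bar>\<phi> y * clamp01 (v y)\<bar> \<le> (K + 2)\<^sup>2" if "\<And>y. K + 1 \<le> norm y \<Longrightarrow> v y = 0" for v :: "real^'d \<Rightarrow> real" and y
  proof (cases "norm y \<le> K + 1")
    case True
    from mult_mono[OF \<phi>_le(1)[OF True] clamp01_bounds(3)[of "v y"]] show ?thesis by (simp add: abs_mult)
  next
    case False
    then show ?thesis using that[of y] by (simp add: clamp01_def)
  qed
  have w0: "w y = 0" if "K + 1 \<le> norm y" for y using w(2) that by simp
  have iF: "integrable lborel (\<lambda>y. \<phi> y * clamp01 (W n y) * F n y)" for n
  proof -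
    have "integrable lborel (\<lambda>y. F n y * (\<phi> y * clamp01 (W n y)))"
      by (rule integrable_bounded_mult[OF F(2)], measurable, rule \<phi>c, rule W0)
    then show ?thesis by (simp add: mult.commute)
  qed
  have if': "integrable lborel (\<lambda>y. \<phi> y * clamp01 (w y) * f y)"
  proof -
    have "integrable lborel (\<lambda>y. f y * (\<phi> y * clamp01 (w y)))"
      by (rule integrable_bounded_mult[OF fi], measurable, rule \<phi>c, rule w0)
    then show ?thesis by (simp add: mult.commute)
  qed
  have iH: "integrable lborel (\<lambda>y. huber (W n y))" "integrable lborel (\<lambda>y. huber (w y))" for n
    by (rule Bochner_Integration.integrable_bound[OF W(2)[of n]], simp_all add: huber_le)
      (rule Bochner_Integration.integrable_bound[OF w(1)], simp_all add: huber_le)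
  have le: "(\<integral>y. \<phi> y * clamp01 (W n y) * F n y \<partial>lborel) \<le> - 2 * real CARD('d) * (\<integral>y. huber (W n y) \<partial>lborel)" for n
    unfolding W_def F_def \<phi>_def
    by (rule integral_paraboloid_mollify_le[OF w K fi eq \<theta>(1,3) e(1,2)]) (use W(2) in \<open>auto simp: W_def\<close>)
  have lim1: "(\<lambda>n. \<integral>y. huber (W n y) \<partial>lborel) \<longlonglongrightarrow> (\<integral>y. huber (w y) \<partial>lborel)"
  proof (rule LIM_zero_cancel, rule Lim_null_comparison[OF always_eventually W(1)], rule allI)
    fix n
    have "(\<integral>y. huber (W n y) \<partial>lborel) - (\<integral>y. huber (w y) \<partial>lborel) = (\<integral>y. huber (W n y) - huber (w y) \<partial>lborel)"
      using iH by simp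
    also have "norm \<dots> \<le> (\<integral>y. \<bar>huber (W n y) - huber (w y)\<bar> \<partial>lborel)"
      unfolding real_norm_def by (rule integral_abs_bound)
    also have "\<dots> \<le> (\<integral>y. \<bar>W n y - w y\<bar> \<partial>lborel)"
      using iH W(2) w(1) huber_lipschitz by (intro integral_mono) auto
    finally show "norm ((\<integral>y. huber (W n y) \<partial>lborel) - (\<integral>y. huber (w y) \<partial>lborel)) \<le> (\<integral>y. \<bar>W n y - w y\<bar> \<partial>lborel)" .
  qed
  have B: "0 \<le> B" using f(2)[of 0] by linarith
  have lim2: "(\<lambda>n. \<integral>y. \<phi> y * clamp01 (W n y) * F n y \<partial>lborel) \<longlonglongrightarrow> (\<integral>y. \<phi> y * clamp01 (w y) * f y \<partial>lborel)"
  proof (rule LIM_zero_cancel, rule Lim_null_comparison[OF always_eventually], rule allI)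
    fix n
    \<comment> \<open>Boundedness of \<open>f\<close> and the Lipschitz bound for
      \<open>clamp01\<close> split the difference of products into two terms that are small in L1;
      outside the ball both clamps vanish.\<close>
    have pw: "\<bar>\<phi> y * clamp01 (W n y) * F n y - \<phi> y * clamp01 (w y) * f y\<bar>
      \<le> (K + 2)\<^sup>2 * (\<bar>F n y - f y\<bar> + B * \<bar>W n y - w y\<bar>)" for y
    proof (cases "norm y \<le> K + 1")
      case True
      have "\<bar>clamp01 (W n y) * F n y - clamp01 (w y) * f y\<bar>
        = \<bar>clamp01 (W n y) * (F n y - f y) + f y * (clamp01 (W n y) - clamp01 (w y))\<bar>"
        by (simp add: algebra_simps)
      also have "\<dots> \<le> \<bar>clamp01 (W n y)\<bar> * \<bar>F n y - f y\<bar> + \<bar>f y\<bar> * \<bar>clamp01 (W n y) - clamp01 (w y)\<bar>"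
        by (rule order_trans[OF abs_triangle_ineq]) (simp add: abs_mult)
      also have "\<dots> \<le> 1 * \<bar>F n y - f y\<bar> + B * \<bar>W n y - w y\<bar>"
        using clamp01_bounds(3) clamp01_lipschitz f(2) B by (intro add_mono mult_mono) auto
      finally have "\<bar>\<phi> y\<bar> * \<bar>clamp01 (W n y) * F n y - clamp01 (w y) * f y\<bar>
        \<le> (K + 2)\<^sup>2 * (\<bar>F n y - f y\<bar> + B * \<bar>W n y - w y\<bar>)"
        using \<phi>_le(1)[OF True] by (intro mult_mono) auto
      then show ?thesis by (simp add: abs_mult[symmetric] algebra_simps)
    next
      case False
      then have "W n y = 0" "w y = 0" using W0 w0 by auto
      then show ?thesis using B by (simp add: clamp01_def)
    qed
    have "(\<integral>y. \<phi> y * clamp01 (W n y) * F n y \<partial>lborel) - (\<integral>y. \<phi> y * clamp01 (w y) * f y \<partial>lborel)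
      = (\<integral>y. \<phi> y * clamp01 (W n y) * F n y - \<phi> y * clamp01 (w y) * f y \<partial>lborel)"
      using iF if' by simp
    also have "norm \<dots> \<le> (\<integral>y. \<bar>\<phi> y * clamp01 (W n y) * F n y - \<phi> y * clamp01 (w y) * f y\<bar> \<partial>lborel)"
      unfolding real_norm_def by (rule integral_abs_bound)
    also have "\<dots> \<le> (\<integral>y. (K + 2)\<^sup>2 * (\<bar>F n y - f y\<bar> + B * \<bar>W n y - w y\<bar>) \<partial>lborel)"
      using iF if' F(2) fi W(2) w(1) pw by (intro integral_mono) auto
    also have "\<dots> = (K + 2)\<^sup>2 * ((\<integral>y. \<bar>F n y - f y\<bar> \<partial>lborel) + B * (\<integral>y. \<bar>W n y - w y\<bar> \<partial>lborel))"
      using F(2) fi W(2) w(1) by simp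
    finally show "norm ((\<integral>y. \<phi> y * clamp01 (W n y) * F n y \<partial>lborel) - (\<integral>y. \<phi> y * clamp01 (w y) * f y \<partial>lborel))
      \<le> (K + 2)\<^sup>2 * ((\<integral>y. \<bar>F n y - f y\<bar> \<partial>lborel) + B * (\<integral>y. \<bar>W n y - w y\<bar> \<partial>lborel))" .
  next
    have "(\<lambda>n. (K + 2)\<^sup>2 * ((\<integral>y. \<bar>F n y - f y\<bar> \<partial>lborel) + B * (\<integral>y. \<bar>W n y - w y\<bar> \<partial>lborel)))
      \<longlonglongrightarrow> (K + 2)\<^sup>2 * (0 + B * 0)"
      by (intro tendsto_intros F(1) W(1))
    then show "(\<lambda>n. (K + 2)\<^sup>2 * ((\<integral>y. \<bar>F n y - f y\<bar> \<partial>lborel) + B * (\<integral>y. \<bar>W n y - w y\<bar> \<partial>lborel))) \<longlonglongrightarrow> 0"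
      by simp
  qed
  \<comment> \<open>In the limit the two sides have opposite signs: the left one is nonnegative
    because \<open>f\<close> is nonnegative where \<open>w > 0\<close>, the right one is
    nonpositive. Hence \<open>huber (w y)\<close> has integral 0.\<close>
  have "(\<integral>y. \<phi> y * clamp01 (w y) * f y \<partial>lborel) \<le> - 2 * real CARD('d) * (\<integral>y. huber (w y) \<partial>lborel)"
    by (rule LIMSEQ_le[OF lim2 tendsto_mult_left[OF lim1]]) (use le in auto)
  moreover have "0 \<le> (\<integral>y. \<phi> y * clamp01 (w y) * f y \<partial>lborel)"
  proof (rule integral_nonneg_AE)
    show "AE y in lborel. 0 \<le> \<phi> y * clamp01 (w y) * f y"
      using pos
    proof eventually_elim
      case (elim y)
      show ?case
      proof (cases "0 < w y")
        case True
        then have "norm y \<le> K + 1" using w0[of y] by force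
        then show ?thesis using True elim \<phi>_le(2) clamp01_bounds(1) by simp
      next
        case False
        then show ?thesis by (simp add: clamp01_def)
      qed
    qed
  qed
  ultimately have "real CARD('d) * (\<integral>y. huber (w y) \<partial>lborel) \<le> 0" by linarith
  then have "(\<integral>y. huber (w y) \<partial>lborel) \<le> 0" by (simp add: mult_le_0_iff)
  moreover have "0 \<le> (\<integral>y. huber (w y) \<partial>lborel)" by (simp add: huber_nonneg)
  ultimately have "AE y in lborel. huber (w y) = 0"
    using integral_nonneg_eq_0_iff_AE[OF iH(2)] by (simp add: huber_nonneg)
  then show ?thesis
  proof eventually_elim
    case (elim y)
    then show ?case using huber_pos[of "w y"] by force
  qed
qed

section \<open>Potentials of balls\<close>

text \<open>On the unit ball the gradient is \<open>- 2 *\<^sub>R y\<close>, so this is a potential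
  of the radial field. It is Lipschitz across the unit sphere and can be integrated by parts without
  boundary terms.\<close>

definition cap :: "'a::euclidean_space \<Rightarrow> real" where
  "cap y = max 0 (1 - (norm y)\<^sup>2)"

lemma borel_measurable_cap [measurable]: "cap \<in> borel_measurable borel"
  unfolding cap_def[abs_def] by measurable

lemma cap_eq_0: "1 \<le> norm y \<Longrightarrow> cap y = 0"
  using power_mono[of 1 "norm y" 2] by (simp add: cap_def)

lemma cap_eq: "norm y \<le> 1 \<Longrightarrow> cap y = 1 - (norm y)\<^sup>2"
  by (simp add: cap_def abs_square_le_1)

lemma cap_bounds: "0 \<le> cap y" "\<bar>cap y\<bar> \<le> 1"
  by (auto simp: cap_def)

lemma integrable_cap: "integrable lborel (cap :: 'a::euclidean_space \<Rightarrow> real)"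
  by (rule integrable_bounded_support[OF borel_measurable_cap cap_bounds(2) cap_eq_0])

text \<open>Majorant for the difference quotients of \<open>cap\<close>; 2 is the supremum of the
  slope of the paraboloid on the unit ball.\<close>

lemma cap_lipschitz: "\<bar>cap x - cap y\<bar> \<le> 2 * norm (x - y)"
proof -
  have real: "\<bar>max 0 (1 - r\<^sup>2) - max 0 (1 - s\<^sup>2)\<bar> \<le> 2 * \<bar>r - s\<bar>" if "0 \<le> r" "0 \<le> s" "r \<le> s" for r s :: real
  proof -
    have d: "s\<^sup>2 - r\<^sup>2 = (s - r) * (s + r)" by (simp add: power2_eq_square algebra_simps)
    consider "s \<le> 1" | "r \<le> 1" "1 \<le> s" | "1 \<le> r" by linarith
    then show ?thesis
    proof cases
      case 1
      then have "r\<^sup>2 \<le> 1" "s\<^sup>2 \<le> 1" using that by (auto simp: power_le_one)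
      moreover have "(s - r) * (s + r) \<le> (s - r) * 2" using that 1 by (intro mult_left_mono) auto
      moreover have "r\<^sup>2 \<le> s\<^sup>2" using that by (intro power_mono) auto
      ultimately have "max 0 (1 - r\<^sup>2) = 1 - r\<^sup>2" "max 0 (1 - s\<^sup>2) = 1 - s\<^sup>2"
        "\<bar>(1 - r\<^sup>2) - (1 - s\<^sup>2)\<bar> \<le> (s - r) * 2" using d by (auto simp: max_absorb2)
      moreover have "(s - r) * 2 = 2 * \<bar>r - s\<bar>" using that by simp
      ultimately show ?thesis by (simp only:)
    next
      case 2
      have "1 \<le> s\<^sup>2" using 2 by simp
      moreover have "r\<^sup>2 \<le> 1" using that 2 by (simp add: power_le_one)
      moreover have "(1 - r) * (1 + r) \<le> (1 - r) * 2" using 2 by (intro mult_left_mono) auto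
      then have "1 - r\<^sup>2 \<le> 2 * (1 - r)" by (simp add: power2_eq_square algebra_simps)
      ultimately show ?thesis using 2 that by simp
    next
      case 3
      then have "1 \<le> r\<^sup>2" "1 \<le> s\<^sup>2" using that by simp_all
      then show ?thesis by simp
    qed
  qed
  have "\<bar>cap x - cap y\<bar> \<le> 2 * \<bar>norm x - norm y\<bar>"
    using real[of "norm x" "norm y"] real[of "norm y" "norm x"]
    by (cases "norm x \<le> norm y") (auto simp: cap_def abs_minus_commute)
  also have "2 * \<bar>norm x - norm y\<bar> \<le> 2 * norm (x - y)"
    using norm_triangle_ineq3[of x y] by simp
  finally show ?thesis .
qed

lemma cap_difference_quotient_tendsto:
  fixes y :: "real^'d::finite"
  assumes t: "t \<longlonglongrightarrow> 0" "\<And>n. 0 < t n" and y: "norm y \<noteq> 1"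
  shows "(\<lambda>n. (cap (y - t n *\<^sub>R axis i 1) - cap y) / t n) \<longlonglongrightarrow> 2 * y $ i * indicator (ball 0 1) y"
proof -
  have lim: "(\<lambda>n. y - t n *\<^sub>R axis i 1) \<longlonglongrightarrow> y - 0 *\<^sub>R axis i 1" by (intro tendsto_intros t)
  show ?thesis
  proof (cases "norm y < 1")
    case True
    then have "\<forall>\<^sub>F n in sequentially. y - t n *\<^sub>R axis i 1 \<in> ball 0 1"
      by (intro topological_tendstoD[OF lim]) auto
    then have "\<forall>\<^sub>F n in sequentially. 2 * y $ i - t n = (cap (y - t n *\<^sub>R axis i 1) - cap y) / t n"
    proof eventually_elim
      case (elim n)
      have "(norm (y - t n *\<^sub>R axis i 1))\<^sup>2 = (norm y)\<^sup>2 - 2 * t n * y $ i + t n * t n"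
        unfolding power2_norm_eq_inner
        by (simp add: inner_simps inner_commute[of "axis i 1"] inner_axis inner_axis_axis algebra_simps)
      then have "cap (y - t n *\<^sub>R axis i 1) - cap y = t n * (2 * y $ i - t n)"
        using elim True by (simp add: cap_eq algebra_simps)
      then show ?case using t(2)[of n] by simp
    qed
    moreover have "(\<lambda>n. 2 * y $ i - t n) \<longlonglongrightarrow> 2 * y $ i - 0" by (intro tendsto_intros t)
    ultimately show ?thesis using True by (auto intro: Lim_transform_eventually)
  next
    case False
    then have "y \<in> {y. 1 < norm y}" using y by simp
    moreover have "open {y::real^'d. 1 < norm y}" by (intro open_Collect_less continuous_intros)
    ultimately have "\<forall>\<^sub>F n in sequentially. y - t n *\<^sub>R axis i 1 \<in> {y. 1 < norm y}"
      by (intro topological_tendstoD[OF lim]) auto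
    then have "\<forall>\<^sub>F n in sequentially. 0 = (cap (y - t n *\<^sub>R axis i 1) - cap y) / t n"
      by eventually_elim (use False in \<open>simp add: cap_eq_0\<close>)
    then show ?thesis using False by (auto intro: Lim_transform_eventually[OF tendsto_const])
  qed
qed

text \<open>Integration by parts for difference quotients: translation invariance moves the
  difference from \<open>\<psi>\<close> to \<open>cap\<close>, and both sides converge dominatedly.
  The unit sphere, where \<open>cap\<close> has a kink, is a null set.\<close>

lemma integral_cap_partial_derivative:
  fixes \<psi> :: "real^'d::finite \<Rightarrow> real"
  assumes \<psi>: "test_function \<psi>"
  shows "(\<integral>y. cap y * partial_derivative i \<psi> y \<partial>lborel) = (\<integral>y. 2 * y $ i * indicator (ball 0 1) y * \<psi> y \<partial>lborel)"
proof -
  let ?a = "axis i 1 :: real^'d"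
  note \<psi>' = test_function_partial_derivative[OF \<psi>, of i]
  note [measurable] = test_function_measurable[OF \<psi>] test_function_measurable[OF \<psi>']
  have [measurable]: "ball (0::real^'d) 1 \<in> sets borel" by simp
  define t where "t n = 1 / real (Suc n)" for n
  have t: "0 < t n" "t \<longlonglongrightarrow> 0" for n
    unfolding t_def using LIMSEQ_inverse_real_of_nat by (auto simp: inverse_eq_divide)
  obtain C where C: "\<And>x. \<bar>partial_derivative i \<psi> x\<bar> \<le> C" using test_function_bounded[OF \<psi>'] by blast
  obtain B where B: "\<And>x. \<bar>\<psi> x\<bar> \<le> B" using test_function_bounded[OF \<psi>] by blast
  have der: "((\<lambda>t. \<psi> (y + t *\<^sub>R ?a)) has_real_derivative partial_derivative i \<psi> (y + s *\<^sub>R ?a)) (at s)" for y s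
    by (intro has_real_derivative_along_axis test_function_differentiable \<psi>)
  have lim: "(\<lambda>n. (\<psi> (y + t n *\<^sub>R ?a) - \<psi> y) / t n) \<longlonglongrightarrow> partial_derivative i \<psi> y" for y
  proof -
    have "((\<lambda>h. (\<psi> (y + h *\<^sub>R ?a) - \<psi> y) / h) \<longlongrightarrow> partial_derivative i \<psi> y) (at 0)"
      using der[of y 0] by (simp add: DERIV_def)
    moreover have "filterlim t (at 0) sequentially"
      using t by (auto simp: filterlim_at less_imp_neq[symmetric])
    ultimately show ?thesis by (rule filterlim_compose)
  qed
  have bound: "\<bar>(\<psi> (y + t n *\<^sub>R ?a) - \<psi> y) / t n\<bar> \<le> C" for y n
  proof -
    obtain z where "\<psi> (y + t n *\<^sub>R ?a) - \<psi> (y + 0 *\<^sub>R ?a) = (t n - 0) * partial_derivative i \<psi> (y + z *\<^sub>R ?a)"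
      using MVT2[OF t(1)[of n] der] by blast
    then show ?thesis using C t(1)[of n] by simp
  qed
  have eq: "(\<integral>y. cap y * ((\<psi> (y + t n *\<^sub>R ?a) - \<psi> y) / t n) \<partial>lborel)
    = (\<integral>y. ((cap (y - t n *\<^sub>R ?a) - cap y) / t n) * \<psi> y \<partial>lborel)" for n
  proof -
    have i1: "integrable lborel (\<lambda>y. cap y * \<psi> (y + z))" for z
      by (rule integrable_bounded_mult[OF integrable_cap _ B]) measurable
    have i2: "integrable lborel (\<lambda>y. cap (y - z) * \<psi> y)"
      "(\<integral>y. cap y * \<psi> (y + z) \<partial>lborel) = (\<integral>y. cap (y - z) * \<psi> y \<partial>lborel)" for z
      using integrable_lborel_translate[OF i1[of z], of "- z"] integral_lborel_translate[OF i1[of z], of "- z"]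
      by simp_all
    have "(\<integral>y. cap y * ((\<psi> (y + t n *\<^sub>R ?a) - \<psi> y) / t n) \<partial>lborel)
      = (\<integral>y. (cap y * \<psi> (y + t n *\<^sub>R ?a) - cap y * \<psi> y) / t n \<partial>lborel)"
      by (simp add: right_diff_distrib)
    also have "\<dots> = ((\<integral>y. cap (y - t n *\<^sub>R ?a) * \<psi> y \<partial>lborel) - (\<integral>y. cap y * \<psi> y \<partial>lborel)) / t n"
      using i1[of "t n *\<^sub>R ?a"] i1[of 0] i2(2)[of "t n *\<^sub>R ?a"] by simp
    also have "\<dots> = (\<integral>y. (cap (y - t n *\<^sub>R ?a) * \<psi> y - cap y * \<psi> y) / t n \<partial>lborel)"
      using i1[of 0] i2(1)[of "t n *\<^sub>R ?a"] by simp
    also have "\<dots> = (\<integral>y. ((cap (y - t n *\<^sub>R ?a) - cap y) / t n) * \<psi> y \<partial>lborel)"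
      by (simp add: left_diff_distrib)
    finally show ?thesis .
  qed
  have "(\<lambda>n. \<integral>y. cap y * ((\<psi> (y + t n *\<^sub>R ?a) - \<psi> y) / t n) \<partial>lborel) \<longlonglongrightarrow> (\<integral>y. cap y * partial_derivative i \<psi> y \<partial>lborel)"
  proof (rule integral_dominated_convergence[where w = "\<lambda>y. cap y * C"])
    show "AE y in lborel. norm (cap y * ((\<psi> (y + t n *\<^sub>R ?a) - \<psi> y) / t n)) \<le> cap y * C" for n
    proof (rule AE_I2)
      fix y
      have "\<bar>cap y\<bar> * \<bar>(\<psi> (y + t n *\<^sub>R ?a) - \<psi> y) / t n\<bar> \<le> cap y * C"
        by (intro mult_mono bound) (simp_all add: cap_bounds(1))
      then show "norm (cap y * ((\<psi> (y + t n *\<^sub>R ?a) - \<psi> y) / t n)) \<le> cap y * C"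
        by (simp only: real_norm_def abs_mult)
    qed
    show "AE y in lborel. (\<lambda>n. cap y * ((\<psi> (y + t n *\<^sub>R ?a) - \<psi> y) / t n)) \<longlonglongrightarrow> cap y * partial_derivative i \<psi> y"
      by (intro AE_I2 tendsto_mult_left lim)
    show "integrable lborel (\<lambda>y::real^'d. cap y * C)" by (intro integrable_mult_left integrable_cap)
  qed measurable
  moreover have "(\<lambda>n. \<integral>y. ((cap (y - t n *\<^sub>R ?a) - cap y) / t n) * \<psi> y \<partial>lborel)
    \<longlonglongrightarrow> (\<integral>y. 2 * y $ i * indicator (ball 0 1) y * \<psi> y \<partial>lborel)"
  proof (rule integral_dominated_convergence[where w = "\<lambda>y. 2 * \<bar>\<psi> y\<bar>"])
    have "sphere (0::real^'d) 1 \<in> null_sets lborel"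
      using negligible_sphere[of "0::real^'d" 1] by (simp add: null_sets_completion_iff negligible_iff_null_sets)
    then have "AE y in lborel. y \<notin> sphere (0::real^'d) 1" by (rule AE_not_in)
    then show "AE y in lborel. (\<lambda>n. ((cap (y - t n *\<^sub>R ?a) - cap y) / t n) * \<psi> y) \<longlonglongrightarrow> 2 * y $ i * indicator (ball 0 1) y * \<psi> y"
      by eventually_elim (intro tendsto_mult_right cap_difference_quotient_tendsto t, simp)
    have "\<bar>(cap (y - t n *\<^sub>R ?a) - cap y) / t n\<bar> \<le> 2" for y n
      using cap_lipschitz[of "y - t n *\<^sub>R ?a" y] t(1)[of n] by (simp add: field_simps)
    then show "AE y in lborel. norm (((cap (y - t n *\<^sub>R ?a) - cap y) / t n) * \<psi> y) \<le> 2 * \<bar>\<psi> y\<bar>" for n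
      unfolding real_norm_def abs_mult[of _ "\<psi> _"] by (intro AE_I2 mult_right_mono) auto
    show "(\<lambda>y. 2 * y $ i * indicator (ball 0 1) y * \<psi> y) \<in> borel_measurable lborel"
      by (simp, measurable)
  qed (use integrable_test_function[OF \<psi>] in auto)
  ultimately show ?thesis
    unfolding eq by (rule LIMSEQ_unique)
qed

text \<open>Of the exponent, \<open>CARD('d)\<close> is the Jacobian and 2 comes from the
  homogeneity of the paraboloid.\<close>

lemma integral_cap_scale:
  fixes g :: "real^'d::finite \<Rightarrow> real"
  assumes b: "0 < b" and g[measurable]: "g \<in> borel_measurable borel" and C: "\<And>x. \<bar>g x\<bar> \<le> C"
  shows "(\<integral>y. cap y * g (b *\<^sub>R y) \<partial>lborel) = (1 / b) ^ (CARD('d) + 2) * (\<integral>x. max 0 (b\<^sup>2 - (norm x)\<^sup>2) * g x \<partial>lborel)"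
proof -
  have i: "integrable lborel (\<lambda>y. cap y * g (b *\<^sub>R y))"
    by (rule integrable_bounded_mult[OF integrable_cap _ C]) measurable
  have "cap ((1 / b) *\<^sub>R x) = (1 / b)\<^sup>2 * max 0 (b\<^sup>2 - (norm x)\<^sup>2)" for x :: "real^'d"
    using b by (auto simp: cap_def max_def power_divide field_simps)
  then have "(\<integral>y. cap y * g (b *\<^sub>R y) \<partial>lborel) = (1 / b) ^ CARD('d) * (\<integral>x. (1 / b)\<^sup>2 * (max 0 (b\<^sup>2 - (norm x)\<^sup>2) * g x) \<partial>lborel)"
    using integral_lborel_affine[OF i, of "1 / b" 0] b by (simp add: mult.assoc)
  then show ?thesis by (simp only: power_add mult.assoc integral_mult_right_zero)
qed

text \<open>On the unit ball \<open>y\<close> is minus one half of the gradient of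
  \<open>cap\<close>. Integration by parts leaves the divergence of the gradient field of
  \<open>\<phi>\<close> taken at \<open>b *\<^sub>R y\<close>, which is \<open>b\<close> times the
  Laplacian; rescaling to radius \<open>b\<close> produces the power.\<close>

lemma integral_ball_radial_derivative:
  fixes \<phi> :: "real^'d::finite \<Rightarrow> real"
  assumes \<phi>: "test_function \<phi>" and b: "0 < b"
  shows "(\<integral>y. indicator (ball 0 1) y * (\<Sum>i\<in>UNIV. y $ i * partial_derivative i \<phi> (b *\<^sub>R y)) \<partial>lborel)
    = (1 / b) ^ (CARD('d) + 1) / 2 * (\<integral>x. max 0 (b\<^sup>2 - (norm x)\<^sup>2) * laplacian \<phi> x \<partial>lborel)"
proof -
  have [measurable]: "ball (0::real^'d) 1 \<in> sets borel" by simp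
  let ?\<psi> = "\<lambda>i y. partial_derivative i \<phi> (b *\<^sub>R y)"
  have t: "test_function (?\<psi> i)" for i
    using test_function_affine[OF test_function_partial_derivative[OF \<phi>, of i], of b 1 0] b by simp
  have pd: "partial_derivative i (?\<psi> i) y = b * partial_derivative i (partial_derivative i \<phi>) (b *\<^sub>R y)" for i y
    using partial_derivative_affine[where g = "partial_derivative i \<phi>" and s = b and x = y and y = 0 and c = 1 and i = i]
      test_function_differentiable[OF test_function_partial_derivative[OF \<phi>]] by simp
  have i1: "integrable lborel (\<lambda>y. y $ i * indicator (ball 0 1) y * ?\<psi> i y)" for i
  proof -
    have "\<bar>y $ i * indicator (ball 0 1) y\<bar> \<le> 1" for y :: "real^'d"
      using component_le_norm_cart[of y i] by (auto simp: indicator_def)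
    from integrable_bounded_mult[OF integrable_test_function[OF t[of i]] _ this]
    have "integrable lborel (\<lambda>y. ?\<psi> i y * (y $ i * indicator (ball 0 1) y))" by measurable
    then show ?thesis by (simp add: mult.commute)
  qed
  have i2: "integrable lborel (\<lambda>y. cap y * partial_derivative i (?\<psi> i) y)" for i
  proof -
    have "integrable lborel (\<lambda>y. partial_derivative i (?\<psi> i) y * cap y)"
      by (rule integrable_bounded_mult[OF integrable_test_function[OF test_function_partial_derivative[OF t[of i]]] _ cap_bounds(2)])
        measurable
    then show ?thesis by (simp add: mult.commute)
  qed
  have "(\<integral>y. indicator (ball 0 1) y * (\<Sum>i\<in>UNIV. y $ i * ?\<psi> i y) \<partial>lborel)
    = (\<integral>y. (\<Sum>i\<in>UNIV. y $ i * indicator (ball 0 1) y * ?\<psi> i y) \<partial>lborel)"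
    by (simp add: sum_distrib_left mult_ac)
  also have "\<dots> = (\<Sum>i\<in>UNIV. \<integral>y. y $ i * indicator (ball 0 1) y * ?\<psi> i y \<partial>lborel)"
    by (rule Bochner_Integration.integral_sum) (rule i1)
  also have "\<dots> = (\<Sum>i\<in>UNIV. (\<integral>y. cap y * partial_derivative i (?\<psi> i) y \<partial>lborel) / 2)"
    by (simp add: integral_cap_partial_derivative[OF t] mult.assoc)
  also have "\<dots> = (\<integral>y. (\<Sum>i\<in>UNIV. cap y * partial_derivative i (?\<psi> i) y) \<partial>lborel) / 2"
    by (subst Bochner_Integration.integral_sum[OF i2]) (simp add: sum_divide_distrib)
  also have "\<dots> = (\<integral>y. b * (cap y * laplacian \<phi> (b *\<^sub>R y)) \<partial>lborel) / 2"
    by (simp add: pd laplacian_def sum_distrib_left mult_ac)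
  also have "\<dots> = b / 2 * (\<integral>y. cap y * laplacian \<phi> (b *\<^sub>R y) \<partial>lborel)" by simp
  also have "\<dots> = b / 2 * ((1 / b) ^ (CARD('d) + 2) * (\<integral>x. max 0 (b\<^sup>2 - (norm x)\<^sup>2) * laplacian \<phi> x \<partial>lborel))"
  proof -
    obtain C where C: "\<And>x. \<bar>laplacian \<phi> x\<bar> \<le> C"
      using test_function_bounded[OF test_function_laplacian[OF \<phi>]] by blast
    show ?thesis
      by (subst integral_cap_scale[OF b test_function_measurable[OF test_function_laplacian[OF \<phi>]] C]) simp
  qed
  finally show ?thesis using b by (simp add: power_add)
qed

text \<open>Up to the factor \<open>vol B\<^sub>1\<close>, \<open>\<lambda>x. ball_profile d a (norm x)\<close> is the potential supported in the ball of radius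
  \<open>a\<close> whose Laplacian is the uniform probability measure on that ball minus \<open>\<delta>\<^sub>0\<close>.\<close>

definition ball_profile :: "nat \<Rightarrow> real \<Rightarrow> real \<Rightarrow> real" where
  "ball_profile d a \<rho> = (\<integral>b. indicator {0..a} b * ((1 / b) ^ (d + 1) / 2 * max 0 (b\<^sup>2 - \<rho>\<^sup>2)) \<partial>lborel)"

lemma borel_measurable_vec_nth [measurable]: "(\<lambda>x::real^'d::finite. x $ i) \<in> borel_measurable borel"
  by (intro borel_measurable_continuous_onI continuous_intros)

text \<open>Fundamental theorem of calculus for \<open>\<phi> (b *\<^sub>R y)\<close> in
  \<open>b\<close> along each ray, followed by Fubini. The lower endpoint contributes the value
  \<open>\<phi> 0\<close>, from which the Dirac mass arises.\<close>

lemma integral_over_ball_eq_radial_integral: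
  fixes \<phi> :: "real^'d::finite \<Rightarrow> real"
  assumes \<phi>: "test_function \<phi>" and a: "0 < a"
  shows "(\<integral>y. indicator (ball 0 1) y * (\<phi> (a *\<^sub>R y) - \<phi> 0) \<partial>lborel)
    = (\<integral>b. indicator {0..a} b * (\<integral>y. indicator (ball 0 1) y * (\<Sum>i\<in>UNIV. y $ i * partial_derivative i \<phi> (b *\<^sub>R y)) \<partial>lborel) \<partial>lborel)"
proof -
  define g where "g b y = (\<Sum>i\<in>UNIV. y $ i * partial_derivative i \<phi> (b *\<^sub>R y))" for b :: real and y :: "real^'d"
  have [measurable]: "ball (0::real^'d) 1 \<in> sets borel" by simp
  note \<phi>' = test_function_partial_derivative[OF \<phi>]
  have [measurable]: "partial_derivative i \<phi> \<in> borel_measurable borel" for i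
    by (rule test_function_measurable[OF \<phi>'])
  have gm[measurable]: "(\<lambda>(b, y). g b y) \<in> borel_measurable (lborel \<Otimes>\<^sub>M lborel)"
    unfolding g_def by measurable
  have "\<exists>C>0. \<forall>x. \<bar>partial_derivative i \<phi> x\<bar> \<le> C" for i
    using test_function_bounded[OF \<phi>'[of i]] by blast
  then obtain C where C: "\<And>i x. \<bar>partial_derivative i \<phi> x\<bar> \<le> C i" by metis
  define M where "M = (\<Sum>i\<in>UNIV. C i)"
  have g_le: "\<bar>g b y\<bar> \<le> M" if "norm y < 1" for b y
    unfolding g_def M_def
  proof (rule order_trans[OF sum_abs sum_mono])
    fix i
    have "\<bar>y $ i\<bar> \<le> 1" using component_le_norm_cart[of y i] that by linarith
    then have "\<bar>y $ i\<bar> * \<bar>partial_derivative i \<phi> (b *\<^sub>R y)\<bar> \<le> 1 * C i"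
      using C by (intro mult_mono) auto
    then show "\<bar>y $ i * partial_derivative i \<phi> (b *\<^sub>R y)\<bar> \<le> C i" by (simp only: abs_mult mult_1)
  qed
  have M: "0 \<le> M" using g_le[of 0 0] by simp
  have pair: "integrable (lborel \<Otimes>\<^sub>M lborel) (\<lambda>(b, y). indicator {0..a} b * (indicator (ball 0 1) y * g b y))"
  proof (rule Bochner_Integration.integrable_bound)
    have "{0..a} \<times> ball (0::real^'d) 1 \<in> sets (lborel \<Otimes>\<^sub>M lborel)" by simp
    moreover have "emeasure (lborel \<Otimes>\<^sub>M lborel) ({0..a} \<times> ball (0::real^'d) 1) < \<infinity>"
      using emeasure_bounded_finite[OF bounded_ball, of "0::real^'d" 1] a
      by (subst lborel.emeasure_pair_measure_Times) (auto simp: ennreal_mult_less_top)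
    ultimately show "integrable (lborel \<Otimes>\<^sub>M lborel) (\<lambda>z. M * indicator ({0..a} \<times> ball (0::real^'d) 1) z)"
      by (intro integrable_mult_right integrable_real_indicator)
    show "AE z in lborel \<Otimes>\<^sub>M lborel. norm (case z of (b, y) \<Rightarrow> indicator {0..a} b * (indicator (ball 0 1) y * g b y))
      \<le> norm (M * indicator ({0..a} \<times> ball (0::real^'d) 1) z)"
    proof (rule AE_I2, clarify)
      fix b y
      show "norm (indicator {0..a} b * (indicator (ball 0 1) y * g b y)) \<le> norm (M * indicator ({0..a} \<times> ball (0::real^'d) 1) (b, y))"
        using g_le[of y b] M by (auto simp: indicator_def)
    qed
  qed measurable
  have der: "((\<lambda>t. \<phi> (t *\<^sub>R y)) has_real_derivative g b y) (at b)" for b y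
  proof -
    have "((\<lambda>t. t *\<^sub>R y) has_derivative (\<lambda>h. h *\<^sub>R y)) (at b)" by (auto intro!: derivative_eq_intros)
    note has_derivative_compose[OF this has_derivative_partial_derivative[OF test_function_differentiable[OF \<phi>]]]
    moreover have "(\<lambda>h. \<Sum>i\<in>UNIV. (h *\<^sub>R y) $ i * partial_derivative i \<phi> (b *\<^sub>R y)) = (*) (g b y)"
      by (rule ext) (simp add: g_def sum_distrib_left mult_ac)
    ultimately show ?thesis by (simp only: has_field_derivative_def)
  qed
  have cont: "isCont (\<lambda>b. g b y) b" for b y
  proof -
    have "isCont (partial_derivative i \<phi>) x" for i x
      using test_function_continuous[OF \<phi>'[of i]] by (simp add: continuous_on_eq_continuous_at)
    then have "isCont (\<lambda>b. partial_derivative i \<phi> (b *\<^sub>R y)) b" for i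
      by (intro isCont_o2[where f = "\<lambda>b. b *\<^sub>R y" and g = "partial_derivative i \<phi>"]
          continuous_scaleR continuous_ident continuous_const)
    then show ?thesis unfolding g_def by (intro continuous_sum continuous_mult continuous_const)
  qed
  have ftc: "(\<integral>b. g b y * indicator {0..a} b \<partial>lborel) = \<phi> (a *\<^sub>R y) - \<phi> 0" for y
    using integral_FTC_Icc_real[OF less_imp_le[OF a] der cont, of y] by simp
  have "(\<integral>y. indicator (ball 0 1) y * (\<phi> (a *\<^sub>R y) - \<phi> 0) \<partial>lborel)
    = (\<integral>y. \<integral>b. indicator {0..a} b * (indicator (ball 0 1) y * g b y) \<partial>lborel \<partial>lborel)"
    unfolding ftc[symmetric] by (subst integral_mult_right_zero[symmetric]) (simp add: mult_ac)
  also have "\<dots> = (\<integral>b. \<integral>y. indicator {0..a} b * (indicator (ball 0 1) y * g b y) \<partial>lborel \<partial>lborel)"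
    using lborel_pair.Fubini_integral[OF pair] by simp
  finally show ?thesis by (simp add: g_def)
qed

text \<open>The singular weight is harmless when \<open>x\<close> is integrated first: the
  paraboloid of radius \<open>b\<close> has an integral proportional to \<open>b ^ (d + 2)\<close>,
  so only a multiple of \<open>b\<close> remains.\<close>

lemma ball_profile_pair_integrable:
  fixes g :: "real^'d::finite \<Rightarrow> real"
  assumes [measurable]: "g \<in> borel_measurable borel" and g: "\<And>x. \<bar>g x\<bar> \<le> C"
  shows "integrable (lborel \<Otimes>\<^sub>M lborel)
    (\<lambda>(b, x). indicator {0..a} b * ((1 / b) ^ (CARD('d) + 1) / 2 * max 0 (b\<^sup>2 - (norm x)\<^sup>2)) * g x)"
proof -
  let ?k = "\<lambda>b x::real^'d. indicator {0..a} b * ((1 / b) ^ (CARD('d) + 1) / 2 * max 0 (b\<^sup>2 - (norm x)\<^sup>2))"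
  have k_nonneg: "0 \<le> ?k b x" for b x by (auto simp: indicator_def)
  have ik: "integrable lborel (?k b)" for b
  proof (rule integrable_bounded_support[where K = "\<bar>b\<bar>" and B = "?k b 0"])
    show "\<bar>?k b x\<bar> \<le> ?k b 0" for x
      by (auto simp: indicator_def intro!: mult_left_mono divide_right_mono)
    show "?k b x = 0" if "\<bar>b\<bar> \<le> norm x" for x
      using power_mono[OF that, of 2] by simp
  qed measurable
  have int: "(\<integral>x. ?k b x \<partial>lborel) = indicator {0..a} b * (b / 2 * (\<integral>y. cap (y::real^'d) \<partial>lborel))" if "b \<noteq> 0" for b
  proof (cases "0 < b \<and> b \<le> a")
    case True
    have "(\<integral>x. max 0 (b\<^sup>2 - (norm (x::real^'d))\<^sup>2) \<partial>lborel) = b ^ (CARD('d) + 2) * (\<integral>y. cap (y::real^'d) \<partial>lborel)"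
      using integral_cap_scale[of b "\<lambda>x::real^'d. 1" 1] True by (simp add: power_one_over)
    then show ?thesis using True by (simp add: power_one_over)
  next
    case False
    then show ?thesis using that by (auto simp: indicator_def)
  qed
  have pair: "integrable (lborel \<Otimes>\<^sub>M lborel) (\<lambda>(b, x). ?k b x)"
  proof (rule lborel_pair.Fubini_integrable)
    have i: "integrable lborel (\<lambda>b. indicator {0..a} b *\<^sub>R (b / 2 * (\<integral>y. cap (y::real^'d) \<partial>lborel)))"
      by (rule borel_integrable_compact) (auto intro!: continuous_intros)
    have ae: "AE b in lborel. indicator {0..a} b *\<^sub>R (b / 2 * (\<integral>y. cap (y::real^'d) \<partial>lborel)) = (\<integral>x. norm (case (b, x) of (b, x) \<Rightarrow> ?k b x) \<partial>lborel)"
      using AE_lborel_singleton[of 0]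
    proof eventually_elim
      case (elim b)
      have "(\<integral>x. norm (case (b, x) of (b, x) \<Rightarrow> ?k b x) \<partial>lborel) = (\<integral>x. ?k b x \<partial>lborel)"
        using k_nonneg[of b] by (intro Bochner_Integration.integral_cong) (simp_all only: prod.case real_norm_def abs_of_nonneg)
      then show ?case using int[OF elim] by simp
    qed
    show "integrable lborel (\<lambda>b. \<integral>x. norm (case (b, x) of (b, x) \<Rightarrow> ?k b x) \<partial>lborel)"
      by (rule integrable_cong_AE_imp[OF i _ ae]) measurable
    show "AE b in lborel. integrable lborel (\<lambda>x. case (b, x) of (b, x) \<Rightarrow> ?k b x)"
      using ik by simp
  qed measurable
  have "integrable (lborel \<Otimes>\<^sub>M lborel) (\<lambda>z. (case z of (b, x) \<Rightarrow> ?k b x) * g (snd z))"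
    by (rule integrable_bounded_mult[OF pair _ g]) measurable
  then show ?thesis by (simp add: case_prod_unfold)
qed

lemma integrable_ball_profile:
  "integrable lborel (\<lambda>x::real^'d::finite. ball_profile CARD('d) a (norm x))"
proof -
  have "integrable (lborel \<Otimes>\<^sub>M lborel)
    (\<lambda>(b, x). indicator {0..a} b * ((1 / b) ^ (CARD('d) + 1) / 2 * max 0 (b\<^sup>2 - (norm x)\<^sup>2)) * (\<lambda>x::real^'d. 1) x)"
    by (rule ball_profile_pair_integrable[where C = 1]) auto
  from lborel_pair.integrable_snd[OF this] show ?thesis by (simp add: ball_profile_def)
qed

text \<open>By Fubini the Laplacian is paired with each truncated paraboloid separately, which gives
  the integral of the radial derivative of \<open>\<phi>\<close> over the unit ball; integration
  over \<open>b\<close> then compares \<open>\<phi>\<close> on the ball of radius \<open>a\<close>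
  with its value at the centre.\<close>

lemma integral_ball_profile_laplacian:
  fixes \<phi> :: "real^'d::finite \<Rightarrow> real"
  assumes \<phi>: "test_function \<phi>" and a: "0 < a"
  shows "(\<integral>x. ball_profile CARD('d) a (norm x) * laplacian \<phi> x \<partial>lborel)
    = (1 / a) ^ CARD('d) * (\<integral>x. indicator (ball 0 a) x * \<phi> x \<partial>lborel) - measure lborel (ball (0::real^'d) 1) * \<phi> 0"
proof -
  obtain C where C: "\<And>x. \<bar>laplacian \<phi> x\<bar> \<le> C"
    using test_function_bounded[OF test_function_laplacian[OF \<phi>]] by blast
  obtain B where B: "\<And>x. \<bar>\<phi> x\<bar> \<le> B" using test_function_bounded[OF \<phi>] by blast
  note [measurable] = test_function_measurable[OF \<phi>] test_function_measurable[OF test_function_laplacian[OF \<phi>]]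
  have [measurable]: "ball (0::real^'d) r \<in> sets borel" for r by simp
  let ?k = "\<lambda>b x::real^'d. indicator {0..a} b * ((1 / b) ^ (CARD('d) + 1) / 2 * max 0 (b\<^sup>2 - (norm x)\<^sup>2))"
  have pair: "integrable (lborel \<Otimes>\<^sub>M lborel) (\<lambda>(b, x). ?k b x * laplacian \<phi> x)"
    by (rule ball_profile_pair_integrable[OF _ C]) measurable
  have "(\<integral>x. ball_profile CARD('d) a (norm x) * laplacian \<phi> x \<partial>lborel) = (\<integral>x. \<integral>b. ?k b x * laplacian \<phi> x \<partial>lborel \<partial>lborel)"
    unfolding ball_profile_def integral_mult_left_zero[symmetric] ..
  also have "\<dots> = (\<integral>b. \<integral>x. ?k b x * laplacian \<phi> x \<partial>lborel \<partial>lborel)"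
    using lborel_pair.Fubini_integral[OF pair] by simp
  also have "\<dots> = (\<integral>b. indicator {0..a} b * (\<integral>y. indicator (ball 0 1) y * (\<Sum>i\<in>UNIV. y $ i * partial_derivative i \<phi> (b *\<^sub>R y)) \<partial>lborel) \<partial>lborel)"
  proof (rule integral_cong_AE)
    show "AE b in lborel. (\<integral>x. ?k b x * laplacian \<phi> x \<partial>lborel)
      = indicator {0..a} b * (\<integral>y. indicator (ball 0 1) y * (\<Sum>i\<in>UNIV. y $ i * partial_derivative i \<phi> (b *\<^sub>R y)) \<partial>lborel)"
      \<comment> \<open>\<open>integral_ball_radial_derivative\<close> needs \<open>0 < b\<close>;
        negative \<open>b\<close> are cut off by the indicator and \<open>b = 0\<close> is a null
        set.\<close>
      using AE_lborel_singleton[of 0]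
    proof eventually_elim
      case (elim b)
      have "(\<integral>x. ?k b x * laplacian \<phi> x \<partial>lborel)
        = indicator {0..a} b * ((1 / b) ^ (CARD('d) + 1) / 2 * (\<integral>x. max 0 (b\<^sup>2 - (norm x)\<^sup>2) * laplacian \<phi> x \<partial>lborel))"
        by (simp only: mult.assoc integral_mult_right_zero)
      then show ?case
        using integral_ball_radial_derivative[OF \<phi>, of b] elim
        by (cases "0 < b") (auto simp: indicator_def)
    qed
    note [measurable] = test_function_measurable[OF test_function_partial_derivative[OF \<phi>]]
    show "(\<lambda>b. indicator {0..a} b * (\<integral>y. indicator (ball 0 1) y * (\<Sum>i\<in>UNIV. y $ i * partial_derivative i \<phi> (b *\<^sub>R y)) \<partial>lborel)) \<in> borel_measurable lborel"
      by measurable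
  qed measurable
  also have "\<dots> = (\<integral>y. indicator (ball 0 1) y * (\<phi> (a *\<^sub>R y) - \<phi> 0) \<partial>lborel)"
    by (rule integral_over_ball_eq_radial_integral[OF \<phi> a, symmetric])
  also have "\<dots> = (\<integral>y. indicator (ball 0 1) y * \<phi> (a *\<^sub>R y) \<partial>lborel) - measure lborel (ball (0::real^'d) 1) * \<phi> 0"
  proof -
    have fin: "integrable lborel (indicator (ball (0::real^'d) 1) :: _ \<Rightarrow> real)"
      using emeasure_bounded_finite[OF bounded_ball, of "0::real^'d" 1] by (intro integrable_real_indicator) auto
    have "integrable lborel (\<lambda>y::real^'d. indicator (ball 0 1) y * \<phi> (a *\<^sub>R y))"
      by (rule integrable_bounded_mult[OF fin _ B]) measurable
    then show ?thesis using fin by (simp add: right_diff_distrib)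
  qed
  also have "(\<integral>y. indicator (ball 0 1) y * \<phi> (a *\<^sub>R y) \<partial>lborel) = (1 / a) ^ CARD('d) * (\<integral>x. indicator (ball 0 a) x * \<phi> x \<partial>lborel)"
  proof -
    have i: "integrable lborel (\<lambda>x::real^'d. indicator (ball 0 a) x * \<phi> x)"
      by (rule integrable_bounded_mult[OF integrable_real_indicator _ B])
        (use emeasure_bounded_finite[OF bounded_ball, of "0::real^'d" a] in auto)
    have "indicator (ball 0 a) (a *\<^sub>R y) = (indicator (ball 0 1) y :: real)" for y :: "real^'d"
      using a by (auto simp: indicator_def)
    then show ?thesis using integral_lborel_affine[OF i, of a 0] a by (simp add: power_one_over)
  qed
  finally show ?thesis .
qed

section \<open>Radial solutions\<close>

text \<open>For \<open>\<rho> > 0\<close> the integrand vanishes when \<open>b \<le> \<rho>\<close>,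
  away from the singularity of the weight. At \<open>\<rho> = 0\<close> with \<open>a > 0\<close>
  and \<open>d \<ge> 2\<close> the integral diverges and \<open>ball_profile\<close> has the default
  value 0 there, hence the assumption \<open>0 < \<rho>\<close> in the order properties
  below.\<close>

lemma integrable_ball_profile_integrand:
  fixes \<rho> a :: real
  assumes "0 < \<rho>"
  shows "integrable lborel (\<lambda>b. indicator {0..a} b * ((1 / b) ^ (d + 1) / 2 * max 0 (b\<^sup>2 - \<rho>\<^sup>2)))"
proof (rule integrable_bounded_support[where K = "\<bar>a\<bar> + 1" and B = "(1 / \<rho>) ^ (d + 1) / 2 * a\<^sup>2"])
  fix b :: real
  show "\<bar>indicator {0..a} b * ((1 / b) ^ (d + 1) / 2 * max 0 (b\<^sup>2 - \<rho>\<^sup>2))\<bar> \<le> (1 / \<rho>) ^ (d + 1) / 2 * a\<^sup>2"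
  proof (cases "\<rho> \<le> b \<and> b \<le> a")
    case True
    have "(1 / b) ^ (d + 1) / 2 \<le> (1 / \<rho>) ^ (d + 1) / 2"
      using True assms by (intro divide_right_mono power_mono) (auto simp: frac_le)
    moreover have "b\<^sup>2 \<le> a\<^sup>2" using True assms by (intro power_mono) auto
    then have "max 0 (b\<^sup>2 - \<rho>\<^sup>2) \<le> a\<^sup>2"
      using zero_le_power2[of a] zero_le_power2[of \<rho>] by (intro max.boundedI) linarith+
    ultimately have "(1 / b) ^ (d + 1) / 2 * max 0 (b\<^sup>2 - \<rho>\<^sup>2) \<le> (1 / \<rho>) ^ (d + 1) / 2 * a\<^sup>2"
      using assms by (intro mult_mono) auto
    then show ?thesis using True assms by (simp add: indicator_def)
  next
    case False
    then have "indicator {0..a} b * ((1 / b) ^ (d + 1) / 2 * max 0 (b\<^sup>2 - \<rho>\<^sup>2)) = 0"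
      using assms power_mono[of b \<rho> 2] by (auto simp: indicator_def not_le)
    then show ?thesis using assms by (simp only: abs_zero) simp
  qed
qed (auto simp: indicator_def)

lemma ball_profile_nonneg: "0 \<le> ball_profile d a \<rho>"
  unfolding ball_profile_def by (rule Bochner_Integration.integral_nonneg) (auto simp: indicator_def)

lemma ball_profile_eq_0:
  assumes "0 \<le> \<rho>" "a \<le> \<rho>"
  shows "ball_profile d a \<rho> = 0"
proof -
  have "indicator {0..a} b * ((1 / b) ^ (d + 1) / 2 * max 0 (b\<^sup>2 - \<rho>\<^sup>2)) = 0" for b :: real
    using power_mono[of b \<rho> 2] assms by (auto simp: indicator_def)
  then show ?thesis by (simp only: ball_profile_def Bochner_Integration.integral_zero)
qed

text \<open>As an integral of a nonnegative integrand over \<open>{r<..R}\<close>, the difference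
  shows its sign and its monotonicity in \<open>\<rho>\<close>.\<close>

lemma ball_profile_diff:
  assumes "0 < \<rho>" "0 \<le> r" "r \<le> R"
  shows "ball_profile d R \<rho> - ball_profile d r \<rho>
    = (\<integral>b. indicator {r<..R} b * ((1 / b) ^ (d + 1) / 2 * max 0 (b\<^sup>2 - \<rho>\<^sup>2)) \<partial>lborel)"
proof -
  let ?f = "\<lambda>b. (1 / b) ^ (d + 1) / 2 * max 0 (b\<^sup>2 - \<rho>\<^sup>2)"
  have "ball_profile d R \<rho> - ball_profile d r \<rho> = (\<integral>b. indicator {0..R} b * ?f b - indicator {0..r} b * ?f b \<partial>lborel)"
    unfolding ball_profile_def
    by (rule Bochner_Integration.integral_diff[symmetric]) (rule integrable_ball_profile_integrand[OF assms(1)])+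
  moreover have "indicator {0..R} b * ?f b - indicator {0..r} b * ?f b = indicator {r<..R} b * ?f b" for b
    using assms by (auto simp: indicator_def)
  ultimately show ?thesis by (simp only:)
qed

lemma ball_profile_antimono:
  assumes "0 < \<rho>" "\<rho> \<le> \<rho>'"
  shows "ball_profile d a \<rho>' \<le> ball_profile d a \<rho>"
  unfolding ball_profile_def
proof (rule integral_mono)
  fix b :: real
  have "\<rho>\<^sup>2 \<le> \<rho>'\<^sup>2" using assms by (intro power_mono) auto
  then show "indicator {0..a} b * ((1 / b) ^ (d + 1) / 2 * max 0 (b\<^sup>2 - \<rho>'\<^sup>2)) \<le> indicator {0..a} b * ((1 / b) ^ (d + 1) / 2 * max 0 (b\<^sup>2 - \<rho>\<^sup>2))"
    by (auto simp: indicator_def intro!: mult_left_mono divide_right_mono)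
qed (rule integrable_ball_profile_integrand, use assms in simp)+

lemma integrable_ball_profile_diff_integrand:
  fixes \<rho> r R :: real
  assumes "0 < \<rho>" "0 \<le> r"
  shows "integrable lborel (\<lambda>b. indicator {r<..R} b * ((1 / b) ^ (d + 1) / 2 * max 0 (b\<^sup>2 - \<rho>\<^sup>2)))"
proof -
  have "integrable lborel (\<lambda>b. indicator {0..R} b * ((1 / b) ^ (d + 1) / 2 * max 0 (b\<^sup>2 - \<rho>\<^sup>2)) * indicator {r<..} b)"
    by (rule integrable_bounded_mult[OF integrable_ball_profile_integrand[OF assms(1)], where B = 1]) (auto simp: indicator_def)
  moreover have "indicator {0..R} b * ((1 / b) ^ (d + 1) / 2 * max 0 (b\<^sup>2 - \<rho>\<^sup>2)) * indicator {r<..} b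
    = indicator {r<..R} b * ((1 / b) ^ (d + 1) / 2 * max 0 (b\<^sup>2 - \<rho>\<^sup>2))" for b
    using assms by (auto simp: indicator_def)
  ultimately show ?thesis by (simp only:)
qed

lemma ball_profile_diff_antimono:
  assumes "0 < \<rho>" "\<rho> \<le> \<rho>'" "0 \<le> r" "r \<le> R"
  shows "ball_profile d R \<rho>' - ball_profile d r \<rho>' \<le> ball_profile d R \<rho> - ball_profile d r \<rho>"
proof -
  have "0 < \<rho>'" using assms by simp
  show ?thesis
    unfolding ball_profile_diff[OF \<open>0 < \<rho>\<close> assms(3,4)] ball_profile_diff[OF \<open>0 < \<rho>'\<close> assms(3,4)]
  proof (rule integral_mono)
    fix b :: real
    have "\<rho>\<^sup>2 \<le> \<rho>'\<^sup>2" using assms by (intro power_mono) auto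
    then have "max 0 (b\<^sup>2 - \<rho>'\<^sup>2) \<le> max 0 (b\<^sup>2 - \<rho>\<^sup>2)" by auto
    then show "indicator {r<..R} b * ((1 / b) ^ (d + 1) / 2 * max 0 (b\<^sup>2 - \<rho>'\<^sup>2)) \<le> indicator {r<..R} b * ((1 / b) ^ (d + 1) / 2 * max 0 (b\<^sup>2 - \<rho>\<^sup>2))"
      using assms by (auto simp: indicator_def intro!: mult_left_mono divide_right_mono)
  qed (rule integrable_ball_profile_diff_integrand, use assms in simp, use assms in simp)+
qed

lemma ball_profile_diff_nonneg:
  assumes "0 < \<rho>" "0 \<le> r" "r \<le> R"
  shows "0 \<le> ball_profile d R \<rho> - ball_profile d r \<rho>"
  unfolding ball_profile_diff[OF assms]
  by (rule Bochner_Integration.integral_nonneg) (use assms in \<open>auto simp: indicator_def\<close>)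

section \<open>Closed form of the ball potential and its radial derivative\<close>

lemma DERIV_one_over_power:
  fixes b :: real
  assumes "b \<noteq> 0"
  shows "((\<lambda>b. (1 / b) ^ n) has_real_derivative - (real n * (1 / b) ^ (n + 1))) (at b)"
proof -
  have "((\<lambda>b. 1 / b) has_real_derivative - ((1 / b) * (1 / b))) (at b)"
    using assms by (auto intro!: derivative_eq_intros simp: power2_eq_square)
  from DERIV_power[OF this, of n] show ?thesis by (cases n) (simp_all add: mult_ac)
qed

text \<open>An antiderivative of \<open>(1 / b) ^ (d - 1)\<close>, logarithmic in the plane.\<close>

definition radial_antiderivative :: "nat \<Rightarrow> real \<Rightarrow> real" where
  "radial_antiderivative d b = (if d = 2 then ln b else - ((1 / b) ^ (d - 2)) / real (d - 2))"

lemma DERIV_radial_antiderivative: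
  assumes "2 \<le> d" "0 < b"
  shows "(radial_antiderivative d has_real_derivative (1 / b) ^ (d - 1)) (at b)"
proof (cases "d = 2")
  case True
  have "(ln has_real_derivative 1 / b) (at b)" using assms by (auto intro!: derivative_eq_intros simp: inverse_eq_divide)
  moreover have "radial_antiderivative d = ln" using True by (auto simp: radial_antiderivative_def)
  ultimately show ?thesis using True by simp
next
  case False
  obtain n where n: "d = Suc (Suc (Suc n))"
    using False assms by (metis One_nat_def Suc_1 add_2_eq_Suc le_Suc_ex not0_implies_Suc add.right_neutral numeral_2_eq_2)
  have "((\<lambda>b. - ((1 / b) ^ Suc n) / real (Suc n)) has_real_derivative (1 / b) ^ (Suc n + 1)) (at b)"
    using DERIV_cdivide[OF DERIV_minus[OF DERIV_one_over_power[of b "Suc n"]], of "real (Suc n)"] assms by (simp del: of_nat_Suc)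
  moreover have "radial_antiderivative d = (\<lambda>b. - ((1 / b) ^ Suc n) / real (Suc n))"
    by (auto simp: radial_antiderivative_def n)
  ultimately show ?thesis by (simp add: n)
qed

text \<open>Closed form of \<open>ball_profile\<close> for \<open>0 < \<rho> \<le> a\<close>,
  without the cut-off at \<open>\<rho> = a\<close>. It stays differentiable there, which makes
  limits at the boundary sphere accessible.\<close>

definition ball_profile_formula :: "nat \<Rightarrow> real \<Rightarrow> real \<Rightarrow> real" where
  "ball_profile_formula d a \<rho> = (radial_antiderivative d a - radial_antiderivative d \<rho>
    + \<rho>\<^sup>2 / real d * ((1 / a) ^ d - (1 / \<rho>) ^ d)) / 2"

lemma ball_profile_eq_formula:
  assumes d: "2 \<le> d" and \<rho>: "0 < \<rho>" "\<rho> \<le> a"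
  shows "ball_profile d a \<rho> = ball_profile_formula d a \<rho>"
proof -
  let ?k = "\<lambda>b. ((1 / b) ^ (d - 1) - \<rho>\<^sup>2 * (1 / b) ^ (d + 1)) / 2"
  let ?P = "\<lambda>b. (radial_antiderivative d b + \<rho>\<^sup>2 / real d * (1 / b) ^ d) / 2"
  have "ball_profile d a \<rho> = (\<integral>b. ?k b * indicator {\<rho>..a} b \<partial>lborel)"
    unfolding ball_profile_def
  proof (rule Bochner_Integration.integral_cong[OF refl])
    fix b :: real
    show "indicator {0..a} b * ((1 / b) ^ (d + 1) / 2 * max 0 (b\<^sup>2 - \<rho>\<^sup>2)) = ?k b * indicator {\<rho>..a} b"
    proof (cases "\<rho> \<le> b \<and> b \<le> a")
      case True
      then have b: "0 < b" "\<rho>\<^sup>2 \<le> b\<^sup>2" using \<rho> by (auto intro: power_mono)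
      obtain n where n: "d = Suc n" using d by (cases d) auto
      have "(1 / b) ^ (d + 1) * b\<^sup>2 = (1 / b) ^ (d - 1)"
        using b(1) by (simp add: n power2_eq_square field_simps)
      then show ?thesis using True b \<rho> by (simp add: indicator_def right_diff_distrib mult.commute diff_divide_distrib)
    next
      case False
      then show ?thesis using \<rho> power_mono[of b \<rho> 2] by (auto simp: indicator_def not_le)
    qed
  qed
  also have "\<dots> = ?P a - ?P \<rho>"
  proof (rule integral_FTC_Icc_real[OF \<rho>(2)])
    fix b assume "\<rho> \<le> b" "b \<le> a"
    then have b: "0 < b" using \<rho> by simp
    have "((\<lambda>b. radial_antiderivative d b + \<rho>\<^sup>2 / real d * (1 / b) ^ d) has_real_derivative
      ((1 / b) ^ (d - 1) + \<rho>\<^sup>2 / real d * - (real d * (1 / b) ^ (d + 1)))) (at b)"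
      using b by (intro DERIV_add DERIV_cmult DERIV_radial_antiderivative d DERIV_one_over_power) auto
    from DERIV_cdivide[OF this, of 2]
    show "(?P has_real_derivative ?k b) (at b)" using d by simp
    show "isCont ?k b" using b by (intro continuous_intros) auto
  qed
  finally show ?thesis by (simp add: ball_profile_formula_def right_diff_distrib diff_divide_distrib add_divide_distrib)
qed

lemma ball_profile_formula_same: "ball_profile_formula d a a = 0"
  by (simp add: ball_profile_formula_def)

text \<open>Times the area \<open>d * vol B\<^sub>1 * \<rho> ^ (d - 1)\<close> of the sphere this is
  \<open>vol B\<^sub>1 * ((\<rho> / a) ^ d - 1)\<close>, the charge enclosed for
  \<open>\<rho> \<le> a\<close>. The terms \<open>(1 / \<rho>) ^ (d - 1)\<close> coming from the
  antiderivative and from \<open>(1 / \<rho>) ^ d\<close> cancel.\<close>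

lemma DERIV_ball_profile_formula:
  assumes d: "2 \<le> d" and \<rho>: "0 < \<rho>"
  shows "(ball_profile_formula d a has_real_derivative \<rho> / real d * ((1 / a) ^ d - (1 / \<rho>) ^ d)) (at \<rho>)"
proof -
  obtain n where n: "d = Suc n" using d by (cases d) auto
  have sq: "((\<lambda>\<rho>. \<rho>\<^sup>2 / real d) has_real_derivative 2 * \<rho> / real d) (at \<rho>)"
    using d by (auto intro!: derivative_eq_intros)
  have "((\<lambda>\<rho>. \<rho>\<^sup>2 / real d * ((1 / a) ^ d - (1 / \<rho>) ^ d)) has_real_derivative
    2 * \<rho> / real d * ((1 / a) ^ d - (1 / \<rho>) ^ d) + (0 - - (real d * (1 / \<rho>) ^ (d + 1))) * (\<rho>\<^sup>2 / real d)) (at \<rho>)"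
    using \<rho> by (intro DERIV_mult sq DERIV_diff DERIV_const DERIV_one_over_power) auto
  from DERIV_cdivide[OF DERIV_add[OF DERIV_diff[OF DERIV_const[of "radial_antiderivative d a"] DERIV_radial_antiderivative[OF d \<rho>]] this], of 2]
  have "(ball_profile_formula d a has_real_derivative (0 - (1 / \<rho>) ^ (d - 1) + (2 * \<rho> / real d * ((1 / a) ^ d - (1 / \<rho>) ^ d)
    + (0 - - (real d * (1 / \<rho>) ^ (d + 1))) * (\<rho>\<^sup>2 / real d))) / 2) (at \<rho>)"
    by (simp add: ball_profile_formula_def[abs_def])
  moreover have "(1 / \<rho>) ^ (d + 1) * \<rho>\<^sup>2 = (1 / \<rho>) ^ (d - 1)"
    using \<rho> by (simp add: n power2_eq_square field_simps)
  ultimately show ?thesis using d by (simp add: mult.commute)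
qed

text \<open>With \<open>\<kappa> = 1 / (m * vol B\<^sub>1)\<close>, the function \<open>\<lambda>x. radial_profile d m \<kappa> r (norm x)\<close> solves
  \<open>\<Delta> V = m I\<^bsub>{r < |x| < R}\<^esub> - \<delta>\<^sub>0\<close> with compact support, where \<open>R = outer_radius d \<kappa> r\<close>.\<close>

definition outer_radius :: "nat \<Rightarrow> real \<Rightarrow> real \<Rightarrow> real" where
  "outer_radius d \<kappa> r = root d (r ^ d + \<kappa>)"

definition radial_profile :: "nat \<Rightarrow> real \<Rightarrow> real \<Rightarrow> real \<Rightarrow> real \<Rightarrow> real" where
  "radial_profile d m \<kappa> r \<rho> = m * (outer_radius d \<kappa> r ^ d * ball_profile d (outer_radius d \<kappa> r) \<rho> - r ^ d * ball_profile d r \<rho>)"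

lemma outer_radius:
  assumes "2 \<le> d" "0 < \<kappa>" "0 \<le> r"
  shows "outer_radius d \<kappa> r ^ d = r ^ d + \<kappa>" "r < outer_radius d \<kappa> r" "0 < outer_radius d \<kappa> r"
proof -
  have "0 < d" using assms by linarith
  then show 1: "outer_radius d \<kappa> r ^ d = r ^ d + \<kappa>"
    unfolding outer_radius_def using assms by (intro real_root_pow_pos2) auto
  show 3: "0 < outer_radius d \<kappa> r"
    using assms by (simp add: outer_radius_def add_nonneg_pos)
  show "r < outer_radius d \<kappa> r"
    by (rule power_less_imp_less_base[of _ d]) (use 1 3 assms in auto)
qed

text \<open>With \<open>R ^ d = r ^ d + \<kappa>\<close> the difference becomes a combination with
  nonnegative coefficients, so sign and monotonicity follow term by term.\<close>

lemma radial_profile_split: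
  assumes "2 \<le> d" "0 < \<kappa>" "0 \<le> r"
  shows "radial_profile d m \<kappa> r \<rho> = m * (\<kappa> * ball_profile d (outer_radius d \<kappa> r) \<rho>
    + r ^ d * (ball_profile d (outer_radius d \<kappa> r) \<rho> - ball_profile d r \<rho>))"
  by (simp add: radial_profile_def outer_radius[OF assms] algebra_simps)

lemma radial_profile_nonneg:
  assumes "2 \<le> d" "0 < \<kappa>" "0 \<le> r" "0 < m" "0 < \<rho>"
  shows "0 \<le> radial_profile d m \<kappa> r \<rho>"
  unfolding radial_profile_split[OF assms(1-3)]
  using assms outer_radius(2)[OF assms(1-3)] ball_profile_diff_nonneg[of \<rho> r "outer_radius d \<kappa> r" d]
  by (intro mult_nonneg_nonneg add_nonneg_nonneg ball_profile_nonneg) auto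

lemma radial_profile_antimono:
  assumes "2 \<le> d" "0 < \<kappa>" "0 \<le> r" "0 < m" "0 < \<rho>" "\<rho> \<le> \<rho>'"
  shows "radial_profile d m \<kappa> r \<rho>' \<le> radial_profile d m \<kappa> r \<rho>"
  unfolding radial_profile_split[OF assms(1-3)]
  using assms outer_radius(2)[OF assms(1-3)]
  by (intro mult_left_mono add_mono ball_profile_antimono ball_profile_diff_antimono) auto

lemma radial_profile_eq_0:
  assumes "2 \<le> d" "0 < \<kappa>" "0 \<le> r" "outer_radius d \<kappa> r \<le> \<rho>"
  shows "radial_profile d m \<kappa> r \<rho> = 0"
  using outer_radius[OF assms(1-3)] assms by (simp add: radial_profile_def ball_profile_eq_0)

text \<open>In the variable \<open>y = \<rho>\<^sup>d - r\<^sup>d\<close> the flux through the sphere of radius \<open>\<rho>\<close> does not depend on \<open>r\<close>.\<close>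

definition annulus_profile :: "nat \<Rightarrow> real \<Rightarrow> real \<Rightarrow> real \<Rightarrow> real \<Rightarrow> real" where
  "annulus_profile d m \<kappa> r y = m * (r ^ d + \<kappa>) * ball_profile_formula d (outer_radius d \<kappa> r) (root d (r ^ d + y))"

text \<open>From the sphere of radius \<open>r\<close> outwards the inner potential
  \<open>ball_profile d r\<close> is 0, and only the outer term, given by its closed form,
  remains.\<close>

lemma radial_profile_eq_annulus_profile:
  assumes "2 \<le> d" "0 < \<kappa>" "0 \<le> r" "0 \<le> y" "y \<le> \<kappa>" "0 < r ^ d + y"
  shows "radial_profile d m \<kappa> r (root d (r ^ d + y)) = annulus_profile d m \<kappa> r y"
proof -
  let ?\<rho> = "root d (r ^ d + y)"
  have "0 < ?\<rho>" using assms by simp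
  moreover have "?\<rho> \<le> outer_radius d \<kappa> r"
    unfolding outer_radius_def using assms by simp
  moreover have "r \<le> ?\<rho>"
    \<comment> \<open>The rule compares powers with exponent \<open>Suc n\<close>, so its
      \<open>n\<close> is \<open>d - 1\<close>.\<close>
    using assms by (intro power_le_imp_le_base[of r "d - 1" ?\<rho>]) auto
  ultimately show ?thesis
    using assms by (simp add: radial_profile_def annulus_profile_def ball_profile_eq_0 outer_radius ball_profile_eq_formula)
qed

text \<open>Up to constants, \<open>\<kappa> - y\<close> is the charge between the current sphere
  and the outer one. Of the two factors \<open>(1 / \<rho>) ^ (d - 1)\<close> one comes from the
  area of the sphere and one from the derivative of \<open>\<rho>\<close> with respect to
  \<open>y\<close>.\<close>

lemma DERIV_annulus_profile:
  assumes "2 \<le> d" "0 < \<kappa>" "0 \<le> r" "0 < r ^ d + y"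
  shows "(annulus_profile d m \<kappa> r has_real_derivative
    - (m / (real d)\<^sup>2 * (\<kappa> - y) * (1 / root d (r ^ d + y)) ^ (2 * (d - 1)))) (at y)"
proof -
  let ?\<rho> = "root d (r ^ d + y)" and ?R = "outer_radius d \<kappa> r"
  have \<rho>: "0 < ?\<rho>" using assms by simp
  have \<rho>d: "?\<rho> ^ d = r ^ d + y" using assms by simp
  obtain n where n: "d = Suc n" using assms by (cases d) auto
  have "((\<lambda>y. r ^ d + y) has_real_derivative 1) (at y)" by (auto intro!: derivative_eq_intros)
  from DERIV_chain2[OF DERIV_real_root[of d "r ^ d + y"] this]
  have "((\<lambda>y. root d (r ^ d + y)) has_real_derivative inverse (real d * ?\<rho> ^ (d - 1))) (at y)"
    using assms by simp
  from DERIV_cmult[OF DERIV_chain2[OF DERIV_ball_profile_formula[OF assms(1) \<rho>] this], of "m * (r ^ d + \<kappa>)" ?R]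
  have "(annulus_profile d m \<kappa> r has_real_derivative
    m * (r ^ d + \<kappa>) * (?\<rho> / real d * ((1 / ?R) ^ d - (1 / ?\<rho>) ^ d) * inverse (real d * ?\<rho> ^ (d - 1)))) (at y)"
    by (simp only: annulus_profile_def[abs_def])
  moreover have "m * (r ^ d + \<kappa>) * (?\<rho> / real d * ((1 / ?R) ^ d - (1 / ?\<rho>) ^ d) * inverse (real d * ?\<rho> ^ (d - 1)))
    = - (m / (real d)\<^sup>2 * (\<kappa> - y) * (1 / ?\<rho>) ^ (2 * (d - 1)))"
  proof -
    have "(r ^ d + \<kappa>) * ((1 / ?R) ^ d - (1 / ?\<rho>) ^ d) = 1 - (r ^ d + \<kappa>) / ?\<rho> ^ d"
      using outer_radius[OF assms(1-3)] assms by (simp add: power_one_over right_diff_distrib del: real_root_pow_pos2)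
        (auto simp: add_nonneg_pos less_imp_neq[symmetric])
    also have "\<dots> = - ((\<kappa> - y) * (1 / ?\<rho>) ^ d)"
      using assms(4) unfolding power_one_over \<rho>d by (simp add: field_simps)
    finally have "(r ^ d + \<kappa>) * ((1 / ?R) ^ d - (1 / ?\<rho>) ^ d) = - ((\<kappa> - y) * (1 / ?\<rho>) ^ d)" .
    moreover have "m * (r ^ d + \<kappa>) * (?\<rho> / real d * ((1 / ?R) ^ d - (1 / ?\<rho>) ^ d) * inverse (real d * ?\<rho> ^ (d - 1)))
      = m * (?\<rho> / real d * ((r ^ d + \<kappa>) * ((1 / ?R) ^ d - (1 / ?\<rho>) ^ d)) * inverse (real d * ?\<rho> ^ (d - 1)))"
      by (simp only: mult_ac)
    ultimately have "m * (r ^ d + \<kappa>) * (?\<rho> / real d * ((1 / ?R) ^ d - (1 / ?\<rho>) ^ d) * inverse (real d * ?\<rho> ^ (d - 1)))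
      = m * (?\<rho> / real d * (- ((\<kappa> - y) * (1 / ?\<rho>) ^ d)) * inverse (real d * ?\<rho> ^ (d - 1)))"
      by (simp only:)
    also have "\<dots> = - (m / (real d)\<^sup>2 * (\<kappa> - y) * (1 / ?\<rho>) ^ (2 * (d - 1)))"
    proof -
      have e: "(1 / ?\<rho>) ^ (2 * (d - 1)) = (1 / ?\<rho>) ^ n * (1 / ?\<rho>) ^ n"
        by (simp add: n power_add[symmetric] mult_2)
      have "m * (x / D * (- (z * (1 / x) ^ Suc n)) * inverse (D * x ^ n)) = - (m / D\<^sup>2 * z * ((1 / x) ^ n * (1 / x) ^ n))"
        if "0 < x" "0 < D" for x D z :: real
        using that by (simp add: field_simps power2_eq_square)
      from this[OF \<rho>, of "real d" "\<kappa> - y"] show ?thesis using assms(1) unfolding e by (simp add: n)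
    qed
    finally show ?thesis .
  qed
  ultimately show ?thesis by simp
qed

lemma annulus_profile_end:
  "2 \<le> d \<Longrightarrow> 0 < \<kappa> \<Longrightarrow> 0 \<le> r \<Longrightarrow> annulus_profile d m \<kappa> r \<kappa> = 0"
  by (simp add: annulus_profile_def outer_radius_def ball_profile_formula_same)

text \<open>The two derivatives differ only in the factor containing
  \<open>root d (r ^ d + y)\<close>: at equal \<open>y\<close> the larger \<open>r\<close> has the
  larger sphere, so its profile descends more slowly.\<close>

lemma annulus_profile_diff_decreasing:
  assumes d: "2 \<le> d" and \<kappa>: "0 < \<kappa>" and m: "0 < m" and r: "0 \<le> r1" "r1 < r2" and y: "0 < y" "y < y'" "y' \<le> \<kappa>"
  shows "annulus_profile d m \<kappa> r1 y' - annulus_profile d m \<kappa> r2 y' < annulus_profile d m \<kappa> r1 y - annulus_profile d m \<kappa> r2 y"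
proof -
  let ?D = "\<lambda>y. annulus_profile d m \<kappa> r1 y - annulus_profile d m \<kappa> r2 y"
  have pos: "0 < r1 ^ d + z" "0 < r2 ^ d + z" if "0 < z" for z
    using that r by (auto intro: add_nonneg_pos)
  have der: "(?D has_real_derivative
     - (m / (real d)\<^sup>2 * (\<kappa> - z) * (1 / root d (r1 ^ d + z)) ^ (2 * (d - 1)))
     - - (m / (real d)\<^sup>2 * (\<kappa> - z) * (1 / root d (r2 ^ d + z)) ^ (2 * (d - 1)))) (at z)" if "0 < z" for z
    using pos[OF that] d \<kappa> r by (intro DERIV_diff DERIV_annulus_profile) auto
  show ?thesis
  proof (rule DERIV_neg_imp_decreasing_open[OF y(2)])
    fix z assume z: "y < z" "z < y'"
    then have z0: "0 < z" using y by simp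
    have "root d (r1 ^ d + z) < root d (r2 ^ d + z)"
      using d r by (simp add: power_strict_mono)
    moreover have "0 < root d (r1 ^ d + z)" using pos[OF z0] d by simp
    ultimately have "(1 / root d (r2 ^ d + z)) ^ (2 * (d - 1)) < (1 / root d (r1 ^ d + z)) ^ (2 * (d - 1))"
      using d by (intro power_strict_mono) (auto simp: frac_less2 divide_strict_left_mono)
    then have "m / (real d)\<^sup>2 * (\<kappa> - z) * (1 / root d (r2 ^ d + z)) ^ (2 * (d - 1)) < m / (real d)\<^sup>2 * (\<kappa> - z) * (1 / root d (r1 ^ d + z)) ^ (2 * (d - 1))"
      using m d z y by (intro mult_strict_left_mono mult_pos_pos divide_pos_pos) auto
    then show "\<exists>l. (?D has_real_derivative l) (at z) \<and> l < 0"
      by (intro exI[of _ "- (m / (real d)\<^sup>2 * (\<kappa> - z) * (1 / root d (r1 ^ d + z)) ^ (2 * (d - 1)))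
     - - (m / (real d)\<^sup>2 * (\<kappa> - z) * (1 / root d (r2 ^ d + z)) ^ (2 * (d - 1)))"] conjI der z0) simp
  next
    show "continuous_on {y..y'} ?D"
      using y by (intro continuous_at_imp_continuous_on ballI DERIV_isCont[OF der]) auto
  qed
qed

text \<open>Suppose \<open>r1 < r2\<close>. Both annulus profiles end at 0, so the one of
  \<open>r1\<close> lies above by some \<delta> > 0, and the gap widens towards
  \<open>y = 0\<close>. Since the profile of \<open>r1\<close> stays below \<open>k\<close>, that of
  \<open>r2\<close> is at most \<open>k - \<delta>\<close> on its inner sphere, whereas its limit
  from inside is at least \<open>k\<close>.\<close>

lemma critical_radius_unique:
  assumes d: "2 \<le> d" and \<kappa>: "0 < \<kappa>" and m: "0 < m" and r: "0 \<le> r1" "0 \<le> r2"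
    and below: "\<And>\<rho>. r1 < \<rho> \<Longrightarrow> radial_profile d m \<kappa> r1 \<rho> < k"
    and above: "\<And>\<rho>. 0 < \<rho> \<Longrightarrow> \<rho> < r2 \<Longrightarrow> k \<le> radial_profile d m \<kappa> r2 \<rho>"
  shows "r2 \<le> r1"
proof (rule ccontr)
  assume "\<not> r2 \<le> r1"
  then have lt: "r1 < r2" and r2: "0 < r2" using r by auto
  let ?H1 = "annulus_profile d m \<kappa> r1" and ?H2 = "annulus_profile d m \<kappa> r2"
  \<comment> \<open>The gap is measured at an interior point: \<open>r1 = 0\<close> is possible, and
    then the radial solution is unbounded as \<open>y\<close> tends to 0. A fixed \<delta> also
    keeps the inequality strict in the limit.\<close>
  define \<delta> where "\<delta> = ?H1 (\<kappa> / 2) - ?H2 (\<kappa> / 2)"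
  have "?H1 \<kappa> - ?H2 \<kappa> < \<delta>"
    unfolding \<delta>_def by (rule annulus_profile_diff_decreasing[OF d \<kappa> m r(1) lt]) (use \<kappa> in auto)
  then have \<delta>: "0 < \<delta>" using annulus_profile_end d \<kappa> r by simp
  have H2: "?H2 y \<le> k - \<delta>" if y: "0 < y" "y < \<kappa> / 2" for y
  proof -
    have "\<delta> < ?H1 y - ?H2 y"
      unfolding \<delta>_def by (rule annulus_profile_diff_decreasing[OF d \<kappa> m r(1) lt]) (use \<kappa> y in auto)
    moreover have "?H1 y < k"
    proof -
      have p: "0 < r1 ^ d + y" using r y by (simp add: add_nonneg_pos)
      have "r1 < root d (r1 ^ d + y)"
        using p d y r by (intro power_less_imp_less_base[of r1 d]) auto
      from below[OF this] show ?thesis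
        using radial_profile_eq_annulus_profile[OF d \<kappa> r(1), of y m] p y \<kappa> by simp
    qed
    ultimately show ?thesis by linarith
  qed
  have "isCont ?H2 0"
    by (rule DERIV_isCont[OF DERIV_annulus_profile[OF d \<kappa> r(2)]]) (use r2 in auto)
  then have "(?H2 \<longlongrightarrow> ?H2 0) (at_right 0)"
    by (simp add: isCont_def filterlim_at_split)
  moreover have "\<forall>\<^sub>F y in at_right 0. ?H2 y \<le> k - \<delta>"
    using eventually_at_right_real[of 0 "\<kappa> / 2"] \<kappa> by (auto elim!: eventually_mono intro: H2)
  ultimately have le: "?H2 0 \<le> k - \<delta>"
    by (rule tendsto_upperbound) auto
  let ?R = "outer_radius d \<kappa> r2"
  note R = outer_radius[OF d \<kappa> r(2)]
  \<comment> \<open>Inside the ball both potentials are given by their closed forms, and this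
    expression is continuous up to the sphere \<open>\<rho> = r2\<close>.\<close>
  let ?G = "\<lambda>\<rho>. m * (?R ^ d * ball_profile_formula d ?R \<rho> - r2 ^ d * ball_profile_formula d r2 \<rho>)"
  have "isCont (ball_profile_formula d a) r2" for a
    by (rule DERIV_isCont[OF DERIV_ball_profile_formula[OF d r2]])
  then have "isCont ?G r2" by (intro continuous_intros) auto
  then have "(?G \<longlongrightarrow> ?G r2) (at_left r2)"
    by (simp add: isCont_def filterlim_at_split)
  moreover have "\<forall>\<^sub>F \<rho> in at_left r2. k \<le> ?G \<rho>"
    using eventually_at_left_real[OF r2]
  proof eventually_elim
    case (elim \<rho>)
    then have "radial_profile d m \<kappa> r2 \<rho> = ?G \<rho>"
      using R d by (simp add: radial_profile_def ball_profile_eq_formula)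
    with above[of \<rho>] elim show ?case by simp
  qed
  ultimately have "k \<le> ?G r2"
    by (rule tendsto_lowerbound) auto
  moreover have "?G r2 = ?H2 0"
    using r2 d R(1) by (simp add: annulus_profile_def ball_profile_formula_same real_root_power_cancel)
  ultimately show False using le \<delta> by linarith
qed

section \<open>Arbitrary solutions\<close>

lemma AE_norm_neq: "AE x in lborel. norm (x::'a::euclidean_space) \<noteq> r"
proof -
  have "sphere (0::'a) r \<in> null_sets lborel"
    using negligible_sphere[of "0::'a" r] by (simp add: null_sets_completion_iff negligible_iff_null_sets)
  from AE_not_in[OF this] show ?thesis by simp
qed

text \<open>A nonempty spherical shell is open and therefore not negligible;
  \<open>0 \<le> r\<close> ensures that a vector of length \<open>(r + s) / 2\<close> lies in
  it.\<close>

lemma AE_norm_interval_impossible: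
  assumes "AE x in lborel. \<not> (r < norm (x::'a::euclidean_space) \<and> norm x < s)" and "0 \<le> r"
  shows "s \<le> r"
proof (rule ccontr)
  assume "\<not> s \<le> r"
  let ?U = "{x::'a. r < norm x \<and> norm x < s}"
  have U: "open ?U" by (intro open_Collect_conj open_Collect_less continuous_intros)
  obtain b :: 'a where b: "b \<in> Basis" using nonempty_Basis by blast
  have "((r + s) / 2) *\<^sub>R b \<in> ?U" using b \<open>\<not> s \<le> r\<close> assms(2) by (simp add: field_simps)
  then have "?U \<noteq> {}" by blast
  moreover have "?U \<in> null_sets lborel"
    using assms(1) U by (subst AE_iff_null_sets) auto
  then have "negligible ?U" by (simp add: negligible_iff_null_sets null_sets_completionI)
  ultimately show False using open_not_negligible[OF U] by blast
qed

lemma integrable_radial_profile: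
  "integrable lborel (\<lambda>x::real^'d::finite. radial_profile CARD('d) m \<kappa> r (norm x))"
  unfolding radial_profile_def
  by (intro integrable_mult_right Bochner_Integration.integrable_diff integrable_ball_profile)

lemma integral_radial_profile_laplacian:
  fixes \<phi> :: "real^'d::finite \<Rightarrow> real"
  assumes d: "2 \<le> CARD('d)" and m: "0 < m" and r: "0 \<le> r" and \<phi>: "test_function \<phi>"
    and \<kappa>: "\<kappa> = 1 / (m * measure lborel (ball (0::real^'d) 1))"
  shows "(\<integral>x. radial_profile CARD('d) m \<kappa> r (norm x) * laplacian \<phi> x \<partial>lborel)
    = m * (\<integral>x. (indicator (ball 0 (outer_radius CARD('d) \<kappa> r)) x - indicator (ball 0 r) x) * \<phi> x \<partial>lborel) - \<phi> 0"
proof -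
  let ?d = "CARD('d)" and ?\<omega> = "measure lborel (ball (0::real^'d) 1)"
  let ?R = "outer_radius ?d \<kappa> r"
  have \<omega>: "0 < ?\<omega>" using content_ball_pos[of 1 "0::real^'d"] by simp
  have \<kappa>0: "0 < \<kappa>" using m \<omega> \<kappa> by simp
  note R = outer_radius[OF d \<kappa>0 r]
  obtain B where B: "\<And>x. \<bar>\<phi> x\<bar> \<le> B" using test_function_bounded[OF \<phi>] by blast
  obtain C where C: "\<And>x. \<bar>laplacian \<phi> x\<bar> \<le> C"
    using test_function_bounded[OF test_function_laplacian[OF \<phi>]] by blast
  note [measurable] = test_function_measurable[OF \<phi>] test_function_measurable[OF test_function_laplacian[OF \<phi>]]
  have i: "integrable lborel (\<lambda>x. ball_profile ?d a (norm x) * laplacian \<phi> x)" for a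
    by (rule integrable_bounded_mult[OF integrable_ball_profile _ C]) measurable
  have ib: "integrable lborel (\<lambda>x::real^'d. indicator (ball 0 a) x * \<phi> x)" for a
    by (rule integrable_bounded_mult[OF integrable_real_indicator _ B])
      (use emeasure_bounded_finite[OF bounded_ball, of "0::real^'d" a] in auto)
  have ball_term: "a ^ ?d * (\<integral>x. ball_profile ?d a (norm x) * laplacian \<phi> x \<partial>lborel)
    = (\<integral>x. indicator (ball 0 a) x * \<phi> x \<partial>lborel) - a ^ ?d * ?\<omega> * \<phi> 0" if "0 \<le> a" for a
  proof (cases "a = 0")
    case True
    then show ?thesis using d by (simp add: zero_power)
  next
    case False
    then show ?thesis using integral_ball_profile_laplacian[OF \<phi>, of a] that
      by (simp add: right_diff_distrib power_one_over)
  qed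
  have "(\<integral>x. radial_profile ?d m \<kappa> r (norm x) * laplacian \<phi> x \<partial>lborel)
    = (\<integral>x. m * (?R ^ ?d * (ball_profile ?d ?R (norm x) * laplacian \<phi> x) - r ^ ?d * (ball_profile ?d r (norm x) * laplacian \<phi> x)) \<partial>lborel)"
    by (simp add: radial_profile_def algebra_simps)
  also have "\<dots> = m * (?R ^ ?d * (\<integral>x. ball_profile ?d ?R (norm x) * laplacian \<phi> x \<partial>lborel) - r ^ ?d * (\<integral>x. ball_profile ?d r (norm x) * laplacian \<phi> x \<partial>lborel))"
    using i by simp
  also have "\<dots> = m * ((\<integral>x. indicator (ball 0 ?R) x * \<phi> x \<partial>lborel) - (\<integral>x. indicator (ball 0 r) x * \<phi> x \<partial>lborel)) - m * (?R ^ ?d - r ^ ?d) * ?\<omega> * \<phi> 0"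
    unfolding ball_term[OF r] ball_term[OF less_imp_le[OF R(3)]] by (simp add: algebra_simps)
  \<comment> \<open>This normalisation determines \<kappa>: the Dirac mass must have coefficient
    1.\<close>
  also have "m * (?R ^ ?d - r ^ ?d) * ?\<omega> = 1"
  proof -
    have "?R ^ ?d - r ^ ?d = \<kappa>" using R(1) by simp
    then show ?thesis using \<omega> m by (simp only:) (simp add: \<kappa>)
  qed
  also have "(\<integral>x. indicator (ball 0 ?R) x * \<phi> x \<partial>lborel) - (\<integral>x. indicator (ball 0 r) x * \<phi> x \<partial>lborel)
    = (\<integral>x. (indicator (ball 0 ?R) x - indicator (ball 0 r) x) * \<phi> x \<partial>lborel)"
    using ib by (simp add: left_diff_distrib)
  finally show ?thesis by simp
qed

text \<open>The maximum principle works on \<open>lborel\<close> with functions that vanish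
  everywhere outside a ball. A compactly supported solution agrees almost everywhere with such a
  Borel function, and the level set \<open>{0 < u < k}\<close> changes only by a null set.\<close>

lemma solution_borel_representative:
  fixes u :: "real^'d::finite \<Rightarrow> real"
  assumes sol: "is_solution m k u" and supp: "compactly_supported u"
  obtains u' K where "u' \<in> borel_measurable borel" "integrable lborel u'" "0 < K" "\<And>x. K \<le> norm x \<Longrightarrow> u' x = 0"
    "AE x in lebesgue. u x = u' x"
    "\<And>\<phi>. test_function \<phi> \<Longrightarrow> (\<integral>x. u' x * laplacian \<phi> x \<partial>lborel) = m * (\<integral>x. indicator {x. 0 < u' x \<and> u' x < k} x * \<phi> x \<partial>lborel) - \<phi> 0"
proof -
  obtain Q where Q: "compact Q" "AE x in lebesgue. x \<notin> Q \<longrightarrow> u x = 0"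
    using supp by (auto simp: compactly_supported_def)
  obtain K where K: "0 < K" "\<And>x. x \<in> Q \<Longrightarrow> norm x < K"
  proof -
    obtain b where "0 < b" "\<forall>x\<in>Q. norm x \<le> b"
      using compact_imp_bounded[OF Q(1)] by (auto simp: bounded_pos)
    then show ?thesis by (intro that[of "b + 1"]) force+
  qed
  have loc: "integrable lebesgue (\<lambda>x. indicator (cball 0 r) x *\<^sub>R u x)" for r
  proof -
    have "u absolutely_integrable_on cball 0 r"
      using sol compact_cball by (auto simp: is_solution_def locally_integrable_def)
    then show ?thesis by (simp add: set_integrable_def)
  qed
  \<comment> \<open>Local integrability gives measurability of the truncations to balls only; these
    converge pointwise to \<open>u\<close>.\<close>
  have um: "u \<in> borel_measurable lebesgue"
  proof (rule borel_measurable_LIMSEQ_real[where u = "\<lambda>n x. indicator (cball 0 (real n)) x *\<^sub>R u x"])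
    show "(\<lambda>x. indicator (cball 0 (real n)) x *\<^sub>R u x) \<in> borel_measurable lebesgue" for n
      using loc by (rule borel_measurable_integrable)
    fix x :: "real^'d"
    obtain N :: nat where N: "norm x \<le> real N" using real_arch_simple by blast
    have "\<forall>\<^sub>F n in sequentially. u x = indicator (cball 0 (real n)) x *\<^sub>R u x"
      using eventually_ge_at_top[of N] by eventually_elim (use N in \<open>auto simp: indicator_def\<close>)
    then show "(\<lambda>n. indicator (cball 0 (real n)) x *\<^sub>R u x) \<longlonglongrightarrow> u x"
      by (rule Lim_transform_eventually[OF tendsto_const])
  qed
  obtain g where g: "g \<in> borel_measurable lborel" "AE x in lborel. u x = g x"
    using completion_ex_borel_measurable_real[OF um] by auto
  define u' where "u' x = (if norm x < K then g x else 0)" for x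
  have [measurable]: "g \<in> borel_measurable borel" using g by simp
  have u'm[measurable]: "u' \<in> borel_measurable borel" unfolding u'_def by measurable
  have u'l[measurable]: "u' \<in> borel_measurable lebesgue" using u'm by (simp add: measurable_completion)
  have eq: "AE x in lebesgue. u x = u' x"
    using Q(2) AE_completion[OF g(2)] by eventually_elim (use K(2) in \<open>auto simp: u'_def\<close>)
  have supp': "u' x = 0" if "K \<le> norm x" for x using that by (simp add: u'_def)
  have "integrable lebesgue u'"
  proof (rule integrable_cong_AE_imp[OF loc[of K] u'l])
    show "AE x in lebesgue. indicator (cball 0 K) x *\<^sub>R u x = u' x"
      using eq by eventually_elim (use supp' in \<open>auto simp: indicator_def\<close>)
  qed
  then have int: "integrable lborel u'" using u'm by (subst (asm) integrable_completion) auto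
  have regular: "regular_distr f \<psi> = (\<integral>x. f' x * \<psi> x \<partial>lborel)"
    if "f \<in> borel_measurable lebesgue" "f' \<in> borel_measurable borel" "AE x in lebesgue. f x = f' x" "\<psi> \<in> borel_measurable borel"
    for f f' \<psi> :: "real^'d \<Rightarrow> real"
  proof -
    have [measurable]: "f \<in> borel_measurable lebesgue" "f' \<in> borel_measurable lebesgue" "\<psi> \<in> borel_measurable lebesgue"
      using that by (auto simp: measurable_completion)
    have "regular_distr f \<psi> = (\<integral>x. f' x * \<psi> x \<partial>lebesgue)"
      unfolding regular_distr_def
    proof (rule integral_cong_AE)
      show "AE x in lebesgue. f x * \<psi> x = f' x * \<psi> x" using that(3) by eventually_elim simp
    qed measurable
    also have "\<dots> = (\<integral>x. f' x * \<psi> x \<partial>lborel)"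
      using that by (intro integral_completion borel_measurable_times) simp_all
    finally show ?thesis .
  qed
  have "(\<integral>x. u' x * laplacian \<phi> x \<partial>lborel) = m * (\<integral>x. indicator {x. 0 < u' x \<and> u' x < k} x * \<phi> x \<partial>lborel) - \<phi> 0"
    if \<phi>: "test_function \<phi>" for \<phi>
  proof -
    have "regular_distr u (laplacian \<phi>) = m * regular_distr (indicator {x. 0 < u x \<and> u x < k}) \<phi> - \<phi> 0"
      using sol \<phi> by (simp add: is_solution_def distr_eq_def distr_laplacian_def dirac_delta_def)
    moreover have "regular_distr u (laplacian \<phi>) = (\<integral>x. u' x * laplacian \<phi> x \<partial>lborel)"
      by (rule regular[OF um u'm eq test_function_measurable[OF test_function_laplacian[OF \<phi>]]])
    moreover have "regular_distr (indicator {x. 0 < u x \<and> u x < k}) \<phi> = (\<integral>x. indicator {x. 0 < u' x \<and> u' x < k} x * \<phi> x \<partial>lborel)"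
    proof (rule regular[OF _ _ _ test_function_measurable[OF \<phi>]])
      show "indicator {x. 0 < u x \<and> u x < k} \<in> borel_measurable lebesgue"
        using um by measurable
      show "AE x in lebesgue. indicator {x. 0 < u x \<and> u x < k} x = (indicator {x. 0 < u' x \<and> u' x < k} x :: real)"
        using eq by eventually_elim (simp add: indicator_def)
    qed measurable
    ultimately show ?thesis by simp
  qed
  with u'm int K(1) supp' eq show ?thesis using that by blast
qed

text \<open>Both balls are open, so the inner sphere belongs to the annulus and the interval is
  closed at \<open>r\<close>.\<close>

lemma indicator_annulus:
  assumes "r < R"
  shows "indicator (ball 0 R) x - indicator (ball 0 r) x = (indicator {r..<R} (norm (x::'a::real_normed_vector)) :: real)"
  using assms by (auto simp: indicator_def)

lemma integral_solution_diff_radial_profile_laplacian: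
  fixes u \<phi> :: "real^'d::finite \<Rightarrow> real"
  assumes d: "2 \<le> CARD('d)" and m: "0 < m" and r: "0 \<le> r"
    and \<kappa>: "\<kappa> = 1 / (m * measure lborel (ball (0::real^'d) 1))"
    and u: "u \<in> borel_measurable borel" "integrable lborel u"
    and eq: "(\<integral>x. u x * laplacian \<phi> x \<partial>lborel) = m * (\<integral>x. indicator {x. 0 < u x \<and> u x < k} x * \<phi> x \<partial>lborel) - \<phi> 0"
    and \<phi>: "test_function \<phi>"
  shows "(\<integral>x. (u x - radial_profile CARD('d) m \<kappa> r (norm x)) * laplacian \<phi> x \<partial>lborel)
    = (\<integral>x. m * (indicator {x. 0 < u x \<and> u x < k} x - indicator {r..<outer_radius CARD('d) \<kappa> r} (norm x)) * \<phi> x \<partial>lborel)"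
proof -
  note u(1)[measurable]
  let ?V = "\<lambda>x::real^'d. radial_profile CARD('d) m \<kappa> r (norm x)"
  let ?R = "outer_radius CARD('d) \<kappa> r"
  let ?I = "\<lambda>x. indicator {x. 0 < u x \<and> u x < k} x :: real"
  let ?J = "\<lambda>x::real^'d. indicator {r..<?R} (norm x) :: real"
  have "0 < \<kappa>" using m content_ball_pos[of 1 "0::real^'d"] by (simp add: \<kappa>)
  note R = outer_radius[OF d this r]
  obtain C where C: "\<And>x. \<bar>laplacian \<phi> x\<bar> \<le> C"
    using test_function_bounded[OF test_function_laplacian[OF \<phi>]] by blast
  note [measurable] = test_function_measurable[OF \<phi>] test_function_measurable[OF test_function_laplacian[OF \<phi>]]
  have i1: "integrable lborel (\<lambda>x. u x * laplacian \<phi> x)"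
    by (rule integrable_bounded_mult[OF u(2) _ C]) measurable
  have i2: "integrable lborel (\<lambda>x. ?V x * laplacian \<phi> x)"
    by (rule integrable_bounded_mult[OF integrable_radial_profile _ C]) measurable
  have Im: "?I \<in> borel_measurable lborel" by measurable
  have i3: "integrable lborel (\<lambda>x. \<phi> x * ?I x)"
    by (rule integrable_bounded_mult[OF integrable_test_function[OF \<phi>] Im, where B = 1]) (simp add: indicator_def)
  have Jm: "?J \<in> borel_measurable lborel" by measurable
  have i4: "integrable lborel (\<lambda>x. \<phi> x * ?J x)"
    by (rule integrable_bounded_mult[OF integrable_test_function[OF \<phi>] Jm, where B = 1]) (simp add: indicator_def)
  have "(\<integral>x. (u x - ?V x) * laplacian \<phi> x \<partial>lborel) = (\<integral>x. u x * laplacian \<phi> x \<partial>lborel) - (\<integral>x. ?V x * laplacian \<phi> x \<partial>lborel)"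
    using i1 i2 by (simp add: left_diff_distrib)
  also have "\<dots> = m * ((\<integral>x. \<phi> x * ?I x \<partial>lborel) - (\<integral>x. \<phi> x * ?J x \<partial>lborel))"
    unfolding eq integral_radial_profile_laplacian[OF d m r \<phi> \<kappa>] indicator_annulus[OF R(2)]
    by (simp add: right_diff_distrib mult.commute)
  also have "\<dots> = (\<integral>x. m * (\<phi> x * ?I x - \<phi> x * ?J x) \<partial>lborel)"
    by (simp only: integral_mult_right_zero Bochner_Integration.integral_diff[OF i3 i4])
  also have "\<dots> = (\<integral>x. m * (?I x - ?J x) * \<phi> x \<partial>lborel)"
    by (rule Bochner_Integration.integral_cong) (simp_all add: algebra_simps)
  finally show ?thesis .
qed

text \<open>The set \<open>{u \<ge> k}\<close> determines \<open>u\<close> as the solution of an obstacle problem whose right-hand side is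
  monotone in that set, so balls containing it or contained in it give radial barriers.\<close>

lemma solution_compare_radial_profile:
  fixes u :: "real^'d::finite \<Rightarrow> real"
  assumes d: "2 \<le> CARD('d)" and m: "0 < m" and r: "0 \<le> r"
    and \<kappa>: "\<kappa> = 1 / (m * measure lborel (ball (0::real^'d) 1))"
    and u: "u \<in> borel_measurable borel" "integrable lborel u" "0 < K" "\<And>x. K \<le> norm x \<Longrightarrow> u x = 0"
    and eq: "\<And>\<phi>. test_function \<phi> \<Longrightarrow> (\<integral>x. u x * laplacian \<phi> x \<partial>lborel) = m * (\<integral>x. indicator {x. 0 < u x \<and> u x < k} x * \<phi> x \<partial>lborel) - \<phi> 0"
  shows "AE x in lborel. r < norm x \<longrightarrow> u x < k \<Longrightarrow> AE x in lborel. u x \<le> radial_profile CARD('d) m \<kappa> r (norm x)"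
    and "AE x in lborel. norm x < r \<longrightarrow> k \<le> u x \<Longrightarrow> AE x in lborel. radial_profile CARD('d) m \<kappa> r (norm x) \<le> u x"
proof -
  note u(1)[measurable]
  let ?V = "\<lambda>x::real^'d. radial_profile CARD('d) m \<kappa> r (norm x)"
  let ?R = "outer_radius CARD('d) \<kappa> r"
  let ?I = "\<lambda>x. indicator {x. 0 < u x \<and> u x < k} x :: real"
  let ?J = "\<lambda>x::real^'d. indicator {r..<?R} (norm x) :: real"
  have \<kappa>0: "0 < \<kappa>" using m content_ball_pos[of 1 "0::real^'d"] by (simp add: \<kappa>)
  have iw: "integrable lborel (\<lambda>x. u x - ?V x)"
    using u(2) integrable_radial_profile by (rule Bochner_Integration.integrable_diff)
  have V0: "?V x = 0" if "?R \<le> norm x" for x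
    using that by (rule radial_profile_eq_0[OF d \<kappa>0 r])
  have w0: "u x - ?V x = 0" if "max K ?R \<le> norm x" for x
    using that u(4)[of x] V0[of x] by simp
  have fm: "(\<lambda>x. m * (?I x - ?J x)) \<in> borel_measurable borel" by measurable
  have f_le: "\<bar>m * (?I x - ?J x)\<bar> \<le> m" for x using m by (auto simp: indicator_def)
  have f0: "m * (?I x - ?J x) = 0" if "max K ?R \<le> norm x" for x
    using that u(4)[of x] by (auto simp: indicator_def)
  have K: "0 < max K ?R" using u(3) by simp
  have weak: "(\<integral>x. (u x - ?V x) * laplacian \<phi> x \<partial>lborel) = (\<integral>x. m * (?I x - ?J x) * \<phi> x \<partial>lborel)"
    if "test_function \<phi>" for \<phi>
    by (rule integral_solution_diff_radial_profile_laplacian[OF d m r \<kappa> u(1,2) eq[OF that] that])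
  show "AE x in lborel. u x \<le> ?V x" if out: "AE x in lborel. r < norm x \<longrightarrow> u x < k"
  proof -
    have "AE x in lborel. 0 < u x - ?V x \<longrightarrow> 0 \<le> m * (?I x - ?J x)"
      using out AE_norm_neq[of r] AE_lborel_singleton[of 0]
    proof eventually_elim
      case (elim x)
      then have "0 \<le> ?V x" using radial_profile_nonneg[OF d \<kappa>0 r m, of "norm x"] by simp
      then show ?case using elim m by (auto simp: indicator_def)
    qed
    from weak_maximum_principle[OF iw w0 fm f_le f0 weak this K]
    show ?thesis by simp
  qed
  show "AE x in lborel. ?V x \<le> u x" if ins: "AE x in lborel. norm x < r \<longrightarrow> k \<le> u x"
  proof -
    have "AE x in lborel. ?V x - u x \<le> 0"
    proof (rule weak_maximum_principle[where K = "max K ?R" and B = m and f = "\<lambda>x. - (m * (?I x - ?J x))"])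
      show "integrable lborel (\<lambda>x. ?V x - u x)"
        using integrable_minus[OF iw] by simp
      show "?V x - u x = 0" if "max K ?R \<le> norm x" for x using w0[OF that] by simp
      show "(\<lambda>x. - (m * (?I x - ?J x))) \<in> borel_measurable borel" using fm by simp
      show "\<bar>- (m * (?I x - ?J x))\<bar> \<le> m" for x using f_le[of x] by simp
      show "- (m * (?I x - ?J x)) = 0" if "max K ?R \<le> norm x" for x using f0[OF that] by simp
      show "0 < max K ?R" by (rule K)
      \<comment> \<open>Beyond \<open>?R\<close> the profile is 0, so \<open>u\<close> is negative
        and both indicators vanish; inside radius \<open>r\<close> both vanish because
        \<open>k \<le> u\<close>; on the annulus \<open>?J\<close> is 1.\<close>
      show "AE x in lborel. 0 < ?V x - u x \<longrightarrow> 0 \<le> - (m * (?I x - ?J x))"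
        using ins
      proof eventually_elim
        case (elim x)
        then show ?case using V0[of x] m by (cases "?R \<le> norm x") (auto simp: indicator_def)
      qed
      show "(\<integral>x. (?V x - u x) * laplacian \<phi> x \<partial>lborel) = (\<integral>x. - (m * (?I x - ?J x)) * \<phi> x \<partial>lborel)"
        if "test_function \<phi>" for \<phi>
      proof -
        have "(\<integral>x. (?V x - u x) * laplacian \<phi> x \<partial>lborel) = (\<integral>x. - ((u x - ?V x) * laplacian \<phi> x) \<partial>lborel)"
          by (rule Bochner_Integration.integral_cong) (simp_all add: algebra_simps)
        also have "\<dots> = - (\<integral>x. (u x - ?V x) * laplacian \<phi> x \<partial>lborel)"
          by (rule integral_minus)
        also have "\<dots> = (\<integral>x. - (m * (?I x - ?J x) * \<phi> x) \<partial>lborel)"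
          unfolding weak[OF that] by (rule integral_minus[symmetric])
        finally show ?thesis by (simp only: mult_minus_left)
      qed
    qed
    then show ?thesis by simp
  qed
qed

text \<open>The smallest ball outside which \<open>u < k\<close> and the largest ball inside which \<open>u \<ge> k\<close> are
  squeezed together by \<open>critical_radius_unique\<close>.\<close>

lemma solution_eq_radial_profile:
  fixes u :: "real^'d::finite \<Rightarrow> real"
  assumes d: "2 \<le> CARD('d)" and m: "0 < m" and k: "0 < k"
    and \<kappa>: "\<kappa> = 1 / (m * measure lborel (ball (0::real^'d) 1))"
    and sol: "is_solution m k u" and supp: "compactly_supported u"
  obtains r where "0 \<le> r" "AE x in lebesgue. u x = radial_profile CARD('d) m \<kappa> r (norm x)"
    "\<And>\<rho>. r < \<rho> \<Longrightarrow> radial_profile CARD('d) m \<kappa> r \<rho> < k"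
    "\<And>\<rho>. 0 < \<rho> \<Longrightarrow> \<rho> < r \<Longrightarrow> k \<le> radial_profile CARD('d) m \<kappa> r \<rho>"
proof -
  let ?V = "radial_profile CARD('d) m \<kappa>"
  have \<kappa>0: "0 < \<kappa>" using m content_ball_pos[of 1 "0::real^'d"] by (simp add: \<kappa>)
  obtain v K where v: "v \<in> borel_measurable borel" "integrable lborel v" "0 < K" "\<And>x. K \<le> norm x \<Longrightarrow> v x = 0"
    and uv: "AE x in lebesgue. u x = v x"
    and eq: "\<And>\<phi>. test_function \<phi> \<Longrightarrow> (\<integral>x. v x * laplacian \<phi> x \<partial>lborel) = m * (\<integral>x. indicator {x. 0 < v x \<and> v x < k} x * \<phi> x \<partial>lborel) - \<phi> 0"
    using solution_borel_representative[OF sol supp] by blast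
  note compare = solution_compare_radial_profile[OF d m _ \<kappa> v eq]
  define S where "S = {\<rho>. 0 \<le> \<rho> \<and> (AE x in lborel. \<rho> < norm x \<longrightarrow> v x < k)}"
  define T where "T = {\<rho>. 0 \<le> \<rho> \<and> (AE x in lborel. norm x < \<rho> \<longrightarrow> k \<le> v x)}"
  \<comment> \<open>Outside the support \<open>v\<close> is 0, which lies below \<open>k\<close>
    because \<open>0 < k\<close>; hence \<open>S\<close> is nonempty.\<close>
  have KS: "K \<in> S" using v(3,4) k by (auto simp: S_def intro!: AE_I2)
  have S_bdd: "bdd_below S" by (auto simp: S_def bdd_below_def)
  have T0: "0 \<in> T" by (simp add: T_def)
  \<comment> \<open>Otherwise \<open>v x < k\<close> and \<open>k \<le> v x\<close> would hold
    together on a shell of positive measure.\<close>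
  have ST: "\<rho> \<le> s" if "s \<in> S" "\<rho> \<in> T" for s \<rho>
  proof (rule AE_norm_interval_impossible[where ?'a = "real^'d"])
    have "AE x in lborel. s < norm x \<longrightarrow> v x < k" "AE x in lborel. norm x < \<rho> \<longrightarrow> k \<le> v x"
      using that by (auto simp: S_def T_def)
    then show "AE x in lborel. \<not> (s < norm (x::real^'d) \<and> norm x < \<rho>)"
      by eventually_elim force
    show "0 \<le> s" using that by (simp add: S_def)
  qed
  have T_bdd: "bdd_above T" using ST[OF KS] by (auto simp: bdd_above_def)
  define r2 where "r2 = Inf S"
  define r1 where "r1 = Sup T"
  have r2: "0 \<le> r2" unfolding r2_def using KS by (intro cInf_greatest) (auto simp: S_def)
  have r1: "0 \<le> r1" unfolding r1_def by (rule cSup_upper[OF T0 T_bdd])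
  have r12: "r1 \<le> r2"
    unfolding r1_def r2_def using T0 KS ST by (intro cSup_least cInf_greatest) auto
  have out: "AE x in lborel. r2 < norm x \<longrightarrow> v x < k"
  proof -
    \<comment> \<open>The infimum is attained: the exteriors of radius
      \<open>r2 + 1 / real (Suc n)\<close> exhaust that of radius \<open>r2\<close>, and countably
      many null sets can be collected.\<close>
    have "AE x in lborel. r2 + 1 / real (Suc n) < norm x \<longrightarrow> v x < k" for n
    proof -
      have "Inf S < r2 + 1 / real (Suc n)" by (simp add: r2_def)
      then obtain s where s: "s \<in> S" "s < r2 + 1 / real (Suc n)"
        using cInf_lessD[of S] KS by blast
      then have "AE x in lborel. s < norm x \<longrightarrow> v x < k" by (simp add: S_def)
      then show ?thesis by eventually_elim (use s(2) in auto)
    qed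
    then have "AE x in lborel. \<forall>n. r2 + 1 / real (Suc n) < norm x \<longrightarrow> v x < k"
      unfolding AE_all_countable by blast
    then show ?thesis
    proof eventually_elim
      case (elim x)
      show ?case
      proof
        assume "r2 < norm x"
        then obtain n where "inverse (real (Suc n)) < norm x - r2"
          using reals_Archimedean[of "norm x - r2"] by auto
        then have "r2 + 1 / real (Suc n) < norm x" by (simp add: inverse_eq_divide)
        with elim show "v x < k" by blast
      qed
    qed
  qed
  have ins: "AE x in lborel. norm x < r1 \<longrightarrow> k \<le> v x"
  proof -
    have "AE x in lborel. norm x < r1 - 1 / real (Suc n) \<longrightarrow> k \<le> v x" for n
    proof -
      have "r1 - 1 / real (Suc n) < Sup T" by (simp add: r1_def)
      then obtain s where s: "s \<in> T" "r1 - 1 / real (Suc n) < s"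
        using less_cSupD[of T] T0 by blast
      then have "AE x in lborel. norm x < s \<longrightarrow> k \<le> v x" by (simp add: T_def)
      then show ?thesis by eventually_elim (use s(2) in auto)
    qed
    then have "AE x in lborel. \<forall>n. norm x < r1 - 1 / real (Suc n) \<longrightarrow> k \<le> v x"
      unfolding AE_all_countable by blast
    then show ?thesis
    proof eventually_elim
      case (elim x)
      show ?case
      proof
        assume "norm x < r1"
        then obtain n where "inverse (real (Suc n)) < r1 - norm x"
          using reals_Archimedean[of "r1 - norm x"] by auto
        then have "norm x < r1 - 1 / real (Suc n)" by (simp add: inverse_eq_divide)
        with elim show "k \<le> v x" by blast
      qed
    qed
  qed
  have upper: "AE x in lborel. v x \<le> ?V r2 (norm x)" by (rule compare(1)[OF r2 _ _ out])
  have lower: "AE x in lborel. ?V r1 (norm x) \<le> v x" by (rule compare(2)[OF r1 _ _ ins])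
  \<comment> \<open>Maximality of \<open>r1\<close>: the profile decreases in the radius, so
    \<open>k \<le> ?V r1 \<rho>\<close> would put the lower barrier at \<open>k\<close> or above on
    the whole ball of radius \<rho>, up to the origin.\<close>
  have below: "?V r1 \<rho> < k" if \<rho>: "r1 < \<rho>" for \<rho>
  proof (rule ccontr)
    assume "\<not> ?V r1 \<rho> < k"
    have "AE x in lborel. norm x < \<rho> \<longrightarrow> k \<le> v x"
      using lower AE_lborel_singleton[of 0]
    proof eventually_elim
      case (elim x)
      then show ?case
        using radial_profile_antimono[OF d \<kappa>0 r1 m, of "norm x" \<rho>] \<open>\<not> ?V r1 \<rho> < k\<close> by auto
    qed
    then have "\<rho> \<in> T" using r1 \<rho> by (simp add: T_def)
    then show False using cSup_upper[OF _ T_bdd] \<rho> by (fastforce simp: r1_def)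
  qed
  \<comment> \<open>Minimality of \<open>r2\<close>: otherwise the upper barrier would be below
    \<open>k\<close> everywhere outside radius \<rho>, and \<rho> would belong to
    \<open>S\<close>.\<close>
  have above: "k \<le> ?V r2 \<rho>" if \<rho>: "0 < \<rho>" "\<rho> < r2" for \<rho>
  proof (rule ccontr)
    assume "\<not> k \<le> ?V r2 \<rho>"
    have "AE x in lborel. \<rho> < norm x \<longrightarrow> v x < k"
      using upper
    proof eventually_elim
      case (elim x)
      then show ?case
        using radial_profile_antimono[OF d \<kappa>0 r2 m \<rho>(1), of "norm x"] \<open>\<not> k \<le> ?V r2 \<rho>\<close> by auto
    qed
    then have "\<rho> \<in> S" using \<rho> by (simp add: S_def)
    then show False using cInf_lower[OF _ S_bdd] \<rho> by (fastforce simp: r2_def)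
  qed
  have "r2 \<le> r1" by (rule critical_radius_unique[OF d \<kappa>0 m r1 r2 below above])
  with r12 have r: "r1 = r2" by simp
  have "AE x in lborel. v x = ?V r1 (norm x)"
    using lower upper unfolding r by eventually_elim simp
  from uv AE_completion[OF this] have "AE x in lebesgue. u x = ?V r1 (norm x)"
    by eventually_elim simp
  with r1 show ?thesis using below above unfolding r by (rule that)
qed

theorem mainTheorem11:
  fixes m k :: real and u :: "real^'d::finite \<Rightarrow> real"
  assumes "2 \<le> CARD('d)" and "0 < m" and "0 < k"
    and "is_solution m k u" and "compactly_supported u"
  shows "(\<forall>v. is_solution m k v \<and> compactly_supported v \<longrightarrow> (AE x in lebesgue. v x = u x))
    \<and> spherically_symmetric u"
proof -
  define \<kappa> where "\<kappa> = 1 / (m * measure lborel (ball (0::real^'d) 1))"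
  have \<kappa>0: "0 < \<kappa>" using assms(2) content_ball_pos[of 1 "0::real^'d"] by (simp add: \<kappa>_def)
  let ?V = "radial_profile CARD('d) m \<kappa>"
  obtain r where r: "0 \<le> r" "AE x in lebesgue. u x = ?V r (norm x)"
    "\<And>\<rho>. r < \<rho> \<Longrightarrow> ?V r \<rho> < k" "\<And>\<rho>. 0 < \<rho> \<Longrightarrow> \<rho> < r \<Longrightarrow> k \<le> ?V r \<rho>"
    using solution_eq_radial_profile[OF assms(1-3) \<kappa>_def assms(4,5)] by blast
  have "AE x in lebesgue. v x = u x" if v: "is_solution m k v" "compactly_supported v" for v :: "real^'d \<Rightarrow> real"
  proof -
    obtain s where s: "0 \<le> s" "AE x in lebesgue. v x = ?V s (norm x)"
      "\<And>\<rho>. s < \<rho> \<Longrightarrow> ?V s \<rho> < k" "\<And>\<rho>. 0 < \<rho> \<Longrightarrow> \<rho> < s \<Longrightarrow> k \<le> ?V s \<rho>"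
      using solution_eq_radial_profile[OF assms(1-3) \<kappa>_def v] by blast
    \<comment> \<open>The exterior bound of one radius meets the interior bound of the other;
      exchanging the roles gives the reverse inequality.\<close>
    have "r \<le> s" by (rule critical_radius_unique[OF assms(1) \<kappa>0 assms(2) s(1) r(1) s(3) r(4)])
    moreover have "s \<le> r" by (rule critical_radius_unique[OF assms(1) \<kappa>0 assms(2) r(1) s(1) r(3) s(4)])
    ultimately have "s = r" by simp
    show ?thesis using r(2) s(2) unfolding \<open>s = r\<close> by eventually_elim simp
  qed
  moreover have "spherically_symmetric u"
    using r(2) by (auto simp: spherically_symmetric_def)
  ultimately show ?thesis by blast
qed

end
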